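(* Let $G$ be a reductive algebraic group over $\mathbb C$ with Lie algebra $\mathfrak g$, let $e\in\mathfrak g$ be a nonzero nilpotent element and $\{e,h,f\}$ an $\mathfrak{sl}_2$-triple. Then for any two MV slices $\mathcal M_1,\mathcal M_2$ (with respect to $\{e,h,f\}$) there is a $\mathbb C^\times$-equivariant isomorphism of affine Poisson varieties $\mathcal M_1\cong\mathcal M_2$.
   Context: An MV slice is an affine subspace $\mathcal M=e+C\subset\mathfrak g$, where $C\subset\mathfrak g$ is an $\mathrm{ad}_h$-invariant subspace with $\mathfrak g=[\mathfrak g,e]\oplus C$ (for example $C=\mathfrak g^f$, the Slodowy slice). Let $(\cdot,\cdot)$ be a nondegenerate $G$-invariant symmetric bilinear form on $\mathfrak g$ (the Killing form in the semisimple case), used to identify $\mathfrak g\cong\mathfrak g^*$. Let $\gamma(t)\in G$ be the image of $\mathrm{diag}(t,t^{-1})$ under the homomorphism $SL_2\to G$ given by the triple. The $\mathbb C^\times$-action (Kazhdan action) on $\mathfrak g$ is $\rho(t)\cdot x=t^2\,\mathrm{Ad}(\gamma(t^{-1}))(x)$; it preserves every MV slice. Poisson structure on $\mathcal M$: let $\mathfrak g=\bigoplus_i\mathfrak g_i$ be the $\mathrm{ad}_h$-weight decomposition, $\mathfrak l\subset\mathfrak g_{-1}$ a Lagrangian subspace for the symplectic form $\langle x,y\rangle=(e,[x,y])$, $\mathfrak m=\mathfrak l\oplus\bigoplus_{i\le-2}\mathfrak g_i$, $M\subset G$ the corresponding unipotent subgroup, and $\mathfrak m^\perp$ its orthogonal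 complement. The adjoint action gives an isomorphism $M\times\mathcal M\cong e+\mathfrak m^\perp$, and $e+\mathfrak m^\perp=\mu^{-1}(e)$ is the fibre of the moment map $\mu:\mathfrak g^*\to\mathfrak m^*$ over the restriction of $(e,\cdot)$ to $\mathfrak m$. Hence $\mathcal M\cong\mu^{-1}(e)/M$ and $\mathbb C[\mathcal M]\cong(\mathbb C[\mathfrak g]/I(\mu^{-1}(e)))^M$, which carries the Poisson bracket obtained by Hamiltonian reduction from the Kostant-Kirillov-Souriau bracket on $\mathfrak g^*\cong\mathfrak g$. *)

theory Defs
  imports "HOL-Analysis.Analysis"
begin

section \<open>Complex matrices and polynomial functions\<close>

type_synonym ('n, 'm) cmat = "complex ^ 'n ^ 'm"

text \<open>
  The scalar product \<open>(*s)\<close> of the library does not apply here: on \<open>complex ^ 'n ^ 'n\<close> its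
  scalars are the entries of the outer vector, i.e. rows.
\<close>

definition cscale :: "complex \<Rightarrow> ('n::finite, 'm::finite) cmat \<Rightarrow> ('n, 'm) cmat" (infixr "\<bullet>\<^sub>C" 75)
  where "c \<bullet>\<^sub>C A = (\<chi> i j. c * A $ i $ j)"

global_interpretation cmat: vector_space "cscale :: complex \<Rightarrow> ('n::finite, 'm::finite) cmat \<Rightarrow> _"
  by standard (simp_all add: cscale_def vec_eq_iff algebra_simps)

inductive cpoly :: "(('n::finite, 'm::finite) cmat \<Rightarrow> complex) \<Rightarrow> bool" where
  coord: "cpoly (\<lambda>A. A $ i $ j)"
| const: "cpoly (\<lambda>A. c)"
| add: "cpoly p \<Longrightarrow> cpoly q \<Longrightarrow> cpoly (\<lambda>A. p A + q A)"
| mult: "cpoly p \<Longrightarrow> cpoly q \<Longrightarrow> cpoly (\<lambda>A. p A * q A)"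

definition dir_deriv ::
    "(('n::finite, 'm::finite) cmat \<Rightarrow> complex) \<Rightarrow> ('n, 'm) cmat \<Rightarrow> ('n, 'm) cmat \<Rightarrow> complex"
  where "dir_deriv p A X = deriv (\<lambda>t. p (A + t \<bullet>\<^sub>C X)) 0"

text \<open>
  Regular functions and regular maps on a Zariski closed subset \<open>V\<close> of a space of matrices. Only
  the values on \<open>V\<close> matter.
\<close>

definition regular_fun :: "('n::finite, 'm::finite) cmat set \<Rightarrow> (('n, 'm) cmat \<Rightarrow> complex) \<Rightarrow> bool"
  where "regular_fun V F \<longleftrightarrow> (\<exists>p. cpoly p \<and> (\<forall>x\<in>V. F x = p x))"

definition regular_map :: "('n::finite, 'm::finite) cmat set \<Rightarrow> (('n, 'm) cmat \<Rightarrow> ('k::finite, 'l::finite) cmat) \<Rightarrow> bool"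
  where "regular_map V \<phi> \<longleftrightarrow> (\<forall>i j. regular_fun V (\<lambda>x. \<phi> x $ i $ j))"

definition variety_iso ::
    "('n::finite, 'm::finite) cmat set \<Rightarrow> ('k::finite, 'l::finite) cmat set \<Rightarrow> (('n, 'm) cmat \<Rightarrow> ('k, 'l) cmat) \<Rightarrow> bool"
  where "variety_iso V W \<phi> \<longleftrightarrow>
    regular_map V \<phi> \<and> \<phi> ` V \<subseteq> W \<and>
    (\<exists>\<psi>. regular_map W \<psi> \<and> \<psi> ` W \<subseteq> V \<and> (\<forall>x\<in>V. \<psi> (\<phi> x) = x) \<and> (\<forall>y\<in>W. \<phi> (\<psi> y) = y))"

section \<open>Linear algebraic groups\<close>

text \<open>
  Affine algebraic groups over the complex numbers are taken in the form of Zariski closed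
  subgroups of the general linear group.
\<close>

definition zariski_closed_GL :: "('n::finite, 'n) cmat set \<Rightarrow> bool"
  where "zariski_closed_GL Z \<longleftrightarrow>
    (\<exists>S. (\<forall>p\<in>S. cpoly p) \<and> Z = {A. invertible A \<and> (\<forall>p\<in>S. p A = 0)})"

definition algebraic_group :: "('n::finite, 'n) cmat set \<Rightarrow> bool"
  where "algebraic_group G \<longleftrightarrow>
    zariski_closed_GL G \<and> mat 1 \<in> G \<and>
    (\<forall>A\<in>G. \<forall>B\<in>G. A ** B \<in> G) \<and> (\<forall>A\<in>G. matrix_inv A \<in> G)"

definition zariski_connected :: "('n::finite, 'n) cmat set \<Rightarrow> bool"
  where "zariski_connected Z \<longleftrightarrow>
    \<not> (\<exists>Z1 Z2. zariski_closed_GL Z1 \<and> zariski_closed_GL Z2 \<and> Z1 \<noteq> {} \<and> Z2 \<noteq> {} \<and>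
        Z1 \<inter> Z2 = {} \<and> Z1 \<union> Z2 = Z)"

definition nilpotent_mat :: "('n::finite, 'n) cmat \<Rightarrow> bool"
  where "nilpotent_mat A \<longleftrightarrow> (\<exists>k. (((**) A) ^^ k) (mat 1) = 0)"

definition unipotent_group :: "('n::finite, 'n) cmat set \<Rightarrow> bool"
  where "unipotent_group U \<longleftrightarrow> algebraic_group U \<and> (\<forall>A\<in>U. nilpotent_mat (A - mat 1))"

text \<open>
  Reductive means that the unipotent radical is trivial; \<open>G\<close> itself need not be connected.
\<close>

definition reductive_group :: "('n::finite, 'n) cmat set \<Rightarrow> bool"
  where "reductive_group G \<longleftrightarrow>
    algebraic_group G \<and>
    (\<forall>U. U \<subseteq> G \<and> unipotent_group U \<and> zariski_connected U \<and>
         (\<forall>A\<in>G. \<forall>B\<in>U. A ** B ** matrix_inv A \<in> U) \<longrightarrow> U = {mat 1})"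

text \<open>The Lie algebra is the Zariski tangent space at the identity.\<close>

definition lie_algebra :: "('n::finite, 'n) cmat set \<Rightarrow> ('n, 'n) cmat set"
  where "lie_algebra G =
    {X. \<forall>p. cpoly p \<and> (\<forall>A\<in>G. p A = 0) \<longrightarrow> dir_deriv p (mat 1) X = 0}"

definition bracket :: "('n::finite, 'n) cmat \<Rightarrow> ('n, 'n) cmat \<Rightarrow> ('n, 'n) cmat"
  where "bracket X Y = X ** Y - Y ** X"

definition Ad :: "('n::finite, 'n) cmat \<Rightarrow> ('n, 'n) cmat \<Rightarrow> ('n, 'n) cmat"
  where "Ad A X = A ** X ** matrix_inv A"

section \<open>The \<open>SL\<^sub>2\<close>-homomorphism of an \<open>\<ss>\<ll>\<^sub>2\<close>-triple and the Kazhdan action\<close>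

definition sl2_triple ::
    "('n::finite, 'n) cmat set \<Rightarrow> ('n, 'n) cmat \<Rightarrow> ('n, 'n) cmat \<Rightarrow> ('n, 'n) cmat \<Rightarrow> bool"
  where "sl2_triple \<gg> e h f \<longleftrightarrow>
    e \<in> \<gg> \<and> h \<in> \<gg> \<and> f \<in> \<gg> \<and>
    bracket h e = 2 \<bullet>\<^sub>C e \<and> bracket h f = (-2) \<bullet>\<^sub>C f \<and> bracket e f = h"

definition SL2 :: "(2, 2) cmat set"
  where "SL2 = {A. det A = 1}"

text \<open>
  The differential at the identity of a map that is regular on \<open>V\<close>, evaluated on a vector \<open>X\<close>
  tangent to \<open>V\<close>; it does not depend on the polynomial extension \<open>P\<close>.
\<close>

definition has_differential_at_one ::
    "('k::finite, 'k) cmat set \<Rightarrow> (('k, 'k) cmat \<Rightarrow> ('n::finite, 'n) cmat) \<Rightarrow>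
     ('k, 'k) cmat \<Rightarrow> ('n, 'n) cmat \<Rightarrow> bool"
  where "has_differential_at_one V \<phi> X Y \<longleftrightarrow>
    (\<exists>P. (\<forall>i j. cpoly (\<lambda>A. P A $ i $ j)) \<and> (\<forall>A\<in>V. P A = \<phi> A) \<and>
         (\<forall>i j. dir_deriv (\<lambda>A. P A $ i $ j) (mat 1) X = Y $ i $ j))"

definition sl2_hom ::
    "('n::finite, 'n) cmat set \<Rightarrow> ('n, 'n) cmat \<Rightarrow> ('n, 'n) cmat \<Rightarrow> ('n, 'n) cmat \<Rightarrow>
     ((2, 2) cmat \<Rightarrow> ('n, 'n) cmat) \<Rightarrow> bool"
  where "sl2_hom G e h f \<Phi> \<longleftrightarrow>
    \<Phi> ` SL2 \<subseteq> G \<and> regular_map SL2 \<Phi> \<and>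
    (\<forall>A\<in>SL2. \<forall>B\<in>SL2. \<Phi> (A ** B) = \<Phi> A ** \<Phi> B) \<and>
    has_differential_at_one SL2 \<Phi> (vector [vector [0, 1], vector [0, 0]]) e \<and>
    has_differential_at_one SL2 \<Phi> (vector [vector [1, 0], vector [0, -1]]) h \<and>
    has_differential_at_one SL2 \<Phi> (vector [vector [0, 0], vector [1, 0]]) f"

definition cocharacter :: "((2, 2) cmat \<Rightarrow> ('n::finite, 'n) cmat) \<Rightarrow> complex \<Rightarrow> ('n, 'n) cmat"
  where "cocharacter \<Phi> t = \<Phi> (vector [vector [t, 0], vector [0, inverse t]])"

definition kazhdan ::
    "((2, 2) cmat \<Rightarrow> ('n::finite, 'n) cmat) \<Rightarrow> complex \<Rightarrow> ('n, 'n) cmat \<Rightarrow> ('n, 'n) cmat"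
  where "kazhdan \<Phi> t x = (t ^ 2) \<bullet>\<^sub>C Ad (cocharacter \<Phi> (inverse t)) x"

section \<open>MV slices\<close>

text \<open>The conditions on \<open>C\<close> say that \<open>\<gg> = [\<gg>, e] \<oplus> C\<close> with \<open>C\<close> stable under \<open>ad h\<close>.\<close>

definition mv_slice ::
    "('n::finite, 'n) cmat set \<Rightarrow> ('n, 'n) cmat \<Rightarrow> ('n, 'n) cmat \<Rightarrow> ('n, 'n) cmat set \<Rightarrow> bool"
  where "mv_slice \<gg> e h \<M> \<longleftrightarrow>
    (\<exists>C. cmat.subspace C \<and> C \<subseteq> \<gg> \<and> (\<forall>x\<in>C. bracket h x \<in> C) \<and>
         \<gg> = {bracket x e + c |x c. x \<in> \<gg> \<and> c \<in> C} \<and>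
         (\<lambda>x. bracket x e) ` \<gg> \<inter> C = {0} \<and>
         \<M> = {e + c |c. c \<in> C})"

section \<open>The Poisson structure of an MV slice\<close>

definition nondeg_invariant_form ::
    "('n::finite, 'n) cmat set \<Rightarrow> (('n, 'n) cmat \<Rightarrow> ('n, 'n) cmat \<Rightarrow> complex) \<Rightarrow> bool"
  where "nondeg_invariant_form G \<beta> \<longleftrightarrow>
    (let \<gg> = lie_algebra G in
      (\<forall>x\<in>\<gg>. \<forall>y\<in>\<gg>. \<forall>z\<in>\<gg>. \<beta> (x + y) z = \<beta> x z + \<beta> y z) \<and>
      (\<forall>c. \<forall>x\<in>\<gg>. \<forall>y\<in>\<gg>. \<beta> (c \<bullet>\<^sub>C x) y = c * \<beta> x y) \<and>
      (\<forall>x\<in>\<gg>. \<forall>y\<in>\<gg>. \<beta> x y = \<beta> y x) \<and>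
      (\<forall>A\<in>G. \<forall>x\<in>\<gg>. \<forall>y\<in>\<gg>. \<beta> (Ad A x) (Ad A y) = \<beta> x y) \<and>
      (\<forall>x\<in>\<gg>. (\<forall>y\<in>\<gg>. \<beta> x y = 0) \<longrightarrow> x = 0))"

definition weight_space ::
    "('n::finite, 'n) cmat set \<Rightarrow> ('n, 'n) cmat \<Rightarrow> int \<Rightarrow> ('n, 'n) cmat set"
  where "weight_space \<gg> h i = {x \<in> \<gg>. bracket h x = of_int i \<bullet>\<^sub>C x}"

text \<open>
  \<open>\<ll>\<close> is a subspace of \<open>\<gg>\<^sub>-\<^sub>1\<close> that equals its own orthogonal complement for the symplectic form
  \<open>\<langle>x, y\<rangle> = (e, [x, y])\<close>.
\<close>

definition lagrangian ::
    "('n::finite, 'n) cmat set \<Rightarrow> (('n, 'n) cmat \<Rightarrow> ('n, 'n) cmat \<Rightarrow> complex) \<Rightarrow>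
     ('n, 'n) cmat \<Rightarrow> ('n, 'n) cmat \<Rightarrow> ('n, 'n) cmat set \<Rightarrow> bool"
  where "lagrangian \<gg> \<beta> e h \<ll> \<longleftrightarrow>
    cmat.subspace \<ll> \<and>
    \<ll> = {x \<in> weight_space \<gg> h (-1). \<forall>y\<in>\<ll>. \<beta> e (bracket x y) = 0}"

definition premet_subalgebra ::
    "('n::finite, 'n) cmat set \<Rightarrow> ('n, 'n) cmat \<Rightarrow> ('n, 'n) cmat set \<Rightarrow> ('n, 'n) cmat set"
  where "premet_subalgebra \<gg> h \<ll> = cmat.span (\<ll> \<union> (\<Union>i\<in>{..-2}. weight_space \<gg> h i))"

text \<open>
  The fibre \<open>\<mu>\<^sup>-\<^sup>1(e)\<close> of the moment map \<open>\<gg> \<cong> \<gg>\<^sup>* \<rightarrow> \<mm>\<^sup>*\<close>, \<open>x \<mapsto> (x, \<cdot>)|\<^sub>\<mm>\<close>; this is \<open>e + \<mm>\<^sup>\<bottom>\<close>.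
\<close>

definition moment_fibre ::
    "('n::finite, 'n) cmat set \<Rightarrow> (('n, 'n) cmat \<Rightarrow> ('n, 'n) cmat \<Rightarrow> complex) \<Rightarrow>
     ('n, 'n) cmat set \<Rightarrow> ('n, 'n) cmat \<Rightarrow> ('n, 'n) cmat set"
  where "moment_fibre \<gg> \<beta> \<mm> e = {x \<in> \<gg>. \<forall>y\<in>\<mm>. \<beta> x y = \<beta> e y}"

text \<open>
  The differential of \<open>F\<close> at \<open>x\<close>, an element of \<open>\<gg>\<^sup>*\<close>, becomes an element of \<open>\<gg>\<close> under the
  identification by the form. The Kostant-Kirillov-Souriau bracket \<open>{F, H}(\<xi>) = \<xi>([dF, dH])\<close> is
  transported to \<open>\<gg>\<close> in the same way.
\<close>

definition gradient ::
    "('n::finite, 'n) cmat set \<Rightarrow> (('n, 'n) cmat \<Rightarrow> ('n, 'n) cmat \<Rightarrow> complex) \<Rightarrow>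
     (('n, 'n) cmat \<Rightarrow> complex) \<Rightarrow> ('n, 'n) cmat \<Rightarrow> ('n, 'n) cmat"
  where "gradient \<gg> \<beta> F x = (THE u. u \<in> \<gg> \<and> (\<forall>y\<in>\<gg>. \<beta> u y = dir_deriv F x y))"

definition kks_bracket ::
    "('n::finite, 'n) cmat set \<Rightarrow> (('n, 'n) cmat \<Rightarrow> ('n, 'n) cmat \<Rightarrow> complex) \<Rightarrow>
     (('n, 'n) cmat \<Rightarrow> complex) \<Rightarrow> (('n, 'n) cmat \<Rightarrow> complex) \<Rightarrow> ('n, 'n) cmat \<Rightarrow> complex"
  where "kks_bracket \<gg> \<beta> F H x = \<beta> x (bracket (gradient \<gg> \<beta> F x) (gradient \<gg> \<beta> H x))"

text \<open>
  A polynomial representing the element of \<open>(\<complex>[\<gg>] / I(\<mu>\<^sup>-\<^sup>1(e)))\<^sup>M\<close> that corresponds to the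
  regular function \<open>F\<close> on the slice \<open>\<M>\<close>. The bracket on \<open>\<complex>[\<M>]\<close> is the Hamiltonian reduction
  bracket: take the bracket of representatives and restrict it to \<open>\<M>\<close>. On \<open>\<M>\<close> the result does
  not depend on the chosen representatives, since \<open>F\<close> determines them modulo \<open>I(\<mu>\<^sup>-\<^sup>1(e))\<close>.
\<close>

definition invariant_representative ::
    "('n::finite, 'n) cmat set \<Rightarrow> ('n, 'n) cmat set \<Rightarrow> ('n, 'n) cmat set \<Rightarrow>
     (('n, 'n) cmat \<Rightarrow> complex) \<Rightarrow> (('n, 'n) cmat \<Rightarrow> complex) \<Rightarrow> bool"
  where "invariant_representative fibre M \<M> F F' \<longleftrightarrow>
    cpoly F' \<and> (\<forall>A\<in>M. \<forall>x\<in>fibre. F' (Ad A x) = F' x) \<and> (\<forall>x\<in>\<M>. F' x = F x)"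

definition slice_bracket ::
    "('n::finite, 'n) cmat set \<Rightarrow> (('n, 'n) cmat \<Rightarrow> ('n, 'n) cmat \<Rightarrow> complex) \<Rightarrow>
     ('n, 'n) cmat set \<Rightarrow> ('n, 'n) cmat set \<Rightarrow> ('n, 'n) cmat set \<Rightarrow>
     (('n, 'n) cmat \<Rightarrow> complex) \<Rightarrow> (('n, 'n) cmat \<Rightarrow> complex) \<Rightarrow> ('n, 'n) cmat \<Rightarrow> complex"
  where "slice_bracket \<gg> \<beta> fibre M \<M> F H =
    kks_bracket \<gg> \<beta> (SOME F'. invariant_representative fibre M \<M> F F')
                    (SOME H'. invariant_representative fibre M \<M> H H')"

definition poisson_iso ::
    "('n::finite, 'm::finite) cmat set \<Rightarrow>
     ((('n, 'm) cmat \<Rightarrow> complex) \<Rightarrow> (('n, 'm) cmat \<Rightarrow> complex) \<Rightarrow> ('n, 'm) cmat \<Rightarrow> complex) \<Rightarrow>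
     ('k::finite, 'l::finite) cmat set \<Rightarrow>
     ((('k, 'l) cmat \<Rightarrow> complex) \<Rightarrow> (('k, 'l) cmat \<Rightarrow> complex) \<Rightarrow> ('k, 'l) cmat \<Rightarrow> complex) \<Rightarrow>
     (('n, 'm) cmat \<Rightarrow> ('k, 'l) cmat) \<Rightarrow> bool"
  where "poisson_iso V brV W brW \<phi> \<longleftrightarrow>
    variety_iso V W \<phi> \<and>
    (\<forall>F H. regular_fun W F \<and> regular_fun W H \<longrightarrow>
       (\<forall>x\<in>V. brV (F \<circ> \<phi>) (H \<circ> \<phi>) x = brW F H (\<phi> x)))"

end

theory Submission
  imports Defs
begin

text \<open>
  Every \<open>M\<close>-orbit in the fibre \<open>e + \<mm>\<^sup>\<bottom>\<close> of the moment map meets each MV slice in exactly one point, and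
  the projection of the fibre to a slice along the orbits is polynomial: \<open>exp (ad y)\<close> with \<open>y \<in> \<mm>\<close> of
  weight \<open>i - 2\<close> changes a point of the fibre in weight \<open>i\<close> by \<open>[y, e]\<close> and otherwise only in lower
  weights, so the components outside the slice can be removed one weight after the other, starting from
  the top. Sending a point of the first slice to the point of the second slice on its \<open>M\<close>-orbit is an
  isomorphism. It preserves the bracket because the Kostant-Kirillov-Souriau bracket of \<open>M\<close>-invariant
  functions is constant along the orbits, and it is equivariant because the cocharacter normalizes \<open>M\<close>.
\<close>

section \<open>Complex matrices\<close>

text \<open>\<open>G\<close> and \<open>M\<close> are given only by polynomial equations and
  \<open>\<mm>\<close> only as a tangent space, so the passage between \<open>y\<close> and
  \<open>exp y\<close> has to be justified algebraically. Negative weights make this possible: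
  elements of \<open>wle (-1)\<close> are nilpotent matrices, their exponentials are finite sums,
  and a polynomial evaluated along \<open>exp (t y)\<close> is a polynomial in \<open>t\<close>.
  Conversely, interpolating the powers of a unipotent matrix gives its logarithm, so
  \<open>M\<close> is exactly \<open>exp \<mm>\<close>. The grading comes from
  \<open>\<Phi>\<close>: on the diagonal torus it is a Laurent polynomial, whose coefficients are
  the projections to the eigenspaces of \<open>h\<close>. Removing one weight works because
  \<open>[\<gg>, e]\<close> contains all positive weights, which forces \<open>C\<close> into
  weights at most 0, and because \<open>ad e\<close> is injective on negative weights, which makes
  the correction \<open>y\<close> unique. The delicate point for the bracket is that representatives
  are invariant on the fibre only: their gradients are equivariant only modulo the orthogonal of
  \<open>\<mm>\<^sup>\<bottom>\<close>, which is \<open>\<mm>\<close>, and the resulting extra terms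
  must be shown to vanish.\<close>

lemma cscale_nth [simp]: "(c \<bullet>\<^sub>C A) $ i $ j = c * A $ i $ j"
  by (simp add: cscale_def)

lemma matrix_add_rdistrib: "((A::('n::finite,'m::finite) cmat) + B) ** (C::('k::finite,'n) cmat) = A ** C + B ** C"
  by (simp add: matrix_matrix_mult_def vec_eq_iff sum.distrib algebra_simps)

lemma matrix_diff_ldistrib: "(A::('n::finite,'m::finite) cmat) ** ((B::('k::finite,'n) cmat) - C) = A ** B - A ** C"
  by (simp add: matrix_matrix_mult_def vec_eq_iff sum_subtractf algebra_simps)

lemma matrix_diff_rdistrib: "((A::('n::finite,'m::finite) cmat) - B) ** (C::('k::finite,'n) cmat) = A ** C - B ** C"
  by (simp add: matrix_matrix_mult_def vec_eq_iff sum_subtractf algebra_simps)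

lemma matrix_mult_zero [simp]:
  "(A::('n::finite,'m::finite) cmat) ** (0::('k::finite,'n) cmat) = 0"
  "(0::('n::finite,'m::finite) cmat) ** (B::('k::finite,'n) cmat) = 0"
  by (simp_all add: matrix_matrix_mult_def vec_eq_iff)

lemma matrix_mult_minus:
  "(A::('n::finite,'m::finite) cmat) ** (- (B::('k::finite,'n) cmat)) = - (A ** B)"
  "(- (A::('n::finite,'m::finite) cmat)) ** (B::('k::finite,'n) cmat) = - (A ** B)"
  by (simp_all add: matrix_matrix_mult_def vec_eq_iff sum_negf)

lemma matrix_mult_cscale [simp]:
  "(A::('n::finite,'m::finite) cmat) ** (c \<bullet>\<^sub>C (B::('k::finite,'n) cmat)) = c \<bullet>\<^sub>C (A ** B)"
  "(c \<bullet>\<^sub>C (A::('n::finite,'m::finite) cmat)) ** (B::('k::finite,'n) cmat) = c \<bullet>\<^sub>C (A ** B)"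
  by (simp_all add: matrix_matrix_mult_def vec_eq_iff sum_distrib_left algebra_simps)

lemma matrix_mult_sum_right:
  "(A::('n::finite,'m::finite) cmat) ** (\<Sum>i\<in>I. (B i::('k::finite,'n) cmat)) = (\<Sum>i\<in>I. A ** B i)"
  by (induction I rule: infinite_finite_induct) (simp_all add: matrix_add_ldistrib)

lemma matrix_mult_sum_left:
  "(\<Sum>i\<in>I. (A i::('n::finite,'m::finite) cmat)) ** (B::('k::finite,'n) cmat) = (\<Sum>i\<in>I. A i ** B)"
  by (induction I rule: infinite_finite_induct) (simp_all add: matrix_add_rdistrib)

lemma cscale_cscale: "a \<bullet>\<^sub>C b \<bullet>\<^sub>C A = (a * b) \<bullet>\<^sub>C A"
  by (simp add: cmat.scale_scale)

lemmas matrix_distribs = matrix_add_ldistrib matrix_add_rdistrib matrix_diff_ldistrib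
  matrix_diff_rdistrib matrix_mult_minus matrix_mult_sum_right matrix_mult_sum_left

lemma bracket_add_left: "bracket (x + y) z = bracket x z + bracket y z"
  and bracket_add_right: "bracket x (y + z) = bracket x y + bracket x z"
  and bracket_diff_left: "bracket (x - y) z = bracket x z - bracket y z"
  and bracket_diff_right: "bracket x (y - z) = bracket x y - bracket x z"
  and bracket_cscale_left [simp]: "bracket (c \<bullet>\<^sub>C x) y = c \<bullet>\<^sub>C bracket x y"
  and bracket_cscale_right [simp]: "bracket x (c \<bullet>\<^sub>C y) = c \<bullet>\<^sub>C bracket x y"
  and bracket_zero [simp]: "bracket 0 x = 0" "bracket x 0 = 0" "bracket x x = 0"
  and bracket_swap: "bracket x y = - bracket y x"
  by (simp_all add: bracket_def matrix_distribs cmat.scale_right_diff_distrib)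

lemma bracket_minus [simp]: "bracket (- x) y = - bracket x y" "bracket x (- y) = - bracket x y"
  by (simp_all add: bracket_def matrix_distribs)

lemma bracket_jacobi: "bracket x (bracket y z) = bracket (bracket x y) z + bracket y (bracket x z)"
  by (simp add: bracket_def matrix_distribs matrix_mul_assoc)

lemma matrix_inv_works:
  assumes "invertible (A::('n::finite,'n) cmat)"
  shows "A ** matrix_inv A = mat 1" "matrix_inv A ** A = mat 1"
  using someI_ex[OF assms[unfolded invertible_def]] by (simp_all add: matrix_inv_def)

lemma matrix_inv_eqI:
  assumes "A ** B = mat 1" "B ** A = mat (1::complex)"
  shows "matrix_inv (A::('n::finite,'n) cmat) = B"
proof -
  have "invertible A" using assms by (auto simp: invertible_def)
  then have "B ** (A ** matrix_inv A) = B ** mat 1"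
    by (simp add: matrix_inv_works)
  then show ?thesis
    by (simp add: matrix_mul_assoc assms)
qed

section \<open>Powers and exponentials of nilpotent matrices\<close>

primrec mpow :: "('n::finite,'n) cmat \<Rightarrow> nat \<Rightarrow> ('n,'n) cmat" where
  "mpow X 0 = mat 1"
| "mpow X (Suc k) = X ** mpow X k"

lemma mpow_add: "mpow X (j + k) = mpow X j ** mpow X k"
  by (induction j) (simp_all add: matrix_mul_assoc)

lemma mpow_cscale: "mpow (c \<bullet>\<^sub>C X) k = c ^ k \<bullet>\<^sub>C mpow X k"
  by (induction k) (simp_all add: cscale_cscale)

lemma mpow_eq_0_mono: "mpow X k = 0 \<Longrightarrow> k \<le> l \<Longrightarrow> mpow X l = 0"
  by (metis le_add_diff_inverse matrix_mult_zero(2) mpow_add)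

lemma nilpotent_mat_mpow: "nilpotent_mat X \<longleftrightarrow> (\<exists>k. mpow X k = 0)"
proof -
  have "((**) X ^^ k) (mat 1) = mpow X k" for k
    by (induction k) simp_all
  then show ?thesis by (simp add: nilpotent_mat_def)
qed

text \<open>The truncated series is the exponential only when \<open>mpow X K = 0\<close>.\<close>

definition mexp :: "nat \<Rightarrow> ('n::finite,'n) cmat \<Rightarrow> ('n,'n) cmat"
  where "mexp K X = (\<Sum>k<K. (1 / fact k) \<bullet>\<^sub>C mpow X k)"

section \<open>Polynomial functions\<close>

text \<open>Entrywise, so that the derivative is complex and each rule reduces to
  \<open>has_field_derivative\<close> on scalars.\<close>

definition has_mderiv ::
    "(complex \<Rightarrow> ('n::finite,'m::finite) cmat) \<Rightarrow> ('n,'m) cmat \<Rightarrow> complex \<Rightarrow> bool"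
  where "has_mderiv a b t \<longleftrightarrow> (\<forall>i j. ((\<lambda>s. a s $ i $ j) has_field_derivative b $ i $ j) (at t))"

lemma has_mderiv_unique: "has_mderiv a b t \<Longrightarrow> has_mderiv a c t \<Longrightarrow> b = c"
  unfolding has_mderiv_def vec_eq_iff by (blast intro: DERIV_unique)

lemma has_mderiv_const: "has_mderiv (\<lambda>s. A) 0 t"
  by (simp add: has_mderiv_def)

lemma has_mderiv_add: "has_mderiv a b t \<Longrightarrow> has_mderiv c d t \<Longrightarrow> has_mderiv (\<lambda>s. a s + c s) (b + d) t"
  by (auto simp: has_mderiv_def intro!: DERIV_add)

lemma has_mderiv_sum:
  "(\<And>k. k \<in> I \<Longrightarrow> has_mderiv (a k) (b k) t) \<Longrightarrow> has_mderiv (\<lambda>s. \<Sum>k\<in>I. a k s) (\<Sum>k\<in>I. b k) t"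
  by (induction I rule: infinite_finite_induct) (simp_all add: has_mderiv_const has_mderiv_add)

lemma has_mderiv_cscale:
  "(f has_field_derivative f') (at t) \<Longrightarrow> has_mderiv (\<lambda>s. f s \<bullet>\<^sub>C A) (f' \<bullet>\<^sub>C A) t"
  by (auto simp: has_mderiv_def intro!: derivative_eq_intros)

lemma has_mderiv_mult:
  assumes "has_mderiv a a' t" "has_mderiv b b' t"
  shows "has_mderiv (\<lambda>s. a s ** b s) (a' ** b t + a t ** b') t"
  unfolding has_mderiv_def
proof (intro allI)
  fix i j
  have "((\<lambda>s. \<Sum>k\<in>UNIV. a s $ i $ k * b s $ k $ j) has_field_derivative
      (\<Sum>k\<in>UNIV. a' $ i $ k * b t $ k $ j + b' $ k $ j * a t $ i $ k)) (at t)"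
    using assms by (intro DERIV_sum DERIV_mult) (auto simp: has_mderiv_def)
  then show "((\<lambda>s. (a s ** b s) $ i $ j) has_field_derivative (a' ** b t + a t ** b') $ i $ j) (at t)"
    by (simp add: matrix_matrix_mult_def sum.distrib mult.commute)
qed

lemma has_mderiv_line: "has_mderiv (\<lambda>s. A + s \<bullet>\<^sub>C X) X t"
  using has_mderiv_add[OF has_mderiv_const has_mderiv_cscale[OF DERIV_ident], of A X t] by simp

lemma has_mderiv_zero_const:
  assumes "\<And>t. has_mderiv a 0 t"
  shows "a t = a s"
proof -
  have "((\<lambda>s. a s $ i $ j) has_field_derivative 0) (at u)" for i j u
    using assms[of u] by (simp add: has_mderiv_def)
  then have "a t $ i $ j = a s $ i $ j" for i j
    using has_field_derivative_zero_constant[of UNIV "\<lambda>s. a s $ i $ j"] by auto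
  then show ?thesis by (simp add: vec_eq_iff)
qed

text \<open>Structural induction on the polynomial; the \<open>c i j\<close> are its partial
  derivatives. They depend on the point alone and are polynomials again, so this one statement
  yields the chain rule, the linearity of \<open>dir_deriv\<close> in its direction and the
  possibility of differentiating repeatedly.\<close>

lemma cpoly_deriv:
  fixes p :: "('n::finite,'m::finite) cmat \<Rightarrow> complex"
  assumes "cpoly p"
  obtains c where "\<And>i j. cpoly (c i j)"
    "\<And>a b t. has_mderiv a b t \<Longrightarrow>
      ((\<lambda>s. p (a s)) has_field_derivative (\<Sum>i\<in>UNIV. \<Sum>j\<in>UNIV. c i j (a t) * b $ i $ j)) (at t)"
proof -
  have "\<exists>c. (\<forall>i j. cpoly (c i j)) \<and> (\<forall>a b t. has_mderiv a b t \<longrightarrow>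
      ((\<lambda>s. p (a s)) has_field_derivative (\<Sum>i\<in>UNIV. \<Sum>j\<in>UNIV. c i j (a t) * b $ i $ j)) (at t))"
    using assms
  proof induction
    case (coord i j)
    let ?c = "\<lambda>i' j' (A::('n,'m) cmat). if i' = i \<and> j' = j then 1 else 0 :: complex"
    have *: "(\<Sum>i'\<in>UNIV. \<Sum>j'\<in>UNIV. ?c i' j' A * b $ i' $ j') = b $ i $ j" for A b :: "('n,'m) cmat"
    proof -
      have "(\<Sum>j'\<in>UNIV. ?c i' j' A * b $ i' $ j') = (if i' = i then b $ i $ j else 0)" for i'
        by (auto simp: if_distrib if_distribR sum.delta cong: if_cong)
      then show ?thesis by simp
    qed
    have "\<forall>i j. cpoly (?c i j)" by (simp add: cpoly.const)
    moreover have "\<forall>a b t. has_mderiv a b t \<longrightarrow>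
      ((\<lambda>s. a s $ i $ j) has_field_derivative (\<Sum>i'\<in>UNIV. \<Sum>j'\<in>UNIV. ?c i' j' (a t) * b $ i' $ j')) (at t)"
      unfolding * by (simp add: has_mderiv_def)
    ultimately show ?case by (intro exI[of _ ?c]) blast
  next
    case (const c)
    show ?case
      by (intro exI[of _ "\<lambda>i j A. 0"]) (simp add: cpoly.const)
  next
    case (add p q)
    then obtain c d where *: "\<forall>i j. cpoly (c i j)" "\<forall>i j. cpoly (d i j)"
     "\<forall>a b t. has_mderiv a b t \<longrightarrow> ((\<lambda>s. p (a s)) has_field_derivative (\<Sum>i\<in>UNIV. \<Sum>j\<in>UNIV. c i j (a t) * b $ i $ j)) (at t)"
     "\<forall>a b t. has_mderiv a b t \<longrightarrow> ((\<lambda>s. q (a s)) has_field_derivative (\<Sum>i\<in>UNIV. \<Sum>j\<in>UNIV. d i j (a t) * b $ i $ j)) (at t)"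
      by blast
    show ?case
      using * by (intro exI[of _ "\<lambda>i j A. c i j A + d i j A"])
        (auto intro!: cpoly.add derivative_eq_intros simp: sum.distrib algebra_simps)
  next
    case (mult p q)
    then obtain c d where *: "\<forall>i j. cpoly (c i j)" "\<forall>i j. cpoly (d i j)"
     "\<forall>a b t. has_mderiv a b t \<longrightarrow> ((\<lambda>s. p (a s)) has_field_derivative (\<Sum>i\<in>UNIV. \<Sum>j\<in>UNIV. c i j (a t) * b $ i $ j)) (at t)"
     "\<forall>a b t. has_mderiv a b t \<longrightarrow> ((\<lambda>s. q (a s)) has_field_derivative (\<Sum>i\<in>UNIV. \<Sum>j\<in>UNIV. d i j (a t) * b $ i $ j)) (at t)"
      by blast
    let ?c = "\<lambda>i j A. c i j A * q A + p A * d i j A"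
    have "((\<lambda>s. p (a s) * q (a s)) has_field_derivative (\<Sum>i\<in>UNIV. \<Sum>j\<in>UNIV. ?c i j (a t) * b $ i $ j)) (at t)"
      if "has_mderiv a b t" for a b t
    proof -
      have "((\<lambda>s. p (a s) * q (a s)) has_field_derivative
         ((\<Sum>i\<in>UNIV. \<Sum>j\<in>UNIV. c i j (a t) * b $ i $ j) * q (a t) + (\<Sum>i\<in>UNIV. \<Sum>j\<in>UNIV. d i j (a t) * b $ i $ j) * p (a t))) (at t)"
        using * that by (intro DERIV_mult) auto
      moreover have "(\<Sum>i\<in>UNIV. \<Sum>j\<in>UNIV. c i j (a t) * b $ i $ j) * q (a t) + (\<Sum>i\<in>UNIV. \<Sum>j\<in>UNIV. d i j (a t) * b $ i $ j) * p (a t)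
        = (\<Sum>i\<in>UNIV. \<Sum>j\<in>UNIV. ?c i j (a t) * b $ i $ j)"
        by (simp add: sum_distrib_left sum.distrib algebra_simps)
      ultimately show ?thesis by simp
    qed
    moreover have "\<forall>i j. cpoly (?c i j)"
      using * mult.hyps by (auto intro!: cpoly.add cpoly.mult)
    ultimately show ?case by (intro exI[of _ ?c]) blast
  qed
  then show thesis using that by blast
qed

lemma dir_deriv_eq:
  assumes "((\<lambda>s. p (A + s \<bullet>\<^sub>C X)) has_field_derivative d) (at 0)"
  shows "dir_deriv p A X = d"
  using assms by (simp add: dir_deriv_def DERIV_imp_deriv)

lemma cpoly_chain:
  assumes "cpoly p" "has_mderiv a b t"
  shows "((\<lambda>s. p (a s)) has_field_derivative dir_deriv p (a t) b) (at t)"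
proof -
  obtain c where "\<And>i j. cpoly (c i j)" and c: "\<And>a b t. has_mderiv a b t \<Longrightarrow>
      ((\<lambda>s. p (a s)) has_field_derivative (\<Sum>i\<in>UNIV. \<Sum>j\<in>UNIV. c i j (a t) * b $ i $ j)) (at t)"
    by (rule cpoly_deriv[OF assms(1)]) blast
  have "dir_deriv p (a t) b = (\<Sum>i\<in>UNIV. \<Sum>j\<in>UNIV. c i j (a t) * b $ i $ j)"
    using dir_deriv_eq[OF c[OF has_mderiv_line]] by simp
  then show ?thesis using c[OF assms(2)] by simp
qed

lemma cpoly_line: "cpoly p \<Longrightarrow> ((\<lambda>s. p (A + s \<bullet>\<^sub>C X)) has_field_derivative dir_deriv p A X) (at 0)"
  using cpoly_chain[OF _ has_mderiv_line, of p A X 0] by simp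

lemma dir_deriv_linear:
  assumes "cpoly p"
  shows "dir_deriv p A (X + Y) = dir_deriv p A X + dir_deriv p A Y"
    "dir_deriv p A (k \<bullet>\<^sub>C X) = k * dir_deriv p A X"
proof -
  obtain c where "\<And>i j. cpoly (c i j)" and c: "\<And>a b t. has_mderiv a b t \<Longrightarrow>
      ((\<lambda>s. p (a s)) has_field_derivative (\<Sum>i\<in>UNIV. \<Sum>j\<in>UNIV. c i j (a t) * b $ i $ j)) (at t)"
    by (rule cpoly_deriv[OF assms(1)]) blast
  have "dir_deriv p A X = (\<Sum>i\<in>UNIV. \<Sum>j\<in>UNIV. c i j A * X $ i $ j)" for A X
    using dir_deriv_eq[OF c[OF has_mderiv_line]] by simp
  then show "dir_deriv p A (X + Y) = dir_deriv p A X + dir_deriv p A Y"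
    "dir_deriv p A (k \<bullet>\<^sub>C X) = k * dir_deriv p A X"
    by (simp_all add: sum_distrib_left sum.distrib algebra_simps)
qed

lemma dir_deriv_const [simp]: "dir_deriv (\<lambda>A. c) A X = 0"
  and dir_deriv_coord [simp]: "dir_deriv (\<lambda>A. A $ i $ j) A X = X $ i $ j"
  by (rule dir_deriv_eq; auto intro!: derivative_eq_intros)+

lemma dir_deriv_add: "cpoly p \<Longrightarrow> cpoly q \<Longrightarrow> dir_deriv (\<lambda>A. p A + q A) A X = dir_deriv p A X + dir_deriv q A X"
  by (rule dir_deriv_eq) (auto intro!: derivative_eq_intros cpoly_line)

lemma dir_deriv_mult:
  "cpoly p \<Longrightarrow> cpoly q \<Longrightarrow> dir_deriv (\<lambda>A. p A * q A) A X = dir_deriv p A X * q A + p A * dir_deriv q A X"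
  by (rule dir_deriv_eq) (auto intro!: derivative_eq_intros cpoly_line)

lemma cpoly_sum: "(\<And>i. i \<in> I \<Longrightarrow> cpoly (p i)) \<Longrightarrow> cpoly (\<lambda>A. \<Sum>i\<in>I. p i A)"
  by (induction I rule: infinite_finite_induct) (simp_all add: cpoly.const cpoly.add)

definition poly_map :: "(('n::finite,'m::finite) cmat \<Rightarrow> ('k::finite,'l::finite) cmat) \<Rightarrow> bool"
  where "poly_map f \<longleftrightarrow> (\<forall>i j. cpoly (\<lambda>A. f A $ i $ j))"

lemma cpoly_comp: "cpoly p \<Longrightarrow> poly_map f \<Longrightarrow> cpoly (\<lambda>A. p (f A))"
  by (induction rule: cpoly.induct) (auto simp: poly_map_def intro: cpoly.intros)

lemma poly_map_id: "poly_map (\<lambda>A. A)"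
  and poly_map_const: "poly_map (\<lambda>A. B)"
  and poly_map_add: "poly_map f \<Longrightarrow> poly_map g \<Longrightarrow> poly_map (\<lambda>A. f A + g A)"
  and poly_map_cscale: "poly_map f \<Longrightarrow> poly_map (\<lambda>A. c \<bullet>\<^sub>C f A)"
  by (simp_all add: poly_map_def cpoly.intros)

lemma poly_map_comp: "poly_map g \<Longrightarrow> poly_map f \<Longrightarrow> poly_map (\<lambda>A. g (f A))"
  unfolding poly_map_def[of g] poly_map_def[of "\<lambda>A. g (f A)"] using cpoly_comp by fastforce

lemma poly_map_mult: "poly_map f \<Longrightarrow> poly_map g \<Longrightarrow> poly_map (\<lambda>A. f A ** g A)"
  by (auto simp: poly_map_def matrix_matrix_mult_def intro!: cpoly_sum cpoly.mult)

lemma poly_map_sum: "(\<And>i. i \<in> I \<Longrightarrow> poly_map (f i)) \<Longrightarrow> poly_map (\<lambda>A. \<Sum>i\<in>I. f i A)"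
  by (induction I rule: infinite_finite_induct) (simp_all add: poly_map_const poly_map_add)

lemma poly_map_minus: "poly_map f \<Longrightarrow> poly_map (\<lambda>A. - f A)"
  using poly_map_cscale[of f "-1"] by (simp add: cmat.scale_minus_left)

lemma poly_map_diff: "poly_map f \<Longrightarrow> poly_map g \<Longrightarrow> poly_map (\<lambda>A. f A - g A)"
  using poly_map_add[OF _ poly_map_minus[of g], of f] by simp

lemma poly_map_mpow: "poly_map f \<Longrightarrow> poly_map (\<lambda>A. mpow (f A) k)"
  by (induction k) (simp_all add: poly_map_const poly_map_mult)

lemma poly_map_mexp: "poly_map f \<Longrightarrow> poly_map (\<lambda>A. mexp K (f A))"
  unfolding mexp_def by (intro poly_map_sum poly_map_cscale poly_map_mpow)

lemma cmat_expansion: "(A::('n::finite,'m::finite) cmat) = (\<Sum>i\<in>UNIV. \<Sum>j\<in>UNIV. (A $ i $ j) \<bullet>\<^sub>C axis i (axis j 1))"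
proof -
  have "(\<Sum>k\<in>UNIV. \<Sum>l\<in>UNIV. (A $ k $ l) \<bullet>\<^sub>C (axis k (axis l 1) :: ('n,'m) cmat)) $ i $ j = A $ i $ j" for i j
  proof -
    have "(\<Sum>k\<in>UNIV. \<Sum>l\<in>UNIV. A $ k $ l * (axis k (axis l 1) :: ('n,'m) cmat) $ i $ j)
       = (\<Sum>k\<in>UNIV. if k = i then (\<Sum>l\<in>UNIV. if l = j then A $ i $ j else 0) else 0)"
      by (intro sum.cong) (auto simp: axis_def if_distrib[of "\<lambda>x. _ * x"] cong: if_cong)
    also have "\<dots> = A $ i $ j"
      by simp
    finally show ?thesis by simp
  qed
  then show ?thesis by (simp add: vec_eq_iff)
qed

lemma poly_map_linear:
  assumes "\<And>x y. f (x + y) = f x + f y" "\<And>c x. f (c \<bullet>\<^sub>C x) = c \<bullet>\<^sub>C f x"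
  shows "poly_map (f :: ('n::finite,'m::finite) cmat \<Rightarrow> ('k::finite,'l::finite) cmat)"
proof -
  have f: "f A = (\<Sum>i\<in>UNIV. \<Sum>j\<in>UNIV. (A $ i $ j) \<bullet>\<^sub>C f (axis i (axis j 1)))" for A
  proof -
    have add: "Modules.additive f" by (simp add: Modules.additive_def assms)
    show ?thesis
      by (subst cmat_expansion) (simp add: Modules.additive.sum[OF add] assms)
  qed
  define F where "F = (\<lambda>A::('n,'m) cmat. \<Sum>i\<in>UNIV. \<Sum>j\<in>UNIV. (A $ i $ j) \<bullet>\<^sub>C f (axis i (axis j 1)))"
  have "poly_map F"
    unfolding F_def by (auto simp: poly_map_def intro!: cpoly_sum cpoly.mult cpoly.coord cpoly.const)
  moreover have "f = F"
    unfolding F_def by (rule ext) (rule f)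
  ultimately show ?thesis by simp
qed

section \<open>Polynomial curves\<close>

definition poly_curve :: "(complex \<Rightarrow> ('n::finite,'m::finite) cmat) \<Rightarrow> bool"
  where "poly_curve a \<longleftrightarrow> (\<forall>i j. \<exists>q. \<forall>t. a t $ i $ j = poly q t)"

lemma cpoly_poly_curve: "cpoly p \<Longrightarrow> poly_curve a \<Longrightarrow> \<exists>q. \<forall>t. p (a t) = poly q t"
proof (induction rule: cpoly.induct)
  case (const c)
  then show ?case by (intro exI[of _ "[:c:]"]) simp
next
  case (add p q)
  then show ?case by (metis poly_add)
next
  case (mult p q)
  then show ?case by (metis poly_mult)
qed (auto simp: poly_curve_def)

lemma poly_curve_const: "poly_curve (\<lambda>t. A)"
  unfolding poly_curve_def by (metis mult_zero_right add.right_neutral poly_pCons poly_0)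

lemma poly_curve_comp: "poly_map f \<Longrightarrow> poly_curve a \<Longrightarrow> poly_curve (\<lambda>t. f (a t))"
  unfolding poly_map_def poly_curve_def[of "\<lambda>t. f (a t)"] using cpoly_poly_curve by blast

lemma poly_curve_add: "poly_curve a \<Longrightarrow> poly_curve b \<Longrightarrow> poly_curve (\<lambda>t. a t + b t)"
  unfolding poly_curve_def by (metis poly_add vector_add_component)

lemma poly_curve_poly_cscale: "poly_curve (\<lambda>t. poly q t \<bullet>\<^sub>C A)"
  unfolding poly_curve_def by (metis cscale_nth mult.commute poly_smult)

lemma poly_curve_sum: "(\<And>i. i \<in> I \<Longrightarrow> poly_curve (a i)) \<Longrightarrow> poly_curve (\<lambda>t. \<Sum>i\<in>I. a i t)"
  by (induction I rule: infinite_finite_induct) (simp_all add: poly_curve_const poly_curve_add)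

lemma poly_curve_deriv:
  assumes "poly_curve a"
  obtains a' where "poly_curve a'" "\<And>t. has_mderiv a (a' t) t"
proof -
  obtain q where q: "a t $ i $ j = poly (q i j) t" for i j t
    using assms unfolding poly_curve_def by metis
  show thesis
  proof (rule that)
    show "poly_curve (\<lambda>t. \<chi> i j. poly (pderiv (q i j)) t)"
      by (auto simp: poly_curve_def)
    show "has_mderiv a (\<chi> i j. poly (pderiv (q i j)) t) t" for t
      by (simp add: has_mderiv_def q)
  qed
qed

text \<open>The natural numbers are infinitely many zeros of \<open>p - q\<close>. This carries
  identities between integer powers of a matrix over to complex exponents.\<close>

lemma poly_eq_on_nat:
  assumes "\<And>n. poly p (of_nat n) = poly q (of_nat n :: complex)"
  shows "p = q"
proof (rule ccontr)
  assume "p \<noteq> q"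
  then have "finite {x. poly (p - q) x = 0}" by (intro poly_roots_finite) simp
  moreover have "range of_nat \<subseteq> {x. poly (p - q) x = 0}" using assms by auto
  ultimately have "finite (range (of_nat :: nat \<Rightarrow> complex))" using finite_subset by blast
  moreover have "inj (of_nat :: nat \<Rightarrow> complex)" by (simp add: inj_of_nat)
  ultimately show False using finite_imageD infinite_UNIV_nat by blast
qed

lemma poly_curve_eq_on_nat:
  assumes "poly_curve a" "poly_curve b" "\<And>n. a (of_nat n) = b (of_nat n)"
  shows "a t = b t"
proof -
  have "a t $ i $ j = b t $ i $ j" for i j
  proof -
    obtain p q where "\<forall>t. a t $ i $ j = poly p t" "\<forall>t. b t $ i $ j = poly q t"
      using assms(1,2) unfolding poly_curve_def by blast
    then show ?thesis using poly_eq_on_nat[of p q] assms(3) by metis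
  qed
  then show ?thesis by (simp add: vec_eq_iff)
qed

section \<open>The exponential as a one-parameter group\<close>

lemma mexp_zero [simp]: "K > 0 \<Longrightarrow> mexp K 0 = mat 1"
proof -
  have "mpow 0 k = (if k = 0 then mat 1 else (0::('a,'a) cmat))" for k by (cases k) auto
  moreover assume "K > 0"
  ultimately show ?thesis
    by (simp add: mexp_def if_distrib[of "\<lambda>A. _ \<bullet>\<^sub>C A"] sum.delta cong: if_cong)
qed

lemma mexp_curve: "mexp K (t \<bullet>\<^sub>C X) = (\<Sum>k<K. (t ^ k / fact k) \<bullet>\<^sub>C mpow X k)"
  by (simp add: mexp_def mpow_cscale cscale_cscale)

lemma poly_curve_mexp: "poly_curve (\<lambda>t. mexp K (t \<bullet>\<^sub>C X))"
proof -
  have "poly_curve (\<lambda>t. t \<bullet>\<^sub>C X)" using poly_curve_poly_cscale[of "[:0,1:]" X] by simp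
  then show ?thesis using poly_curve_comp[OF poly_map_mexp[OF poly_map_id]] by blast
qed

lemma mexp_commute:
  assumes "X ** Y = Y ** X"
  shows "X ** mexp K Y = mexp K Y ** X"
proof -
  have "X ** mpow Y k = mpow Y k ** X" for k
    by (induction k) (simp, metis assms matrix_mul_assoc mpow.simps(2))
  then show ?thesis by (simp add: mexp_def matrix_distribs)
qed

text \<open>Differentiation shifts the series by one term, and the term with \<open>mpow X K\<close>
  that is then missing at the end is zero by hypothesis.\<close>

lemma has_mderiv_mexp:
  assumes "mpow X K = 0"
  shows "has_mderiv (\<lambda>t. mexp K (t \<bullet>\<^sub>C X)) (X ** mexp K (t \<bullet>\<^sub>C X)) t"
proof (cases K)
  case 0
  then show ?thesis by (simp add: mexp_def has_mderiv_const)
next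
  case (Suc L)
  have "has_mderiv (\<lambda>t. mexp K (t \<bullet>\<^sub>C X)) (\<Sum>k<K. (of_nat k * t ^ (k - 1) / fact k) \<bullet>\<^sub>C mpow X k) t"
    unfolding mexp_curve
    by (intro has_mderiv_sum has_mderiv_cscale) (auto intro!: derivative_eq_intros)
  also have "(\<Sum>k<K. (of_nat k * t ^ (k - 1) / fact k) \<bullet>\<^sub>C mpow X k) = (\<Sum>k<L. (t ^ k / fact k) \<bullet>\<^sub>C mpow X (Suc k))"
    unfolding Suc by (subst sum.lessThan_Suc_shift) (simp add: fact_Suc del: mpow.simps of_nat_Suc)
  also have "\<dots> = (\<Sum>k<K. (t ^ k / fact k) \<bullet>\<^sub>C mpow X (Suc k))"
    using assms by (simp add: Suc)
  also have "\<dots> = X ** mexp K (t \<bullet>\<^sub>C X)" by (simp add: mexp_curve matrix_distribs)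
  finally show ?thesis .
qed

lemma mpow_minus_eq_0: "mpow X K = 0 \<Longrightarrow> mpow (- X) K = 0"
  using mpow_cscale[of "-1" X K] by (simp add: cmat.scale_minus_left)

text \<open>Uniqueness for the linear equation \<open>a' = X a\<close>: the product has derivative
  zero because \<open>X\<close> commutes with its exponential. With \<open>a\<close> an exponential
  this gives the inverse; with \<open>a\<close> the interpolated powers of a unipotent matrix it
  shows that the matrix is an exponential.\<close>

lemma mexp_eq_of_ode:
  assumes X: "mpow X K = 0" and "K > 0" and a0: "a 0 = mat 1"
    and a: "\<And>t. has_mderiv a (X ** a t) t"
  shows "mexp K (t \<bullet>\<^sub>C (- X)) ** a t = mat 1"
proof -
  have "has_mderiv (\<lambda>t. mexp K (t \<bullet>\<^sub>C (- X)) ** a t) 0 t" for t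
  proof -
    have "has_mderiv (\<lambda>t. mexp K (t \<bullet>\<^sub>C (- X)) ** a t)
       (((- X) ** mexp K (t \<bullet>\<^sub>C (- X))) ** a t + mexp K (t \<bullet>\<^sub>C (- X)) ** (X ** a t)) t"
      by (intro has_mderiv_mult has_mderiv_mexp a mpow_minus_eq_0 X)
    moreover have "X ** mexp K (t \<bullet>\<^sub>C (- X)) = mexp K (t \<bullet>\<^sub>C (- X)) ** X"
      by (rule mexp_commute) (simp add: matrix_mult_minus)
    ultimately show ?thesis
      by (simp add: matrix_distribs matrix_mul_assoc)
  qed
  from has_mderiv_zero_const[OF this, of t 0] show ?thesis
    using assms(2) a0 by simp
qed

lemma mexp_inverse:
  assumes "mpow X K = 0" "K > 0"
  shows "mexp K X ** mexp K (- X) = mat 1" "mexp K (- X) ** mexp K X = mat 1"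
proof -
  have *: "mexp K (- X) ** mexp K X = mat 1" if "mpow X K = 0" for X
  proof -
    have "mexp K (1 \<bullet>\<^sub>C (- X)) ** mexp K (1 \<bullet>\<^sub>C X) = mat 1"
      using that assms(2) by (intro mexp_eq_of_ode has_mderiv_mexp) auto
    then show ?thesis by simp
  qed
  show "mexp K X ** mexp K (- X) = mat 1" "mexp K (- X) ** mexp K X = mat 1"
    using *[of X] *[of "- X"] assms mpow_minus_eq_0 by auto
qed

lemma matrix_inv_mexp: "mpow X K = 0 \<Longrightarrow> K > 0 \<Longrightarrow> matrix_inv (mexp K X) = mexp K (- X)"
  by (intro matrix_inv_eqI mexp_inverse)

lemma Ad_mexp: "mpow X K = 0 \<Longrightarrow> K > 0 \<Longrightarrow> Ad (mexp K X) x = mexp K X ** x ** mexp K (- X)"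
  by (simp add: Ad_def matrix_inv_mexp)

section \<open>Linear algebra\<close>

lemma cmat_in_span_axes: "(A::('n::finite,'m::finite) cmat) \<in> cmat.span ((\<lambda>(i,j). axis i (axis j 1)) ` UNIV)"
proof -
  have "axis i (axis j 1) \<in> cmat.span ((\<lambda>(i,j). axis i (axis j 1)) ` UNIV)" for i :: 'm and j :: 'n
    by (rule cmat.span_base) auto
  then show ?thesis
    by (subst cmat_expansion) (intro cmat.span_sum cmat.span_scale)
qed

text \<open>Prescribe the values on a basis of \<open>S\<close>; the agreement set is a subspace
  containing that basis. This serves maps that are linear on \<open>S\<close> only, whereas
  polynomial maps are defined on the whole matrix space.\<close>

lemma linear_extend:
  fixes f :: "('n::finite,'m::finite) cmat \<Rightarrow> ('k::finite,'l::finite) cmat"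
  assumes S: "cmat.subspace S"
    and add: "\<And>x y. x \<in> S \<Longrightarrow> y \<in> S \<Longrightarrow> f (x + y) = f x + f y"
    and scale: "\<And>c x. x \<in> S \<Longrightarrow> f (c \<bullet>\<^sub>C x) = c \<bullet>\<^sub>C f x"
  obtains g where "Vector_Spaces.linear cscale cscale g" "\<And>x. x \<in> S \<Longrightarrow> g x = f x"
proof -
  interpret vp: vector_space_pair "cscale :: complex \<Rightarrow> ('n,'m) cmat \<Rightarrow> _" "cscale :: complex \<Rightarrow> ('k,'l) cmat \<Rightarrow> _"
    by unfold_locales
  obtain B where B: "B \<subseteq> S" "cmat.independent B" "S \<subseteq> cmat.span B"
    by (rule cmat.maximal_independent_subset)
  obtain g where g: "Vector_Spaces.linear cscale cscale g" "\<And>x. x \<in> B \<Longrightarrow> g x = f x"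
    using vp.linear_independent_extend[OF B(2), of f] by blast
  interpret g: Vector_Spaces.linear cscale cscale g by (rule g(1))
  have f0: "f 0 = 0" using scale[of 0 0] cmat.subspace_0[OF S] by simp
  have "cmat.subspace {x \<in> S. g x = f x}"
    unfolding cmat.subspace_def
    using S by (auto simp: g.add g.scale add scale cmat.subspace_0 cmat.subspace_add cmat.subspace_scale f0)
  then have "cmat.span B \<subseteq> {x \<in> S. g x = f x}"
    using B g(2) by (intro cmat.span_minimal) auto
  then show thesis using that[OF g(1)] B(3) by blast
qed

lemma poly_map_extend:
  fixes f :: "('n::finite,'m::finite) cmat \<Rightarrow> ('k::finite,'l::finite) cmat"
  assumes "cmat.subspace S"
    and "\<And>x y. x \<in> S \<Longrightarrow> y \<in> S \<Longrightarrow> f (x + y) = f x + f y"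
    and "\<And>c x. x \<in> S \<Longrightarrow> f (c \<bullet>\<^sub>C x) = c \<bullet>\<^sub>C f x"
  obtains g where "poly_map g" "\<And>x. x \<in> S \<Longrightarrow> g x = f x"
proof -
  obtain g where g: "Vector_Spaces.linear cscale cscale g" "\<And>x. x \<in> S \<Longrightarrow> g x = f x"
    using linear_extend[OF assms] by blast
  interpret g: Vector_Spaces.linear cscale cscale g by (rule g(1))
  have "poly_map g" by (rule poly_map_linear) (simp_all add: g.add g.scale)
  then show thesis using g(2) that by blast
qed

text \<open>For a basis \<open>B\<close> of \<open>S\<close>, the endomorphism
  \<open>u \<mapsto> (\<Sum>b\<in>B. \<beta> u b \<bullet>\<^sub>C b)\<close> is injective by
  nondegeneracy, hence surjective by dimension; a preimage of
  \<open>\<Sum>b\<in>B. L b \<bullet>\<^sub>C b\<close> represents \<open>L\<close>.\<close>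

lemma nondegenerate_represent:
  fixes S :: "('n::finite,'m::finite) cmat set"
  assumes S: "cmat.subspace S"
    and add: "\<And>x y z. x \<in> S \<Longrightarrow> y \<in> S \<Longrightarrow> z \<in> S \<Longrightarrow> \<beta> (x + y) z = \<beta> x z + \<beta> y z"
    and scale: "\<And>c x y. x \<in> S \<Longrightarrow> y \<in> S \<Longrightarrow> \<beta> (c \<bullet>\<^sub>C x) y = c * \<beta> x y"
    and sym: "\<And>x y. x \<in> S \<Longrightarrow> y \<in> S \<Longrightarrow> \<beta> x y = \<beta> y x"
    and nondeg: "\<And>x. x \<in> S \<Longrightarrow> (\<forall>y\<in>S. \<beta> x y = 0) \<Longrightarrow> x = 0"
    and L_add: "\<And>x y. L (x + y) = L x + (L y :: complex)" and L_scale: "\<And>c x. L (c \<bullet>\<^sub>C x) = c * L x"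
  shows "\<exists>u\<in>S. \<forall>y\<in>S. \<beta> u y = L y"
proof -
  interpret vp: vector_space_pair "cscale :: complex \<Rightarrow> ('n,'m) cmat \<Rightarrow> _" "cscale :: complex \<Rightarrow> ('n,'m) cmat \<Rightarrow> _"
    by unfold_locales
  obtain B where B: "B \<subseteq> S" "cmat.independent B" "S \<subseteq> cmat.span B"
    by (rule cmat.maximal_independent_subset)
  have fin: "finite B"
    using cmat.independent_span_bound[OF _ B(2), of "(\<lambda>(i,j). axis i (axis j 1)) ` UNIV"] cmat_in_span_axes by auto
  have span: "cmat.span B = S"
    using B S by (simp add: cmat.span_minimal subset_antisym)
  define J0 where "J0 = (\<lambda>u. \<Sum>b\<in>B. \<beta> u b \<bullet>\<^sub>C b)"
  have J0_add: "J0 (x + y) = J0 x + J0 y" if "x \<in> S" "y \<in> S" for x y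
    unfolding J0_def sum.distrib[symmetric]
    using that B(1) by (intro sum.cong refl) (auto simp: add cmat.scale_left_distrib)
  have J0_scale: "J0 (c \<bullet>\<^sub>C x) = c \<bullet>\<^sub>C J0 x" if "x \<in> S" for c x
    unfolding J0_def cmat.scale_sum_right
    using that B(1) by (intro sum.cong refl) (auto simp: scale)
  \<comment> \<open>\<open>J0\<close> is linear only on \<open>S\<close>, since nothing is assumed
    of \<open>\<beta>\<close> elsewhere; \<open>J\<close> is a linear extension.\<close>
  obtain J where J: "Vector_Spaces.linear cscale cscale J" "\<And>x. x \<in> S \<Longrightarrow> J x = J0 x"
    using linear_extend[OF S J0_add J0_scale] by blast
  interpret J: Vector_Spaces.linear cscale cscale J by (rule J(1))
  \<comment> \<open>Equality on the basis spreads to \<open>S\<close>; symmetry supplies the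
    linearity in the second argument.\<close>
  have zero_on_S: "\<beta> u y = l y" if u: "u \<in> S" and y: "y \<in> S" and eq: "\<And>b. b \<in> B \<Longrightarrow> \<beta> u b = l b"
    and l: "\<And>x y. l (x + y) = l x + (l y :: complex)" "\<And>c x. l (c \<bullet>\<^sub>C x) = c * l x" for u y l
  proof -
    have l0: "l 0 = 0" using l(2)[of 0 0] by simp
    have z: "\<beta> u 0 = 0" using scale[of 0 u 0] sym[of u 0] u cmat.subspace_0[OF S] 
      by (metis cmat.scale_zero_left mult_zero_left scale)
    have "cmat.subspace {y \<in> S. \<beta> u y = l y}"
      unfolding cmat.subspace_def
    proof (safe)
      show "0 \<in> S" "\<beta> u 0 = l 0" using z l0 cmat.subspace_0[OF S] by auto
    next
      fix x y assume *: "x \<in> S" "y \<in> S" "\<beta> u x = l x" "\<beta> u y = l y"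
      then show "x + y \<in> S" using S by (simp add: cmat.subspace_add)
      then show "\<beta> u (x + y) = l (x + y)" using * u add[of x y u] sym[of u] l(1) by metis
    next
      fix c x assume *: "x \<in> S" "\<beta> u x = l x"
      then show "c \<bullet>\<^sub>C x \<in> S" using S by (simp add: cmat.subspace_scale)
      then show "\<beta> u (c \<bullet>\<^sub>C x) = l (c \<bullet>\<^sub>C x)" using * u scale[of x u c] sym[of u] l(2) by metis
    qed
    then have "cmat.span B \<subseteq> {y \<in> S. \<beta> u y = l y}"
      using B(1) eq by (intro cmat.span_minimal) auto
    then show ?thesis using y span by blast
  qed
  have inj: "inj_on J (cmat.span B)"
  proof (subst J.inj_on_iff_eq_0)
    show "\<forall>x\<in>cmat.span B. J x = 0 \<longrightarrow> x = 0"
    proof (intro ballI impI)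
      fix x assume x: "x \<in> cmat.span B" "J x = 0"
      then have xS: "x \<in> S" by (simp add: span)
      have "(\<Sum>b\<in>B. (\<beta> x b) \<bullet>\<^sub>C b) = 0" using x(2) J(2)[OF xS] by (simp add: J0_def)
      then have "\<forall>b\<in>B. \<beta> x b = 0"
        using cmat.independentD[OF B(2) fin order_refl] by blast
      then have "\<forall>y\<in>S. \<beta> x y = 0"
        using zero_on_S[OF xS, of _ "\<lambda>_. 0"] by auto
      then show "x = 0" using nondeg xS by blast
    qed
  qed (simp add: cmat.subspace_span)
  have JB: "cmat.independent (J ` B)" "card (J ` B) = card B" "J ` B \<subseteq> cmat.span B"
  proof -
    show "cmat.independent (J ` B)"
      using vp.linear_independent_injective_image B(2) inj J(1) by blast
    show "card (J ` B) = card B"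
      using inj by (intro card_image) (meson cmat.span_superset inj_on_subset)
    show "J ` B \<subseteq> cmat.span B"
    proof
      fix y assume "y \<in> J ` B"
      then obtain x where "x \<in> S" "y = J x" using B(1) by blast
      then show "y \<in> cmat.span B"
        by (simp add: J(2) J0_def cmat.span_sum cmat.span_scale cmat.span_base)
    qed
  qed
  \<comment> \<open>The image of \<open>B\<close> is independent and as large as \<open>B\<close>; a
    vector outside its span would give an independent set too large for
    \<open>cmat.span B\<close>.\<close>
  have surj: "cmat.span B \<subseteq> cmat.span (J ` B)"
  proof
    fix v assume v: "v \<in> cmat.span B"
    show "v \<in> cmat.span (J ` B)"
    proof (rule ccontr)
      assume nv: "v \<notin> cmat.span (J ` B)"
      then have "cmat.independent (insert v (J ` B))"
        using JB(1) by (rule cmat.independent_insertI)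
      from cmat.independent_span_bound[OF fin this] v JB(3)
      have "card (insert v (J ` B)) \<le> card B" by blast
      moreover have "v \<notin> J ` B" using nv cmat.span_base by blast
      ultimately show False using JB(2) fin by simp
    qed
  qed
  define w where "w = (\<Sum>b\<in>B. L b \<bullet>\<^sub>C b)"
  have "w \<in> cmat.span (J ` B)"
    using surj unfolding w_def by (blast intro: cmat.span_sum cmat.span_scale cmat.span_base)
  then obtain u where u: "u \<in> S" "J u = w"
    unfolding J.span_image span by blast
  then have "(\<Sum>b\<in>B. (\<beta> u b - L b) \<bullet>\<^sub>C b) = 0"
    by (simp add: J(2) J0_def w_def cmat.scale_left_diff_distrib sum_subtractf)
  then have "\<forall>b\<in>B. \<beta> u b - L b = 0"
    using cmat.independentD[OF B(2) fin order_refl, of "\<lambda>b. \<beta> u b - L b"] by blast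
  then have "\<forall>y\<in>S. \<beta> u y = L y"
    using zero_on_S[OF u(1) _ _ L_add L_scale] by auto
  then show ?thesis using u(1) by blast
qed

section \<open>The Lie algebra of an algebraic group\<close>

lemma cpoly_dir_deriv:
  assumes "cpoly p" "poly_map V"
  shows "cpoly (\<lambda>A. dir_deriv p A (V A))"
proof -
  obtain c where c: "\<And>i j. cpoly (c i j)" "\<And>a b t. has_mderiv a b t \<Longrightarrow>
      ((\<lambda>s. p (a s)) has_field_derivative (\<Sum>i\<in>UNIV. \<Sum>j\<in>UNIV. c i j (a t) * b $ i $ j)) (at t)"
    by (rule cpoly_deriv[OF assms(1)]) blast
  have "dir_deriv p A X = (\<Sum>i\<in>UNIV. \<Sum>j\<in>UNIV. c i j A * X $ i $ j)" for A X
    using dir_deriv_eq[OF c(2)[OF has_mderiv_line]] by simp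
  then show ?thesis
    using assms(2) c(1) by (auto simp: poly_map_def intro!: cpoly_sum cpoly.mult)
qed

lemma dir_deriv_mult_coord [simp]: "dir_deriv (\<lambda>B. (B ** Y) $ i $ j) A Z = (Z ** Y) $ i $ j"
proof (rule dir_deriv_eq)
  have "has_mderiv (\<lambda>s. (A + s \<bullet>\<^sub>C Z) ** Y) (Z ** Y + (A + 0 \<bullet>\<^sub>C Z) ** 0) 0"
    by (intro has_mderiv_mult has_mderiv_line has_mderiv_const)
  then show "((\<lambda>s. ((A + s \<bullet>\<^sub>C Z) ** Y) $ i $ j) has_field_derivative (Z ** Y) $ i $ j) (at 0)"
    by (simp add: has_mderiv_def)
qed

text \<open>Both sides are derivations in \<open>p\<close>, so coordinates suffice; the mixed terms
  of the product rule cancel. In terms of the left invariant vector fields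
  \<open>A \<mapsto> A ** X\<close>, the commutator of two fields is the field of the
  bracket.\<close>

lemma dir_deriv_commutator:
  assumes "cpoly p"
  shows "dir_deriv (\<lambda>B. dir_deriv p B (B ** Y)) A (A ** X) - dir_deriv (\<lambda>B. dir_deriv p B (B ** X)) A (A ** Y)
    = dir_deriv p A (A ** bracket X Y)"
  using assms
proof induction
  case (coord i j)
  then show ?case by (simp add: bracket_def matrix_distribs matrix_mul_assoc)
next
  case (add p q)
  have *: "cpoly (\<lambda>B. dir_deriv p B (B ** Z))" "cpoly (\<lambda>B. dir_deriv q B (B ** Z))" for Z
    using add.hyps by (auto intro!: cpoly_dir_deriv poly_map_mult poly_map_id poly_map_const)
  show ?case
    using add.hyps by (simp add: dir_deriv_add * flip: add.IH)
next
  case (mult p q)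
  have *: "cpoly (\<lambda>B. dir_deriv p B (B ** Z))" "cpoly (\<lambda>B. dir_deriv q B (B ** Z))" for Z
    using mult.hyps by (auto intro!: cpoly_dir_deriv poly_map_mult poly_map_id poly_map_const)
  have "dir_deriv (\<lambda>B. p B * q B) A (A ** bracket X Y) =
    (dir_deriv (\<lambda>B. dir_deriv p B (B ** Y)) A (A ** X) - dir_deriv (\<lambda>B. dir_deriv p B (B ** X)) A (A ** Y)) * q A +
    p A * (dir_deriv (\<lambda>B. dir_deriv q B (B ** Y)) A (A ** X) - dir_deriv (\<lambda>B. dir_deriv q B (B ** X)) A (A ** Y))"
    using mult by (simp add: dir_deriv_mult)
  then show ?case
    using mult.hyps by (simp add: dir_deriv_mult dir_deriv_add * cpoly.mult algebra_simps)
qed simp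

lemma lie_algebraD:
  "X \<in> lie_algebra G \<Longrightarrow> cpoly p \<Longrightarrow> (\<And>A. A \<in> G \<Longrightarrow> p A = 0) \<Longrightarrow> dir_deriv p (mat 1) X = 0"
  by (simp add: lie_algebra_def)

lemma lie_algebraI:
  "(\<And>p. cpoly p \<Longrightarrow> (\<And>A. A \<in> G \<Longrightarrow> p A = 0) \<Longrightarrow> dir_deriv p (mat 1) X = 0) \<Longrightarrow> X \<in> lie_algebra G"
  by (simp add: lie_algebra_def)

lemma subspace_lie_algebra: "cmat.subspace (lie_algebra G)"
proof -
  have "dir_deriv p (mat 1) 0 = 0" if "cpoly p" for p :: "('a,'a) cmat \<Rightarrow> complex"
    using dir_deriv_linear(2)[OF that, of "mat 1" 0 0] by simp
  then show ?thesis
    unfolding cmat.subspace_def by (auto simp: lie_algebra_def dir_deriv_linear)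
qed

lemma algebraic_group_inv:
  assumes "algebraic_group G" "A \<in> G"
  shows "matrix_inv A \<in> G" "A ** matrix_inv A = mat 1" "matrix_inv A ** A = mat 1"
proof -
  show "matrix_inv A \<in> G" using assms by (simp add: algebraic_group_def)
  have "invertible A" using assms by (auto simp: algebraic_group_def zariski_closed_GL_def)
  then show "A ** matrix_inv A = mat 1" "matrix_inv A ** A = mat 1" by (simp_all add: matrix_inv_works)
qed

lemma algebraic_group_mult: "algebraic_group G \<Longrightarrow> A \<in> G \<Longrightarrow> B \<in> G \<Longrightarrow> A ** B \<in> G"
  by (simp add: algebraic_group_def)

text \<open>Left invariant vector fields preserve the vanishing ideal of the group.\<close>

lemma lie_algebra_deriv_zero:
  assumes G: "algebraic_group G" and X: "X \<in> lie_algebra G" and p: "cpoly p" "\<And>A. A \<in> G \<Longrightarrow> p A = 0"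
    and A: "A \<in> G"
  shows "dir_deriv p A (A ** X) = 0"
proof -
  have "cpoly (\<lambda>B. p (A ** B))"
    by (intro cpoly_comp[OF p(1)] poly_map_mult poly_map_id poly_map_const)
  then have "dir_deriv (\<lambda>B. p (A ** B)) (mat 1) X = 0"
    by (rule lie_algebraD[OF X]) (rule p(2), rule algebraic_group_mult[OF G A])
  then show ?thesis by (simp add: dir_deriv_def matrix_distribs)
qed

text \<open>Each left invariant field maps the vanishing ideal of \<open>G\<close> into itself, so
  both iterated derivatives vanish at the identity, and by \<open>dir_deriv_commutator\<close> so
  does the derivative along the bracket.\<close>

lemma bracket_lie_algebra:
  assumes G: "algebraic_group G" and X: "X \<in> lie_algebra G" and Y: "Y \<in> lie_algebra G"
  shows "bracket X Y \<in> lie_algebra G"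
proof (rule lie_algebraI)
  fix p assume p: "cpoly p" "\<And>A. A \<in> G \<Longrightarrow> p A = 0"
  have *: "dir_deriv (\<lambda>B. dir_deriv p B (B ** Z)) (mat 1) (mat 1 ** Z') = 0"
    if "Z \<in> lie_algebra G" "Z' \<in> lie_algebra G" for Z Z'
  proof -
    have "cpoly (\<lambda>B. dir_deriv p B (B ** Z))"
      using p by (auto intro!: cpoly_dir_deriv poly_map_mult poly_map_id poly_map_const)
    then show ?thesis
      using lie_algebraD[OF that(2), of "\<lambda>B. dir_deriv p B (B ** Z)"] lie_algebra_deriv_zero[OF G that(1) p]
      by simp
  qed
  show "dir_deriv p (mat 1) (bracket X Y) = 0"
    using dir_deriv_commutator[OF p(1), of Y "mat 1" X] * X Y by simp
qed

section \<open>The adjoint action\<close>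

lemma Ad_linear [simp]:
  "Ad A (x + y) = Ad A x + Ad A y" "Ad A (x - y) = Ad A x - Ad A y" "Ad A (c \<bullet>\<^sub>C x) = c \<bullet>\<^sub>C Ad A x"
  "Ad A 0 = 0" "Ad A (- x) = - Ad A x"
  by (simp_all add: Ad_def matrix_distribs)

lemma Ad_sum: "Ad A (\<Sum>i\<in>I. f i) = (\<Sum>i\<in>I. Ad A (f i))"
  by (simp add: Ad_def matrix_distribs)

lemma Ad_mat_1 [simp]: "Ad (mat 1) x = x"
proof -
  have "matrix_inv (mat 1 :: ('a,'a) cmat) = mat 1" by (rule matrix_inv_eqI) auto
  then show ?thesis by (simp add: Ad_def)
qed

lemma Ad_lie_algebra:
  assumes G: "algebraic_group G" and A: "A \<in> G" and X: "X \<in> lie_algebra G"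
  shows "Ad A X \<in> lie_algebra G"
proof (rule lie_algebraI)
  fix p assume p: "cpoly p" "\<And>A. A \<in> G \<Longrightarrow> p A = 0"
  have "cpoly (\<lambda>B. p (A ** B ** matrix_inv A))"
    by (intro cpoly_comp[OF p(1)] poly_map_mult poly_map_id poly_map_const)
  then have "dir_deriv (\<lambda>B. p (A ** B ** matrix_inv A)) (mat 1) X = 0"
    by (rule lie_algebraD[OF X])
      (intro p(2) algebraic_group_mult[OF G] algebraic_group_inv(1)[OF G A] A)
  then show "dir_deriv p (mat 1) (Ad A X) = 0"
    using algebraic_group_inv[OF G A] by (simp add: dir_deriv_def matrix_distribs Ad_def)
qed

lemma
  assumes G: "algebraic_group G" and A: "A \<in> G"
  shows Ad_mult: "B \<in> G \<Longrightarrow> Ad (A ** B) X = Ad A (Ad B X)"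
    and Ad_inv: "Ad (matrix_inv A) (Ad A X) = X" "Ad A (Ad (matrix_inv A) X) = X"
    and Ad_bracket: "Ad A (bracket X Y) = bracket (Ad A X) (Ad A Y)"
proof -
  note inv = algebraic_group_inv[OF G A]
  have *: "matrix_inv A ** (A ** Z) = Z" "A ** (matrix_inv A ** Z) = Z" for Z
    using inv by (simp_all add: matrix_mul_assoc)
  have inv2: "matrix_inv (matrix_inv A) = A" using inv by (intro matrix_inv_eqI)
  show "Ad (matrix_inv A) (Ad A X) = X" "Ad A (Ad (matrix_inv A) X) = X"
    using inv by (simp_all add: Ad_def inv2 matrix_mul_assoc[symmetric] *)
  show "Ad A (bracket X Y) = bracket (Ad A X) (Ad A Y)"
    by (simp add: Ad_def bracket_def matrix_distribs matrix_mul_assoc[symmetric] *)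
  show "Ad (A ** B) X = Ad A (Ad B X)" if "B \<in> G"
  proof -
    note invB = algebraic_group_inv[OF G that]
    have *: "B ** (matrix_inv B ** Z) = Z" "matrix_inv A ** (A ** Z) = Z" for Z
      using invB inv by (simp_all add: matrix_mul_assoc)
    have "matrix_inv (A ** B) = matrix_inv B ** matrix_inv A"
      using inv invB by (intro matrix_inv_eqI) (simp_all add: matrix_mul_assoc[symmetric] *)
    then show ?thesis by (simp add: Ad_def matrix_mul_assoc)
  qed
qed

lemma matrix_inverse_cancel:
  assumes "algebraic_group G" "A \<in> G"
  shows "matrix_inv A ** (A ** Z) = Z" "A ** (matrix_inv A ** Z) = Z"
  using algebraic_group_inv[OF assms] by (simp_all add: matrix_mul_assoc)

lemma Ad_mexp_commute:
  assumes "algebraic_group G" "A \<in> G"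
  shows "Ad A (mexp K X) = mexp K (Ad A X)"
proof -
  have "Ad A (mpow X k) = mpow (Ad A X) k" for k
  proof (induction k)
    case 0
    then show ?case using algebraic_group_inv[OF assms] by (simp add: Ad_def)
  next
    case (Suc k)
    have "Ad A (X ** mpow X k) = Ad A X ** Ad A (mpow X k)"
      by (simp add: Ad_def matrix_mul_assoc[symmetric] matrix_inverse_cancel[OF assms])
    then show ?case using Suc by simp
  qed
  then show ?thesis by (simp add: mexp_def Ad_sum)
qed

text \<open>For \<open>p\<close> vanishing on \<open>G\<close>,
  \<open>p (mexp K (t \<bullet>\<^sub>C X))\<close> is a polynomial \<open>q\<close> in
  \<open>t\<close>. Its derivative arises in the same way from
  \<open>A \<mapsto> dir_deriv p A (A ** X)\<close>, which again vanishes on \<open>G\<close>.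
  Induction on the degree makes \<open>q\<close> constant, and its value at \<open>0\<close> is
  \<open>p (mat 1) = 0\<close>.\<close>

lemma mexp_in_group:
  assumes G: "algebraic_group G" and X: "X \<in> lie_algebra G" and nil: "mpow X K = 0" and K: "K > 0"
  shows "mexp K X \<in> G"
proof -
  have zero: "p (mexp K (t \<bullet>\<^sub>C X)) = 0"
    if "cpoly p" "\<And>A. A \<in> G \<Longrightarrow> p A = 0" "\<And>t. p (mexp K (t \<bullet>\<^sub>C X)) = poly q t" "degree q \<le> d" for p q d t
    using that
  proof (induction d arbitrary: p q t)
    case d: (0 p q t)
    obtain c where "q = [:c:]" using d.prems(4) degree_eq_zeroE by auto
    moreover have "poly q 0 = 0"
      using d.prems(2)[of "mat 1"] d.prems(3)[of 0] K G by (simp add: algebraic_group_def)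
    ultimately show ?case by (simp add: d.prems(3))
  next
    case (Suc d)
    let ?p = "\<lambda>A. dir_deriv p A (A ** X)"
    have deriv: "?p (mexp K (t \<bullet>\<^sub>C X)) = poly (pderiv q) t" for t
    proof -
      have "((\<lambda>t. p (mexp K (t \<bullet>\<^sub>C X))) has_field_derivative ?p (mexp K (t \<bullet>\<^sub>C X))) (at t)"
        using cpoly_chain[OF Suc.prems(1) has_mderiv_mexp[OF nil]]
        by (metis cmat.scale_scale mexp_commute matrix_mult_cscale)
      moreover have "((\<lambda>t. p (mexp K (t \<bullet>\<^sub>C X))) has_field_derivative poly (pderiv q) t) (at t)"
        by (simp add: Suc.prems(3))
      ultimately show ?thesis by (rule DERIV_unique)
    qed
    have "?p (mexp K (t \<bullet>\<^sub>C X)) = 0" for t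
    proof (rule Suc.IH[of ?p "pderiv q"])
      show "cpoly ?p" using Suc.prems(1) by (auto intro!: cpoly_dir_deriv poly_map_mult poly_map_id poly_map_const)
      show "?p A = 0" if "A \<in> G" for A using lie_algebra_deriv_zero[OF G X Suc.prems(1,2)] that by auto
      show "degree (pderiv q) \<le> d" using Suc.prems(4) by (simp add: degree_pderiv)
    qed (rule deriv)
    then have "pderiv q = 0" using deriv poly_all_0_iff_0 by metis
    then obtain c where "q = [:c:]" using pderiv_eq_0_iff degree_eq_zeroE by metis
    moreover have "poly q 0 = 0"
      using Suc.prems(2)[of "mat 1"] Suc.prems(3)[of 0] K G by (simp add: algebraic_group_def)
    ultimately show ?case by (simp add: Suc.prems(3))
  qed
  have "p (mexp K X) = 0" if p: "cpoly p" "\<And>A. A \<in> G \<Longrightarrow> p A = 0" for p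
  proof -
    obtain q where "\<And>t. p (mexp K (t \<bullet>\<^sub>C X)) = poly q t"
      using cpoly_poly_curve[OF p(1) poly_curve_mexp] by blast
    from zero[OF p this order_refl, of 1] show ?thesis by simp
  qed
  moreover have "invertible (mexp K X)"
    using mexp_inverse[OF nil K] by (auto simp: invertible_def)
  ultimately show ?thesis
    using G unfolding algebraic_group_def zariski_closed_GL_def by blast
qed

text \<open>
  The powers \<open>A\<^sup>n\<close> of a unipotent matrix are polynomial in \<open>n\<close>, so they extend to a one-parameter
  group; its velocity at \<open>0\<close> plays the role of the logarithm.
\<close>

lemma unipotent_log:
  assumes M: "algebraic_group M" and A: "A \<in> M" and nil: "nilpotent_mat (A - mat 1)"
  obtains L where "L \<in> lie_algebra M" "\<And>K. mpow L K = 0 \<Longrightarrow> K > 0 \<Longrightarrow> A = mexp K L"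
proof -
  define N where "N = A - mat 1"
  obtain D where D: "mpow N D = 0" using nil by (auto simp: nilpotent_mat_mpow N_def)
  \<comment> \<open>The binomial series of \<open>(1 + N)^t\<close>, which stops because
    \<open>N^D = 0\<close>; at natural \<open>t\<close> it is a power of \<open>A\<close>.\<close>
  define a where "a = (\<lambda>t::complex. \<Sum>k<D. (t gchoose k) \<bullet>\<^sub>C mpow N k)"
  have binom: "mpow A n = (\<Sum>k\<le>n. of_nat (n choose k) \<bullet>\<^sub>C mpow N k)" for n
  proof (induction n)
    case (Suc n)
    have "mpow A (Suc n) = mpow A n + N ** mpow A n"
      by (simp add: N_def matrix_distribs)
    also have "N ** mpow A n = (\<Sum>k\<le>n. of_nat (n choose k) \<bullet>\<^sub>C mpow N (Suc k))"
      by (simp add: Suc matrix_distribs)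
    also have "\<dots> = (\<Sum>k\<in>{1..Suc n}. of_nat (n choose (k - 1)) \<bullet>\<^sub>C mpow N k)"
      by (rule sum.reindex_bij_witness[of _ "\<lambda>k. k - 1" Suc]) auto
    also have "mpow A n = mat 1 + (\<Sum>k\<in>{1..Suc n}. of_nat (n choose k) \<bullet>\<^sub>C mpow N k)"
    proof -
      have "{..n} = insert 0 {1..n}" by auto
      then show ?thesis by (simp add: Suc cmat.scale_one)
    qed
    also have "mat 1 + (\<Sum>k\<in>{1..Suc n}. of_nat (n choose k) \<bullet>\<^sub>C mpow N k) + (\<Sum>k\<in>{1..Suc n}. of_nat (n choose (k - 1)) \<bullet>\<^sub>C mpow N k)
        = mat 1 + (\<Sum>k\<in>{1..Suc n}. of_nat (Suc n choose k) \<bullet>\<^sub>C mpow N k)"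
      unfolding add.assoc sum.distrib[symmetric] cmat.scale_left_distrib[symmetric]
      by (intro arg_cong2[of _ _ _ _ "(+)"] refl sum.cong) (auto simp: choose_reduce_nat add.commute)
    also have "\<dots> = (\<Sum>k\<le>Suc n. of_nat (Suc n choose k) \<bullet>\<^sub>C mpow N k)"
    proof -
      have "{..Suc n} = insert 0 {1..Suc n}" by auto
      then show ?thesis by (simp add: cmat.scale_one del: binomial_Suc_Suc)
    qed
    finally show ?case .
  qed simp
  have a_nat: "a (of_nat n) = mpow A n" for n
  proof -
    \<comment> \<open>From \<open>D\<close> on the powers of \<open>N\<close> vanish, beyond
      \<open>n\<close> the binomial coefficients do; both sums equal the one up to the
      maximum.\<close>
    have "a (of_nat n) = (\<Sum>k<max D (Suc n). of_nat (n choose k) \<bullet>\<^sub>C mpow N k)"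
      unfolding a_def using mpow_eq_0_mono[OF D]
      by (intro sum.mono_neutral_cong_left) (auto simp: binomial_gbinomial[symmetric])
    also have "\<dots> = (\<Sum>k\<le>n. of_nat (n choose k) \<bullet>\<^sub>C mpow N k)"
      by (intro sum.mono_neutral_right) (auto simp: binomial_eq_0)
    finally show ?thesis by (simp add: binom)
  qed
  have nz: "1 + of_nat k \<noteq> (0::complex)" for k
    by (metis of_nat_Suc of_nat_neq_0)
  have "\<exists>q. \<forall>t::complex. t gchoose k = poly q t" for k
  proof (induction k)
    case 0
    show ?case by (intro exI[of _ 1]) simp
  next
    case (Suc k)
    then obtain q where q: "\<forall>t::complex. t gchoose k = poly q t" by blast
    have "t gchoose Suc k = poly (smult (1 / of_nat (Suc k)) (q * [:- of_nat k, 1:])) t" for t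
      using gbinomial_absorb_comp[of t k] gbinomial_absorption[of k t]
      by (simp add: q[rule_format, symmetric] nz field_simps)
    then show ?case by blast
  qed
  then have "poly_curve a"
    unfolding a_def by (intro poly_curve_sum) (metis poly_curve_poly_cscale ext)
  then obtain a' where a': "poly_curve a'" "\<And>t. has_mderiv a (a' t) t"
    by (rule poly_curve_deriv) blast
  define L where "L = a' 0"
  have shift: "poly_curve (\<lambda>t. a (t + c))" for c
    unfolding poly_curve_def
  proof (intro allI)
    fix i j
    obtain q where "\<forall>t. a t $ i $ j = poly q t" using \<open>poly_curve a\<close> unfolding poly_curve_def by blast
    then show "\<exists>q. \<forall>t. a (t + c) $ i $ j = poly q t"
      by (intro exI[of _ "pcompose q [:c, 1:]"]) (simp add: poly_pcompose add.commute)
  qed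
  \<comment> \<open>Differentiate \<open>a (t + m) = a t ** a m\<close> at \<open>t = 0\<close>.
    This functional equation holds for natural \<open>t\<close> and extends to all \<open>t\<close>;
    the resulting equation at natural \<open>m\<close> then extends in the same way.\<close>
  have "a' (of_nat m) = L ** a (of_nat m)" for m
  proof -
    have "a (t + of_nat m) = a t ** a (of_nat m)" for t
    proof (rule poly_curve_eq_on_nat[OF shift])
      show "poly_curve (\<lambda>t. a t ** a (of_nat m))"
        using poly_curve_comp[OF poly_map_mult[OF poly_map_id poly_map_const] \<open>poly_curve a\<close>] .
      show "a (of_nat n + of_nat m) = a (of_nat n) ** a (of_nat m)" for n
        using mpow_add[of A n m] by (simp flip: a_nat)
    qed
    then have "(\<lambda>t. a (t + of_nat m)) = (\<lambda>t. a t ** a (of_nat m))" by blast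
    moreover have "has_mderiv (\<lambda>t. a t ** a (of_nat m)) (L ** a (of_nat m) + a 0 ** 0) 0"
      unfolding L_def by (intro has_mderiv_mult a' has_mderiv_const)
    moreover have "has_mderiv (\<lambda>t. a (t + of_nat m)) (a' (of_nat m)) 0"
      unfolding has_mderiv_def
    proof (intro allI)
      fix i j
      show "((\<lambda>s. a (s + of_nat m) $ i $ j) has_field_derivative a' (of_nat m) $ i $ j) (at 0)"
        using a'(2)[of "of_nat m"] DERIV_shift[of "\<lambda>s. a s $ i $ j" "a' (of_nat m) $ i $ j" 0 "of_nat m"]
        by (simp add: has_mderiv_def)
    qed
    ultimately have "a' (of_nat m) = L ** a (of_nat m) + a 0 ** 0"
      by (intro has_mderiv_unique[of "\<lambda>t. a t ** a (of_nat m)" _ 0]) simp_all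
    then show ?thesis by simp
  qed
  moreover have "poly_curve (\<lambda>t. L ** a t)"
    using poly_curve_comp[OF poly_map_mult[OF poly_map_const poly_map_id] \<open>poly_curve a\<close>] .
  ultimately have ode: "a' t = L ** a t" for t
    using poly_curve_eq_on_nat[OF a'(1)] by blast
  have a0: "a 0 = mat 1" using a_nat[of 0] by simp
  show thesis
  proof (rule that[of L])
    show "L \<in> lie_algebra M"
    proof (rule lie_algebraI)
      fix p assume p: "cpoly p" "\<And>A. A \<in> M \<Longrightarrow> p A = 0"
      obtain q where q: "\<And>t. p (a t) = poly q t"
        using cpoly_poly_curve[OF p(1) \<open>poly_curve a\<close>] by blast
      have pow: "mpow A n \<in> M" for n
        using A M by (induction n) (auto simp: algebraic_group_def)
      \<comment> \<open>\<open>p\<close> vanishes at all powers of \<open>A\<close>, hence along the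
        whole curve, and so does its derivative at \<open>0\<close>.\<close>
      have "q = 0"
      proof (rule poly_eq_on_nat)
        fix n
        show "poly q (of_nat n) = poly 0 (of_nat n)"
          using p(2)[OF pow[of n]] by (simp flip: q a_nat)
      qed
      then have "p (a t) = 0" for t by (simp add: q)
      then have "((\<lambda>t. p (a t)) has_field_derivative 0) (at 0)" by simp
      moreover have "((\<lambda>t. p (a t)) has_field_derivative dir_deriv p (a 0) L) (at 0)"
        unfolding L_def by (intro cpoly_chain p a')
      ultimately show "dir_deriv p (mat 1) L = 0" using DERIV_unique a0 by metis
    qed
  next
    \<comment> \<open>Nilpotency of \<open>L\<close> stays a condition here; in
      \<open>M_mexp\<close> it follows from the negative weights of \<open>L\<close>.\<close>
    fix K assume K: "mpow L K = 0" "K > 0"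
    have "mexp K (1 \<bullet>\<^sub>C (- L)) ** a 1 = mat 1"
      using a'(2) by (intro mexp_eq_of_ode K a0) (simp flip: ode)
    moreover have "a 1 = A" using a_nat[of 1] by simp
    ultimately have "mexp K L ** (mexp K (- L) ** A) = mexp K L" by simp
    then show "A = mexp K L"
      by (simp add: matrix_mul_assoc mexp_inverse[OF K])
  qed
qed

section \<open>Gradings by a cocharacter\<close>

text \<open>A diagonalizable \<open>h\<close> with integral eigenvalues, encoded as a complete
  system of orthogonal idempotents on the space on which the matrices act. Weights of
  \<open>ad h\<close> are differences of two such eigenvalues, so they lie between
  \<open>-2N\<close> and \<open>2N\<close>.\<close>

locale weight_grading =
  fixes P :: "int \<Rightarrow> ('n::finite,'n) cmat" and N :: int
  assumes P_mult: "P a ** P b = (if a = b then P a else 0)"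
    and P_out: "a \<notin> {-N..N} \<Longrightarrow> P a = 0"
    and P_sum: "(\<Sum>a\<in>{-N..N}. P a) = mat 1"
    and N_nonneg: "N \<ge> 0"
begin

text \<open>
  \<open>P a\<close> projects to the eigenspace of \<open>h\<close> for \<open>a\<close>. The block \<open>(a, b)\<close> of a matrix has \<open>ad h\<close>-weight
  \<open>a - b\<close>, \<open>wcomp i\<close> is the projection to weight \<open>i\<close>, and \<open>wle i\<close> is the sum of the weights at most \<open>i\<close>.
\<close>

definition block :: "int \<Rightarrow> int \<Rightarrow> ('n,'n) cmat \<Rightarrow> ('n,'n) cmat"
  where "block a b X = P a ** X ** P b"

definition wcomp :: "int \<Rightarrow> ('n,'n) cmat \<Rightarrow> ('n,'n) cmat"
  where "wcomp i X = (\<Sum>a\<in>{-N..N}. block a (a - i) X)"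

definition wle :: "int \<Rightarrow> ('n,'n) cmat set"
  where "wle i = {X. \<forall>a b. a - b > i \<longrightarrow> block a b X = 0}"

definition hh :: "('n,'n) cmat"
  where "hh = (\<Sum>a\<in>{-N..N}. of_int a \<bullet>\<^sub>C P a)"

text \<open>This is \<open>t^h\<close>; \<open>sl2_hom_grading\<close> identifies it with the
  cocharacter.\<close>

definition gam :: "complex \<Rightarrow> ('n,'n) cmat"
  where "gam t = (\<Sum>a\<in>{-N..N}. (t powi a) \<bullet>\<^sub>C P a)"

lemma block_linear [simp]:
  "block a b (X + Y) = block a b X + block a b Y"
  "block a b (X - Y) = block a b X - block a b Y"
  "block a b (- X) = - block a b X"
  "block a b (c \<bullet>\<^sub>C X) = c \<bullet>\<^sub>C block a b X"
  "block a b 0 = 0"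
  by (simp_all add: block_def matrix_distribs)

lemma block_sum: "block a b (\<Sum>i\<in>I. f i) = (\<Sum>i\<in>I. block a b (f i))"
  by (simp add: block_def matrix_distribs)

lemma block_out: "a \<notin> {-N..N} \<or> b \<notin> {-N..N} \<Longrightarrow> block a b X = 0"
  by (auto simp: block_def P_out)

lemma block_block: "block a b (block c d X) = (if a = c \<and> b = d then block a b X else 0)"
proof -
  have "block a b (block c d X) = (P a ** P c) ** X ** (P d ** P b)"
    by (simp add: block_def matrix_mul_assoc)
  then show ?thesis by (simp add: P_mult block_def)
qed

lemma sum_blocks: "X = (\<Sum>a\<in>{-N..N}. \<Sum>b\<in>{-N..N}. block a b X)"
proof -
  have "X = (\<Sum>a\<in>{-N..N}. P a) ** X ** (\<Sum>b\<in>{-N..N}. P b)"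
    by (simp add: P_sum)
  also have "\<dots> = (\<Sum>a\<in>{-N..N}. P a ** X ** (\<Sum>b\<in>{-N..N}. P b))"
    by (simp only: matrix_mult_sum_left)
  also have "\<dots> = (\<Sum>a\<in>{-N..N}. \<Sum>b\<in>{-N..N}. block a b X)"
    by (simp only: matrix_mult_sum_right block_def)
  finally show ?thesis .
qed

lemma block_eqI: "(\<And>a b. block a b X = block a b Y) \<Longrightarrow> X = Y"
  using sum_blocks[of X] sum_blocks[of Y] by simp

lemma block_mult: "block a b (X ** Y) = (\<Sum>c\<in>{-N..N}. block a c X ** block c b Y)"
proof -
  have *: "P c ** (P c ** Z) = P c ** Z" for c Z
    by (simp add: matrix_mul_assoc P_mult)
  have "block a b (X ** Y) = P a ** X ** (\<Sum>c\<in>{-N..N}. P c) ** Y ** P b"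
    by (simp add: P_sum block_def matrix_mul_assoc)
  then show ?thesis
    by (simp add: block_def matrix_mult_sum_left matrix_mult_sum_right matrix_mul_assoc[symmetric] *)
qed

lemma block_comp: "block a b (wcomp i X) = (if a - b = i then block a b X else 0)"
proof -
  have "block a b (wcomp i X) = (\<Sum>c\<in>{-N..N}. if c = a then (if a - b = i then block a b X else 0) else 0)"
    unfolding wcomp_def block_sum block_block by (intro sum.cong) auto
  then show ?thesis by (auto simp: block_out)
qed

lemma wcomp_linear [simp]:
  "wcomp i (X + Y) = wcomp i X + wcomp i Y"
  "wcomp i (X - Y) = wcomp i X - wcomp i Y"
  "wcomp i (- X) = - wcomp i X"
  "wcomp i (c \<bullet>\<^sub>C X) = c \<bullet>\<^sub>C wcomp i X"
  "wcomp i 0 = 0"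
  by (rule block_eqI; simp add: block_comp)+

lemma wcomp_sum: "wcomp i (\<Sum>j\<in>I. f j) = (\<Sum>j\<in>I. wcomp i (f j))"
  by (induction I rule: infinite_finite_induct) simp_all

lemma wcomp_comp: "wcomp i (wcomp j X) = (if i = j then wcomp i X else 0)"
  by (rule block_eqI) (auto simp: block_comp)

lemma wcomp_out: "i \<notin> {-(2*N)..2*N} \<Longrightarrow> wcomp i X = 0"
  by (rule block_eqI) (auto simp: block_comp intro!: block_out)

lemma sum_comp: "(\<Sum>i\<in>{-(2*N)..2*N}. wcomp i X) = X"
proof (rule block_eqI)
  fix a b
  show "block a b (\<Sum>i\<in>{-(2*N)..2*N}. wcomp i X) = block a b X"
    by (cases "a \<in> {-N..N} \<and> b \<in> {-N..N}") (auto simp: block_sum block_comp block_out)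
qed

lemma wle_iff_comp: "X \<in> wle i \<longleftrightarrow> (\<forall>j>i. wcomp j X = 0)"
proof
  assume *: "X \<in> wle i"
  have "wcomp j X = 0" if "j > i" for j
    by (rule block_eqI) (use * that in \<open>simp add: wle_def block_comp\<close>)
  then show "\<forall>j>i. wcomp j X = 0" by blast
next
  assume *: "\<forall>j>i. wcomp j X = 0"
  show "X \<in> wle i"
    unfolding wle_def
  proof safe
    fix a b assume "a - b > i"
    then have "block a b (wcomp (a - b) X) = 0" using * by simp
    then show "block a b X = 0" by (simp add: block_comp)
  qed
qed

lemma subspace_wle: "cmat.subspace (wle i)"
  by (auto simp: cmat.subspace_def wle_def)

lemma wle_closed [intro]:
  "0 \<in> wle i"
  "X \<in> wle i \<Longrightarrow> Y \<in> wle i \<Longrightarrow> X + Y \<in> wle i"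
  "X \<in> wle i \<Longrightarrow> Y \<in> wle i \<Longrightarrow> X - Y \<in> wle i"
  "X \<in> wle i \<Longrightarrow> - X \<in> wle i"
  "X \<in> wle i \<Longrightarrow> c \<bullet>\<^sub>C X \<in> wle i"
  by (auto simp: wle_def)

lemma wle_sum: "(\<And>j. j \<in> I \<Longrightarrow> f j \<in> wle i) \<Longrightarrow> (\<Sum>j\<in>I. f j) \<in> wle i"
  by (rule cmat.subspace_sum[OF subspace_wle])

lemma wle_mono: "X \<in> wle i \<Longrightarrow> i \<le> j \<Longrightarrow> X \<in> wle j"
  by (auto simp: wle_def)

lemma wle_mult: "X \<in> wle i \<Longrightarrow> Y \<in> wle j \<Longrightarrow> k \<ge> i + j \<Longrightarrow> X ** Y \<in> wle k"
  unfolding wle_def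
proof safe
  fix a b assume *: "\<forall>a b. a - b > i \<longrightarrow> block a b X = 0" "\<forall>a b. a - b > j \<longrightarrow> block a b Y = 0"
    "k \<ge> i + j" "a - b > k"
  have "block a c X ** block c b Y = 0" for c
  proof (cases "a - c > i")
    case False
    then have "c - b > j" using *(3,4) by linarith
    then show ?thesis using *(2) by simp
  qed (use * in simp)
  then show "block a b (X ** Y) = 0" by (simp add: block_mult)
qed

lemma wle_bracket: "X \<in> wle i \<Longrightarrow> Y \<in> wle j \<Longrightarrow> k \<ge> i + j \<Longrightarrow> bracket X Y \<in> wle k"
  unfolding bracket_def using wle_mult[of X i Y j k] wle_mult[of Y j X i k] by (auto simp: add.commute)

lemma wcomp_in_wle: "wcomp i X \<in> wle i"
  by (simp add: wle_iff_comp wcomp_comp)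

lemma homogeneous_in_wle: "wcomp i X = X \<Longrightarrow> X \<in> wle i"
  using wcomp_in_wle[of i X] by simp

text \<open>Nonzero blocks have both indices in \<open>{-N..N}\<close>, so their weight is at least
  \<open>-2N\<close>. This is what ends every argument that lowers weights.\<close>

lemma wle_trivial: "i < -2*N \<Longrightarrow> wle i = {0}"
proof -
  assume i: "i < -2*N"
  have "X = 0" if "X \<in> wle i" for X
  proof -
    have "(\<Sum>j\<in>{-(2*N)..2*N}. wcomp j X) = 0"
      using that i by (intro sum.neutral) (simp add: wle_iff_comp)
    then show ?thesis by (simp add: sum_comp)
  qed
  then show ?thesis by auto
qed

lemma wle_lower: "X \<in> wle i \<Longrightarrow> wcomp i X = 0 \<Longrightarrow> X \<in> wle (i - 1)"
proof -
  assume *: "X \<in> wle i" "wcomp i X = 0"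
  have "wcomp j X = 0" if "j > i - 1" for j
    using * that by (cases "j = i") (simp_all add: wle_iff_comp)
  then show ?thesis by (simp add: wle_iff_comp)
qed

lemma one_in_wle: "mat 1 \<in> wle 0"
proof -
  have "block a b (mat 1) = 0" if "a - b > 0" for a b
    using that by (simp add: block_def P_mult)
  then show ?thesis by (simp add: wle_def)
qed

lemma wcomp_mult_homogeneous:
  assumes "wcomp j E = E"
  shows "wcomp i (X ** E) = wcomp (i - j) X ** E" "wcomp i (E ** X) = E ** wcomp (i - j) X"
proof -
  have E: "block a b E = 0" if "a - b \<noteq> j" for a b
    using block_comp[of a b j E] that by (simp add: assms)
  show "wcomp i (X ** E) = wcomp (i - j) X ** E"
  proof (rule block_eqI)
    fix a b
    have "(if a - c = i - j then block a c X else 0) ** block c b E = (if a - b = i then block a c X ** block c b E else 0)" for c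
      using E[of c b] by (cases "c - b = j") auto
    then show "block a b (wcomp i (X ** E)) = block a b (wcomp (i - j) X ** E)"
      by (simp add: block_comp block_mult)
  qed
  show "wcomp i (E ** X) = E ** wcomp (i - j) X"
  proof (rule block_eqI)
    fix a b
    have "block a c E ** (if c - b = i - j then block c b X else 0) = (if a - b = i then block a c E ** block c b X else 0)" for c
      using E[of a c] by (cases "a - c = j") auto
    then show "block a b (wcomp i (E ** X)) = block a b (E ** wcomp (i - j) X)"
      by (simp add: block_comp block_mult)
  qed
qed

lemma wcomp_bracket_homogeneous:
  assumes "wcomp j E = E"
  shows "wcomp i (bracket X E) = bracket (wcomp (i - j) X) E" "wcomp i (bracket E X) = bracket E (wcomp (i - j) X)"
  by (simp_all add: bracket_def wcomp_mult_homogeneous[OF assms])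

lemma hh_P: "hh ** P b = of_int b \<bullet>\<^sub>C P b" "P a ** hh = of_int a \<bullet>\<^sub>C P a"
proof -
  have "hh ** P b = (\<Sum>a\<in>{-N..N}. if a = b then of_int b \<bullet>\<^sub>C P b else 0)"
    unfolding hh_def matrix_mult_sum_left by (intro sum.cong) (auto simp: P_mult)
  then show "hh ** P b = of_int b \<bullet>\<^sub>C P b" by (auto simp: P_out)
  have "P a ** hh = (\<Sum>b\<in>{-N..N}. if b = a then of_int a \<bullet>\<^sub>C P a else 0)"
    unfolding hh_def matrix_mult_sum_right by (intro sum.cong) (auto simp: P_mult)
  then show "P a ** hh = of_int a \<bullet>\<^sub>C P a" by (auto simp: P_out)
qed

lemma block_bracket_hh: "block a b (bracket hh X) = of_int (a - b) \<bullet>\<^sub>C block a b X"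
proof -
  have "block a b (hh ** X) = of_int a \<bullet>\<^sub>C block a b X"
    by (simp add: block_def matrix_mul_assoc hh_P)
  moreover have "block a b (X ** hh) = of_int b \<bullet>\<^sub>C block a b X"
    by (simp add: block_def matrix_mul_assoc[symmetric] hh_P)
  ultimately show ?thesis
    by (simp add: bracket_def cmat.scale_left_diff_distrib)
qed

lemma bracket_hh_comp: "bracket hh (wcomp i X) = of_int i \<bullet>\<^sub>C wcomp i X"
  by (rule block_eqI) (auto simp: block_comp block_bracket_hh)

lemma weight_iff: "bracket hh X = of_int i \<bullet>\<^sub>C X \<longleftrightarrow> wcomp i X = X"
proof
  assume *: "bracket hh X = of_int i \<bullet>\<^sub>C X"
  show "wcomp i X = X"
  proof (rule block_eqI)
    fix a b
    have "of_int (a - b) \<bullet>\<^sub>C block a b X = of_int i \<bullet>\<^sub>C block a b X"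
      by (metis * block_bracket_hh block_linear(4))
    then have "a - b = i \<or> block a b X = 0"
      by (metis cmat.scale_cancel_right of_int_eq_iff)
    then show "block a b (wcomp i X) = block a b X"
      by (auto simp: block_comp)
  qed
next
  assume "wcomp i X = X"
  then show "bracket hh X = of_int i \<bullet>\<^sub>C X" using bracket_hh_comp[of i X] by simp
qed

text \<open>The components are eigenvectors of \<open>ad h\<close> to distinct eigenvalues, so a stable subspace separates them.\<close>

lemma wcomp_in_stable:
  assumes S: "cmat.subspace S" and stable: "\<And>x. x \<in> S \<Longrightarrow> bracket hh x \<in> S" and X: "X \<in> S"
  shows "wcomp i X \<in> S"
proof -
  have gen: "\<forall>i\<in>I. f i \<in> S"
    if "finite I" "(\<Sum>i\<in>I. f i) \<in> S" "\<And>i. i \<in> I \<Longrightarrow> bracket hh (f i) = of_int i \<bullet>\<^sub>C f i" for I and f :: "int \<Rightarrow> ('n,'n) cmat"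
    using that
  proof (induction I arbitrary: f rule: finite_induct)
    case (insert k I)
    let ?s = "f k + (\<Sum>i\<in>I. f i)"
    have s: "?s \<in> S" using insert by simp
    \<comment> \<open>Applying \<open>ad h - k\<close> removes the summand of weight
      \<open>k\<close> and multiplies each other one by the nonzero number \<open>i - k\<close>,
      which leaves a sum over \<open>I\<close>.\<close>
    have eq: "bracket hh ?s - of_int k \<bullet>\<^sub>C ?s = (\<Sum>i\<in>I. of_int (i - k) \<bullet>\<^sub>C f i)"
    proof -
      have "bracket hh ?s = of_int k \<bullet>\<^sub>C f k + (\<Sum>i\<in>I. of_int i \<bullet>\<^sub>C f i)"
      proof -
        have "bracket hh (\<Sum>i\<in>I. f i) = (\<Sum>i\<in>I. bracket hh (f i))"
          by (simp add: bracket_def matrix_distribs sum_subtractf)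
        also have "\<dots> = (\<Sum>i\<in>I. of_int i \<bullet>\<^sub>C f i)" using insert.prems(2) by (intro sum.cong) auto
        finally show ?thesis using insert.prems(2)[of k] by (simp add: bracket_add_right)
      qed
      then show ?thesis
        by (simp add: cmat.scale_right_distrib cmat.scale_left_diff_distrib sum_subtractf cmat.scale_sum_right)
    qed
    have "(\<Sum>i\<in>I. of_int (i - k) \<bullet>\<^sub>C f i) \<in> S"
      unfolding eq[symmetric] by (intro cmat.subspace_diff[OF S] stable s cmat.subspace_scale[OF S])
    then have "\<forall>i\<in>I. of_int (i - k) \<bullet>\<^sub>C f i \<in> S"
      using insert.prems(2) by (intro insert.IH) (auto simp: cscale_cscale mult.commute simp del: of_int_diff)
    then have "f i \<in> S" if "i \<in> I" for i
    proof -
      have "i - k \<noteq> 0" using that insert.hyps by auto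
      moreover have "(1 / of_int (i - k)) \<bullet>\<^sub>C of_int (i - k) \<bullet>\<^sub>C f i \<in> S"
        using \<open>\<forall>i\<in>I. _\<close> that S cmat.subspace_scale by blast
      ultimately show ?thesis by (simp add: cmat.scale_one del: of_int_diff)
    qed
    then have "\<forall>i\<in>I. f i \<in> S" by blast
    moreover from this have "f k \<in> S"
      using s S cmat.subspace_diff[OF S s cmat.subspace_sum[OF S, of I f]] by auto
    ultimately show ?case by blast
  qed simp
  have "\<forall>i\<in>{-(2*N)..2*N}. wcomp i X \<in> S"
    using X by (intro gen) (simp_all add: sum_comp bracket_hh_comp)
  then show ?thesis
    using wcomp_out[of i X] cmat.subspace_0[OF S] by (cases "i \<in> {-(2*N)..2*N}") auto
qed

text \<open>With \<open>2 * N + 1\<close> the \<open>K\<close>-th power of an element of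
  \<open>wle (-1)\<close> already vanishes; one more gives \<open>K \<ge> 2\<close> even for
  \<open>N = 0\<close>, so that the truncated series always contains
  \<open>mat 1 + X\<close>.\<close>

definition K :: nat where "K = nat (2 * N + 2)"

lemma K_pos: "K > 0" and K_ge: "K \<ge> 2"
  using N_nonneg by (simp_all add: K_def)

lemma mpow_in_wle: "X \<in> wle i \<Longrightarrow> mpow X k \<in> wle (int k * i)"
proof (induction k)
  case (Suc k)
  then show ?case by (auto intro!: wle_mult[of X i _ "int k * i"] simp: algebra_simps)
qed (simp add: one_in_wle)

lemma mpow_K: "X \<in> wle (-1) \<Longrightarrow> mpow X K = 0"
  using mpow_in_wle[of X "-1" K] wle_trivial[of "- int K"] N_nonneg by (simp add: K_def)

text \<open>What remains after \<open>mat 1 + X\<close> starts with a term quadratic in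
  \<open>X\<close>, and higher powers have lower weights still.\<close>

lemma mexp_in_wle:
  assumes X: "X \<in> wle (- k)" and k: "k \<ge> 1"
  shows "mexp K X - mat 1 - X \<in> wle (- 2 * k)"
proof -
  have "{..<K} = {0, 1} \<union> {2..<K}" using K_ge by auto
  then have "mexp K X = (mat 1 + X) + (\<Sum>j\<in>{2..<K}. (1 / fact j) \<bullet>\<^sub>C mpow X j)"
    by (simp add: mexp_def cmat.scale_one add.assoc)
  moreover have "(\<Sum>j\<in>{2..<K}. (1 / fact j) \<bullet>\<^sub>C mpow X j) \<in> wle (- 2 * k)"
  proof (intro wle_sum wle_closed)
    fix j assume "j \<in> {2..<K}"
    then have "int j * (- k) \<le> - 2 * k" using k by simp
    then show "mpow X j \<in> wle (- 2 * k)" using wle_mono[OF mpow_in_wle[OF X]] by blast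
  qed
  ultimately show ?thesis by (simp add: algebra_simps)
qed

text \<open>First order expansion of \<open>exp (ad Y)\<close>: every other term contains at least
  two factors from \<open>wle (- k)\<close>, where \<open>U\<close> and \<open>V\<close> count
  twice. The second \<open>k\<close> gained over the linear term drives all later inductions on
  weights.\<close>

lemma Ad_mexp_wle:
  assumes Y: "Y \<in> wle (- k)" and k: "k \<ge> 1" and x: "x \<in> wle j"
  shows "Ad (mexp K Y) x - x - bracket Y x \<in> wle (j - 2 * k)"
proof -
  define U where "U = mexp K Y - mat 1 - Y"
  define V where "V = mexp K (- Y) - mat 1 - (- Y)"
  have U: "U \<in> wle (- 2 * k)" and V: "V \<in> wle (- 2 * k)"
    unfolding U_def V_def using Y k by (intro mexp_in_wle wle_closed; simp)+
  have e: "mexp K Y = mat 1 + Y + U" "mexp K (- Y) = mat 1 - Y + V" by (simp_all add: U_def V_def)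
  have Y1: "Y \<in> wle (-1)" using Y k wle_mono[of Y "-k" "-1"] by simp
  have "Ad (mexp K Y) x = mexp K Y ** x ** mexp K (- Y)"
    using Ad_mexp mpow_K[OF Y1] K_pos by blast
  then have "Ad (mexp K Y) x - x - bracket Y x
      = x ** V - Y ** x ** Y + Y ** x ** V + U ** x - U ** x ** Y + U ** x ** V"
    unfolding e bracket_def by (simp add: matrix_distribs algebra_simps)
  moreover have "Y ** x \<in> wle (j - k)" "U ** x \<in> wle (j - 2 * k)"
    using Y U x by (auto intro: wle_mult)
  moreover have "x ** V \<in> wle (j - 2 * k)" using V x by (auto intro: wle_mult)
  moreover have "Y ** x ** Y \<in> wle (j - 2 * k)" "Y ** x ** V \<in> wle (j - 2 * k)"
    "U ** x ** Y \<in> wle (j - 2 * k)" "U ** x ** V \<in> wle (j - 2 * k)"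
    using calculation(2,3) Y V k by (auto intro: wle_mult)
  ultimately show ?thesis by (auto intro!: wle_closed)
qed

section \<open>The torus acting through \<open>gam\<close>\<close>

lemma gam_P: "gam t ** P b = (if b \<in> {-N..N} then (t powi b) \<bullet>\<^sub>C P b else 0)"
  "P a ** gam t = (if a \<in> {-N..N} then (t powi a) \<bullet>\<^sub>C P a else 0)"
proof -
  have "gam t ** P b = (\<Sum>a\<in>{-N..N}. if a = b then (t powi b) \<bullet>\<^sub>C P b else 0)"
    unfolding gam_def matrix_mult_sum_left by (intro sum.cong) (auto simp: P_mult)
  then show "gam t ** P b = (if b \<in> {-N..N} then (t powi b) \<bullet>\<^sub>C P b else 0)" by simp
  have "P a ** gam t = (\<Sum>b\<in>{-N..N}. if b = a then (t powi a) \<bullet>\<^sub>C P a else 0)"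
    unfolding gam_def matrix_mult_sum_right by (intro sum.cong) (auto simp: P_mult)
  then show "P a ** gam t = (if a \<in> {-N..N} then (t powi a) \<bullet>\<^sub>C P a else 0)" by simp
qed

lemma gam_mult: "t \<noteq> 0 \<Longrightarrow> gam t ** gam (inverse t) = mat 1"
proof -
  assume t: "t \<noteq> 0"
  have "gam t ** gam (inverse t) = (\<Sum>a\<in>{-N..N}. (inverse t powi a) \<bullet>\<^sub>C (gam t ** P a))"
    by (simp add: gam_def[of "inverse t"] matrix_distribs)
  also have "\<dots> = (\<Sum>a\<in>{-N..N}. P a)"
    using t by (intro sum.cong) (auto simp: gam_P cscale_cscale power_int_inverse cmat.scale_one)
  finally show ?thesis by (simp add: P_sum)
qed

lemma block_Ad_gam:
  assumes "t \<noteq> 0"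
  shows "block a b (Ad (gam t) X) = (t powi (a - b)) \<bullet>\<^sub>C block a b X"
proof (cases "a \<in> {-N..N} \<and> b \<in> {-N..N}")
  case True
  have "matrix_inv (gam t) = gam (inverse t)"
    using gam_mult[of t] gam_mult[of "inverse t"] assms by (intro matrix_inv_eqI) auto
  then have "block a b (Ad (gam t) X) = (P a ** gam t) ** X ** (gam (inverse t) ** P b)"
    by (simp add: Ad_def block_def matrix_mul_assoc)
  also have "\<dots> = (t powi (a - b)) \<bullet>\<^sub>C block a b X"
    using True assms
    by (simp add: gam_P cscale_cscale block_def power_int_diff power_int_inverse divide_inverse mult.commute)
  finally show ?thesis .
qed (simp add: block_out)

lemma wcomp_Ad_gam: "t \<noteq> 0 \<Longrightarrow> wcomp i (Ad (gam t) X) = (t powi i) \<bullet>\<^sub>C wcomp i X"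
  by (rule block_eqI) (auto simp: block_comp block_Ad_gam)

lemma Ad_gam_homogeneous: "t \<noteq> 0 \<Longrightarrow> wcomp i X = X \<Longrightarrow> Ad (gam t) X = (t powi i) \<bullet>\<^sub>C X"
proof (rule block_eqI)
  fix a b assume *: "t \<noteq> 0" "wcomp i X = X"
  then show "block a b (Ad (gam t) X) = block a b ((t powi i) \<bullet>\<^sub>C X)"
    using block_comp[of a b i X] by (cases "a - b = i") (simp_all add: block_Ad_gam)
qed

lemma Ad_gam_wle: "t \<noteq> 0 \<Longrightarrow> X \<in> wle i \<Longrightarrow> Ad (gam t) X \<in> wle i"
  by (simp add: wle_iff_comp wcomp_Ad_gam)

end

section \<open>The grading defined by the cocharacter of an \<open>\<ss>\<ll>\<^sub>2\<close>-triple\<close>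

definition torus2 :: "complex \<Rightarrow> (2, 2) cmat"
  where "torus2 t = vector [vector [t, 0], vector [0, inverse t]]"

lemma torus2_SL2: "t \<noteq> 0 \<Longrightarrow> torus2 t \<in> SL2"
  by (simp add: torus2_def SL2_def det_2)

lemma torus2_mult: "torus2 s ** torus2 t = torus2 (s * t)"
  by (simp add: torus2_def vec_eq_iff forall_2 matrix_matrix_mult_def sum_2)

lemma torus2_1: "torus2 1 = mat 1"
  by (simp add: torus2_def vec_eq_iff forall_2 mat_def)

lemma torus2_deriv: "has_mderiv torus2 (vector [vector [1, 0], vector [0, -1]]) 1"
proof -
  have "((\<lambda>s. inverse s) has_field_derivative - 1) (at (1::complex))"
    using DERIV_inverse[of "1::complex" UNIV] by simp
  then show ?thesis
    by (auto simp: has_mderiv_def torus2_def forall_2)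
qed

text \<open>On the diagonal torus a polynomial becomes a Laurent polynomial; multiplying by
  \<open>t ^ n\<close> clears the poles and turns exponents between \<open>-n\<close> and
  \<open>n\<close> into degrees up to \<open>2 * n\<close>.\<close>

lemma cpoly_torus2:
  assumes "cpoly p"
  shows "\<exists>n q. degree q \<le> 2 * n \<and> (\<forall>t. t \<noteq> 0 \<longrightarrow> t ^ n * p (torus2 t) = poly q t)"
  using assms
proof induction
  case (coord i j)
  consider "i = 1" "j = 1" | "i = 2" "j = 2" | "i \<noteq> j" using exhaust_2[of i] exhaust_2[of j] by auto
  then show ?case
  proof cases
    case 1
    then show ?thesis by (intro exI[of _ 1] exI[of _ "[:0,0,1:]"]) (simp add: torus2_def)
  next
    case 2
    then show ?thesis by (intro exI[of _ 1] exI[of _ "[:1:]"]) (simp add: torus2_def)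
  next
    case 3
    then have "torus2 t $ i $ j = 0" for t
      using exhaust_2[of i] exhaust_2[of j] by (auto simp: torus2_def)
    then show ?thesis by (intro exI[of _ 0]) auto
  qed
next
  case (const c)
  show ?case by (intro exI[of _ 0] exI[of _ "[:c:]"]) simp
next
  case (add p q)
  then obtain n p' m q' where *: "degree p' \<le> 2 * n" "degree q' \<le> 2 * m"
    "\<And>t. t \<noteq> 0 \<Longrightarrow> t ^ n * p (torus2 t) = poly p' t" "\<And>t. t \<noteq> 0 \<Longrightarrow> t ^ m * q (torus2 t) = poly q' t" by metis
  have "degree (monom 1 m * p' + monom 1 n * q') \<le> 2 * (n + m)"
    by (intro degree_add_le order.trans[OF degree_mult_le]) (use * in \<open>auto simp: degree_monom_eq\<close>)
  moreover have "t ^ (n + m) * (p (torus2 t) + q (torus2 t)) = poly (monom 1 m * p' + monom 1 n * q') t" if "t \<noteq> 0" for t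
    by (simp add: poly_monom flip: *(3,4)[OF that]) (simp add: power_add algebra_simps)
  ultimately show ?case by blast
next
  case (mult p q)
  then obtain n p' m q' where *: "degree p' \<le> 2 * n" "degree q' \<le> 2 * m"
    "\<And>t. t \<noteq> 0 \<Longrightarrow> t ^ n * p (torus2 t) = poly p' t" "\<And>t. t \<noteq> 0 \<Longrightarrow> t ^ m * q (torus2 t) = poly q' t" by metis
  have "degree (p' * q') \<le> 2 * (n + m)"
    using * by (intro order.trans[OF degree_mult_le]) auto
  moreover have "t ^ (n + m) * (p (torus2 t) * q (torus2 t)) = poly (p' * q') t" if "t \<noteq> 0" for t
    by (simp flip: *(3,4)[OF that]) (simp add: power_add algebra_simps)
  ultimately show ?case by blast
qed

lemma matrix_poly_coeffs:
  fixes A B :: "nat \<Rightarrow> ('n::finite,'m::finite) cmat"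
  assumes "\<And>t. t \<noteq> 0 \<Longrightarrow> (\<Sum>k\<le>n. (t ^ k) \<bullet>\<^sub>C A k) = (\<Sum>k\<le>n. (t ^ k) \<bullet>\<^sub>C B k)" and k: "k \<le> n"
  shows "A k = B k"
proof -
  have "A k $ i $ j = B k $ i $ j" for i j
  proof -
    define p where "p = (\<Sum>k\<le>n. monom (A k $ i $ j) k)"
    define q where "q = (\<Sum>k\<le>n. monom (B k $ i $ j) k)"
    have "poly p t = poly q t" if "t \<noteq> 0" for t
      using arg_cong[OF assms(1)[OF that], of "\<lambda>X. X $ i $ j"]
      by (simp add: p_def q_def poly_sum poly_monom mult.commute)
    then have "- {0} \<subseteq> {t. poly (p - q) t = 0}" by auto
    moreover have "infinite (- {0::complex})"
      by (simp add: infinite_UNIV_char_0 Compl_eq_Diff_UNIV)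
    ultimately have "p - q = 0" using poly_roots_finite finite_subset by metis
    then have "coeff p k = coeff q k" by simp
    then show ?thesis using k by (simp add: p_def q_def coeff_sum)
  qed
  then show ?thesis by (simp add: vec_eq_iff)
qed

text \<open>Write \<open>t^m \<gamma>(t)\<close> as a matrix polynomial with coefficients
  \<open>Q k\<close>. Comparing coefficients in
  \<open>\<gamma> (s * t) = \<gamma> s ** \<gamma> t\<close> makes the \<open>Q k\<close> orthogonal
  idempotents, \<open>\<gamma> 1 = mat 1\<close> makes them complete, and the derivative at
  \<open>1\<close> exhibits \<open>h\<close> as the sum of the \<open>(k - m) Q k\<close>.\<close>

lemma sl2_hom_grading:
  fixes G :: "('n::finite,'n) cmat set"
  assumes G: "algebraic_group G" and Phi: "sl2_hom G e h f \<Phi>"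
  obtains P N where "weight_grading P N" "h = weight_grading.hh P N"
    "\<And>t. t \<noteq> 0 \<Longrightarrow> cocharacter \<Phi> t = weight_grading.gam P N t"
proof -
  define \<gamma> where "\<gamma> t = \<Phi> (torus2 t)" for t
  have mult: "\<gamma> (s * t) = \<gamma> s ** \<gamma> t" if "s \<noteq> 0" "t \<noteq> 0" for s t
    using Phi torus2_SL2 that unfolding sl2_hom_def \<gamma>_def by (metis torus2_mult)
  have "\<gamma> t \<in> G" if "t \<noteq> 0" for t
    using Phi torus2_SL2[OF that] unfolding sl2_hom_def \<gamma>_def by blast
  \<comment> \<open>\<open>\<gamma> 1\<close> is idempotent, and it is invertible as an element of
    \<open>G\<close>.\<close>
  then have one: "\<gamma> 1 = mat 1"
    using mult[of 1 1] algebraic_group_inv(3)[OF G, of "\<gamma> 1"]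
    by (metis matrix_mul_assoc matrix_mul_lid mult_1 zero_neq_one)
  have "\<forall>i j. \<exists>p. cpoly p \<and> (\<forall>x\<in>SL2. \<Phi> x $ i $ j = p x)"
    using Phi by (simp add: sl2_hom_def regular_map_def regular_fun_def)
  then have "\<forall>i j. \<exists>n q. degree q \<le> 2 * n \<and> (\<forall>t. t \<noteq> 0 \<longrightarrow> t ^ n * \<gamma> t $ i $ j = poly q t)"
    unfolding \<gamma>_def using cpoly_torus2 torus2_SL2 by metis
  then obtain n q where nq: "\<And>i j. degree (q i j) \<le> 2 * n i j"
    "\<And>i j t. t \<noteq> 0 \<Longrightarrow> t ^ n i j * \<gamma> t $ i $ j = poly (q i j) t" by metis
  \<comment> \<open>A common bound for the pole orders of all entries.\<close>
  define m where "m = Max (range (\<lambda>(i,j). n i j))"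
  have m: "n i j \<le> m" for i j
    unfolding m_def by (rule Max_ge) (auto intro: rev_image_eqI)
  define r where "r i j = monom 1 (m - n i j) * q i j" for i j
  have r: "degree (r i j) \<le> 2 * m" "t \<noteq> 0 \<Longrightarrow> t ^ m * \<gamma> t $ i $ j = poly (r i j) t" for i j t
  proof -
    have "degree (r i j) \<le> (m - n i j) + 2 * n i j"
      unfolding r_def using nq(1)[of i j] by (intro order.trans[OF degree_mult_le]) (auto simp: degree_monom_eq)
    then show "degree (r i j) \<le> 2 * m" using m[of i j] by linarith
    assume t: "t \<noteq> 0"
    have "t ^ m = t ^ (m - n i j) * t ^ n i j" using m[of i j] by (simp flip: power_add)
    then show "t ^ m * \<gamma> t $ i $ j = poly (r i j) t"
      by (simp add: r_def poly_monom mult.assoc flip: nq(2)[OF t])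
  qed
  define Q :: "nat \<Rightarrow> ('n,'n) cmat" where "Q k = (\<chi> i j. coeff (r i j) k)" for k
  have Q: "(t ^ m) \<bullet>\<^sub>C \<gamma> t = (\<Sum>k\<le>2*m. (t ^ k) \<bullet>\<^sub>C Q k)" if "t \<noteq> 0" for t
  proof -
    have "poly (r i j) t = (\<Sum>k\<le>2*m. t ^ k * coeff (r i j) k)" for i j
      unfolding poly_altdef using r(1)[of i j]
      by (intro sum.mono_neutral_cong_left) (auto simp: coeff_eq_0)
    then show ?thesis by (simp add: vec_eq_iff r(2)[OF that] Q_def)
  qed
  have QQ: "Q j ** Q k = (if j = k then Q j else 0)" if "j \<le> 2*m" "k \<le> 2*m" for j k
  proof -
    \<comment> \<open>Coefficients are compared first in \<open>s\<close> with \<open>t\<close>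
      fixed, afterwards in \<open>t\<close>.\<close>
    have *: "Q j ** (\<Sum>k\<le>2*m. (t ^ k) \<bullet>\<^sub>C Q k) = (t ^ j) \<bullet>\<^sub>C Q j" if t: "t \<noteq> 0" and j: "j \<le> 2*m" for j t
    proof (rule matrix_poly_coeffs[OF _ j])
      fix s :: complex assume s: "s \<noteq> 0"
      have "(\<Sum>j\<le>2*m. (s ^ j) \<bullet>\<^sub>C (Q j ** (\<Sum>k\<le>2*m. (t ^ k) \<bullet>\<^sub>C Q k))) = ((s ^ m) \<bullet>\<^sub>C \<gamma> s) ** ((t ^ m) \<bullet>\<^sub>C \<gamma> t)"
        by (simp add: Q[OF s] Q[OF t] matrix_mult_sum_left)
      also have "\<dots> = ((s * t) ^ m) \<bullet>\<^sub>C \<gamma> (s * t)"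
        using s t by (simp add: mult cscale_cscale power_mult_distrib mult.commute)
      also have "\<dots> = (\<Sum>j\<le>2*m. (s ^ j) \<bullet>\<^sub>C (t ^ j) \<bullet>\<^sub>C Q j)"
        using s t Q[of "s * t"] by (simp add: cscale_cscale power_mult_distrib)
      finally show "(\<Sum>j\<le>2*m. (s ^ j) \<bullet>\<^sub>C (Q j ** (\<Sum>k\<le>2*m. (t ^ k) \<bullet>\<^sub>C Q k))) = (\<Sum>j\<le>2*m. (s ^ j) \<bullet>\<^sub>C (t ^ j) \<bullet>\<^sub>C Q j)" .
    qed
    show ?thesis
    proof (rule matrix_poly_coeffs[OF _ that(2), of "\<lambda>k. Q j ** Q k" "\<lambda>k. if j = k then Q j else 0"])
      fix t :: complex assume "t \<noteq> 0"
      from *[OF this that(1)] show "(\<Sum>k\<le>2*m. (t ^ k) \<bullet>\<^sub>C (Q j ** Q k)) = (\<Sum>k\<le>2*m. (t ^ k) \<bullet>\<^sub>C (if j = k then Q j else 0))"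
        using that(1) by (simp add: matrix_mult_sum_right if_distrib[of "\<lambda>X. _ \<bullet>\<^sub>C X"] cong: if_cong)
    qed
  qed
  define N where "N = int m"
  define P where "P a = (if a \<in> {-N..N} then Q (nat (a + N)) else 0)" for a
  have reindex: "(\<Sum>a\<in>{-N..N}. g a (Q (nat (a + N)))) = (\<Sum>k\<le>2*m. g (int k - N) (Q k))"
    for g :: "int \<Rightarrow> ('n,'n) cmat \<Rightarrow> ('n,'n) cmat"
    by (rule sum.reindex_bij_witness[of _ "\<lambda>k. int k - N" "\<lambda>a. nat (a + N)"]) (auto simp: N_def)
  have sumQ: "(\<Sum>k\<le>2*m. Q k) = mat 1" using Q[of 1] by (simp add: one cmat.scale_one)
  have grading: "weight_grading P N"
  proof
    show "P a ** P b = (if a = b then P a else 0)" for a b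
      by (auto simp: P_def N_def QQ)
    show "(\<Sum>a\<in>{-N..N}. P a) = mat 1"
      using reindex[of "\<lambda>a X. X"] sumQ by (simp add: P_def)
  qed (auto simp: P_def N_def)
  interpret weight_grading P N by (rule grading)
  show thesis
  proof (rule that[OF grading])
    show "cocharacter \<Phi> t = gam t" if t: "t \<noteq> 0" for t
    proof -
      have "gam t = (\<Sum>k\<le>2*m. (t powi (int k - N)) \<bullet>\<^sub>C Q k)"
        using reindex[of "\<lambda>a X. (t powi a) \<bullet>\<^sub>C X"] by (simp add: gam_def P_def)
      also have "\<dots> = inverse (t ^ m) \<bullet>\<^sub>C (\<Sum>k\<le>2*m. (t ^ k) \<bullet>\<^sub>C Q k)"
        using t by (simp add: cmat.scale_sum_right cscale_cscale N_def power_int_diff divide_inverse mult.commute)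
      also have "\<dots> = \<gamma> t" using t by (simp flip: Q[OF t] add: cscale_cscale cmat.scale_one)
      finally show ?thesis by (simp add: cocharacter_def \<gamma>_def torus2_def)
    qed
    obtain p where p: "\<forall>i j. cpoly (\<lambda>A. p A $ i $ j)" "\<forall>A\<in>SL2. p A = \<Phi> A"
      "\<forall>i j. dir_deriv (\<lambda>A. p A $ i $ j) (mat 1) (vector [vector [1, 0], vector [0, -1]]) = h $ i $ j"
      using Phi unfolding sl2_hom_def has_differential_at_one_def by blast
    \<comment> \<open>Both sides are the derivative of \<open>t^m \<gamma>(t)\<close> at
      \<open>1\<close>: once by the product rule and the differential of \<open>\<Phi>\<close>, once
      from the expansion in the \<open>Q k\<close>, which is valid away from
      \<open>0\<close>.\<close>
    have "of_nat m \<bullet>\<^sub>C mat 1 + h = (\<Sum>k\<le>2*m. of_nat k \<bullet>\<^sub>C Q k)"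
    proof -
      have "(of_nat m \<bullet>\<^sub>C mat 1 + h) $ i $ j = (\<Sum>k\<le>2*m. of_nat k \<bullet>\<^sub>C Q k) $ i $ j" for i j
      proof -
        have "((\<lambda>t. p (torus2 t) $ i $ j) has_field_derivative h $ i $ j) (at 1)"
          using cpoly_chain[OF p(1)[rule_format, of i j] torus2_deriv] p(3) by (simp add: torus2_1)
        moreover have pone: "p (torus2 1) = mat 1"
          using p(2) torus2_SL2[of 1] one by (simp add: \<gamma>_def)
        ultimately have "((\<lambda>t. t ^ m * p (torus2 t) $ i $ j) has_field_derivative of_nat m * mat 1 $ i $ j + h $ i $ j) (at 1)"
          by (auto intro!: derivative_eq_intros)
        moreover have "((\<lambda>t. t ^ m * p (torus2 t) $ i $ j) has_field_derivative (\<Sum>k\<le>2*m. of_nat k * Q k $ i $ j)) (at 1)"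
        proof (rule has_field_derivative_transform_within_open[of "\<lambda>t. \<Sum>k\<le>2*m. t ^ k * Q k $ i $ j" _ _ "- {0}"])
          show "((\<lambda>t. \<Sum>k\<le>2*m. t ^ k * Q k $ i $ j) has_field_derivative (\<Sum>k\<le>2*m. of_nat k * Q k $ i $ j)) (at 1)"
            by (auto intro!: derivative_eq_intros)
          show "(\<Sum>k\<le>2*m. t ^ k * Q k $ i $ j) = t ^ m * p (torus2 t) $ i $ j" if "t \<in> - {0}" for t
            using arg_cong[OF Q[of t], of "\<lambda>X. X $ i $ j"] that p(2) torus2_SL2[of t] by (simp add: \<gamma>_def)
        qed auto
        ultimately show ?thesis by (simp add: DERIV_unique)
      qed
      then show ?thesis by (simp add: vec_eq_iff)
    qed
    then have "h = (\<Sum>k\<le>2*m. of_nat k \<bullet>\<^sub>C Q k) - of_nat m \<bullet>\<^sub>C (\<Sum>k\<le>2*m. Q k)"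
      unfolding sumQ by (simp add: eq_diff_eq add.commute)
    also have "\<dots> = (\<Sum>k\<le>2*m. of_int (int k - N) \<bullet>\<^sub>C Q k)"
      by (simp add: cmat.scale_sum_right N_def cmat.scale_left_diff_distrib sum_subtractf)
    also have "\<dots> = hh"
      using reindex[of "\<lambda>a X. of_int a \<bullet>\<^sub>C X"] by (simp add: hh_def P_def)
    finally show "h = hh" .
  qed
qed

section \<open>The graded Lie algebra of an \<open>\<ss>\<ll>\<^sub>2\<close>-triple\<close>

locale graded_sl2 = weight_grading P N
  for P :: "int \<Rightarrow> ('n::finite,'n) cmat" and N +
  fixes G :: "('n,'n) cmat set" and e f :: "('n,'n) cmat"
  assumes G: "algebraic_group G"
    and triple: "sl2_triple (lie_algebra G) e hh f"
    and gam_G: "\<And>t. t \<noteq> 0 \<Longrightarrow> gam t \<in> G"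
begin

abbreviation \<gg> :: "('n,'n) cmat set" where "\<gg> \<equiv> lie_algebra G"

lemmas subspace_g = subspace_lie_algebra[of G]
lemmas g_zero [simp] = cmat.subspace_0[OF subspace_g]
lemmas g_add = cmat.subspace_add[OF subspace_g]
lemmas g_diff = cmat.subspace_diff[OF subspace_g]
lemmas g_minus = cmat.subspace_neg[OF subspace_g]
lemmas g_scale = cmat.subspace_scale[OF subspace_g]
lemmas g_sum = cmat.subspace_sum[OF subspace_g]
lemmas g_bracket = bracket_lie_algebra[OF G]
lemmas g_Ad = Ad_lie_algebra[OF G]

lemma e_g: "e \<in> \<gg>" and f_g: "f \<in> \<gg>" and h_g: "hh \<in> \<gg>" and e_f: "bracket e f = hh"
  using triple by (simp_all add: sl2_triple_def)

lemma wcomp_e [simp]: "wcomp 2 e = e" and wcomp_f: "wcomp (-2) f = f"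
  using triple weight_iff[of e 2] weight_iff[of f "-2"] by (simp_all add: sl2_triple_def)

lemma e_wle: "e \<in> wle 2"
  by (rule homogeneous_in_wle) simp

lemma g_wcomp: "x \<in> \<gg> \<Longrightarrow> wcomp i x \<in> \<gg>"
  by (rule wcomp_in_stable[OF subspace_g]) (simp_all add: g_bracket h_g)

lemma wcomp_bracket_e: "wcomp i (bracket x e) = bracket (wcomp (i - 2) x) e"
  using wcomp_bracket_homogeneous(1)[OF wcomp_e] .

lemma weight_space_iff: "x \<in> weight_space \<gg> hh i \<longleftrightarrow> x \<in> \<gg> \<and> wcomp i x = x"
  by (simp add: weight_space_def weight_iff)

section \<open>Highest weight vectors of the triple\<close>

lemma weight_f_power: "wcomp i v = v \<Longrightarrow> wcomp (i - 2 * int k) ((bracket f ^^ k) v) = (bracket f ^^ k) v"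
proof (induction k)
  case (Suc k)
  have "i - 2 * int (Suc k) - (-2) = i - 2 * int k" by simp
  then show ?case
    using Suc wcomp_bracket_homogeneous(2)[OF wcomp_f, of "i - 2 * int (Suc k)" "(bracket f ^^ k) v"] by simp
qed simp

lemma weight_e_power: "wcomp i v = v \<Longrightarrow> wcomp (i + 2 * int k) ((bracket e ^^ k) v) = (bracket e ^^ k) v"
proof (induction k)
  case (Suc k)
  have "i + 2 * int (Suc k) - 2 = i + 2 * int k" by simp
  then show ?case
    using Suc wcomp_bracket_homogeneous(2)[OF wcomp_e, of "i + 2 * int (Suc k)" "(bracket e ^^ k) v"] by simp
qed simp

text \<open>Move \<open>ad e\<close> past one \<open>ad f\<close> at a time with
  \<open>[e, f] = h\<close>; the coefficient is the sum of the weights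
  \<open>i, i - 2, ..., i - 2k\<close> met on the way.\<close>

lemma bracket_e_f_power:
  assumes v: "wcomp i v = v" "bracket e v = 0"
  shows "bracket e ((bracket f ^^ Suc k) v) = of_int (int (Suc k) * (i - int k)) \<bullet>\<^sub>C (bracket f ^^ k) v"
proof (induction k)
  case 0
  show ?case
    using weight_iff[of v i] v by (simp add: bracket_jacobi[of e f v] e_f)
next
  case (Suc k)
  let ?w = "(bracket f ^^ Suc k) v"
  have "bracket e (bracket f ?w) = bracket hh ?w + bracket f (bracket e ?w)"
    by (simp only: bracket_jacobi[of e f ?w] e_f)
  also have "bracket hh ?w = of_int (i - 2 * int (Suc k)) \<bullet>\<^sub>C ?w"
    using weight_f_power[OF v(1), of "Suc k"] weight_iff by blast
  also have "bracket f (bracket e ?w) = of_int (int (Suc k) * (i - int k)) \<bullet>\<^sub>C ?w"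
    using Suc by simp
  also have "of_int (i - 2 * int (Suc k)) \<bullet>\<^sub>C ?w + of_int (int (Suc k) * (i - int k)) \<bullet>\<^sub>C ?w
      = of_int (int (Suc (Suc k)) * (i - int (Suc k))) \<bullet>\<^sub>C ?w"
    by (simp only: cmat.scale_left_distrib[symmetric] of_int_add[symmetric])
      (rule arg_cong[of _ _ "\<lambda>c. of_int c \<bullet>\<^sub>C ?w"], simp add: algebra_simps)
  finally show ?case by simp
qed

text \<open>For \<open>i < 0\<close> the coefficient \<open>(k + 1) * (i - k)\<close> never
  vanishes, so a nonzero \<open>v\<close> would have nonzero images under all powers of
  \<open>ad f\<close>, in weights that drop below \<open>-2N\<close>.\<close>

lemma ad_e_injective_homogeneous:
  assumes v: "wcomp i v = v" "bracket e v = 0" and i: "i < 0"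
  shows "v = 0"
proof (rule ccontr)
  assume "v \<noteq> 0"
  have "(bracket f ^^ k) v \<noteq> 0" for k
  proof (induction k)
    case (Suc k)
    have "(of_int (int (Suc k) * (i - int k)) :: complex) \<noteq> 0"
      using i by (simp only: of_int_eq_0_iff mult_eq_0_iff) linarith
    then show ?case using bracket_e_f_power[OF v, of k] Suc by fastforce
  qed (simp add: \<open>v \<noteq> 0\<close>)
  moreover have "wcomp (i - 2 * int (nat (N + 1))) ((bracket f ^^ nat (N + 1)) v) = 0"
    using i N_nonneg by (intro wcomp_out) auto
  ultimately show False using weight_f_power[OF v(1), of "nat (N + 1)"] by metis
qed

lemma ad_e_injective:
  assumes v: "v \<in> wle (-1)" "bracket v e = 0"
  shows "v = 0"
proof -
  have "wcomp i v = 0" for i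
  proof (cases "i < 0")
    case True
    have "bracket (wcomp i v) e = 0" using wcomp_bracket_e[of "i + 2" v] v(2) by simp
    then have "bracket e (wcomp i v) = 0" using bracket_swap[of e "wcomp i v"] by simp
    then show ?thesis using ad_e_injective_homogeneous[of i "wcomp i v"] True by (simp add: wcomp_comp)
  next
    case False
    then show ?thesis using v(1) by (simp add: wle_iff_comp)
  qed
  then show ?thesis using sum_comp[of v] by simp
qed

lemma e_power_linear:
  "(bracket e ^^ k) (c \<bullet>\<^sub>C x) = c \<bullet>\<^sub>C (bracket e ^^ k) x"
  "(bracket e ^^ k) (x - y) = (bracket e ^^ k) x - (bracket e ^^ k) y"
  by (induction k) (simp_all add: bracket_diff_right)

lemma power_g: "x \<in> \<gg> \<Longrightarrow> (bracket e ^^ k) x \<in> \<gg>" "x \<in> \<gg> \<Longrightarrow> (bracket f ^^ k) x \<in> \<gg>"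
  by (induction k) (simp_all add: g_bracket e_g f_g)

text \<open>Each step up undoes a step down with a factor \<open>(l + 1) * (i - l)\<close>,
  \<open>l < k\<close>, which is positive as \<open>k \<le> i\<close>.\<close>

lemma e_power_f_power:
  assumes u: "wcomp i u = u" "bracket e u = 0" and k: "int k \<le> i"
  shows "\<exists>c\<noteq>0. (bracket e ^^ k) ((bracket f ^^ k) u) = c \<bullet>\<^sub>C u"
  using k
proof (induction k)
  case 0
  show ?case by (intro exI[of _ 1]) (simp add: cmat.scale_one)
next
  case (Suc k)
  then obtain c where c: "c \<noteq> 0" "(bracket e ^^ k) ((bracket f ^^ k) u) = c \<bullet>\<^sub>C u" by auto
  let ?d = "of_int (int (Suc k) * (i - int k)) :: complex"
  have d: "?d \<noteq> 0" using Suc.prems by (simp only: of_int_eq_0_iff mult_eq_0_iff) linarith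
  have "(bracket e ^^ Suc k) ((bracket f ^^ Suc k) u) = (bracket e ^^ k) (bracket e ((bracket f ^^ Suc k) u))"
    by (simp only: funpow_Suc_right o_apply)
  also have "\<dots> = (?d * c) \<bullet>\<^sub>C u"
    unfolding bracket_e_f_power[OF u] e_power_linear c(2) by (rule cscale_cscale)
  finally show ?case using c(1) d by (intro exI[of _ "?d * c"]) simp
qed

text \<open>Induction on the power of \<open>ad e\<close> that kills \<open>w\<close>. The highest
  weight vector \<open>u = (ad e)^k w\<close> is also reached from a multiple \<open>v\<close> of
  \<open>(ad f)^k u\<close>. Then \<open>w - v\<close> is killed by a smaller power, and
  \<open>v\<close> is in the image because \<open>ad e\<close> sends \<open>(ad f)^(k+1) u\<close>
  to a nonzero multiple of it.\<close>

lemma ad_e_surjective: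
  assumes w: "w \<in> \<gg>" "wcomp j w = w" and j: "j \<ge> 1"
  shows "\<exists>y\<in>\<gg>. bracket y e = w"
proof -
  have gen: "\<exists>y\<in>\<gg>. bracket y e = w" if "w \<in> \<gg>" "wcomp j w = w" "(bracket e ^^ k) w = 0" for k w
    using that
  proof (induction k arbitrary: w)
    case 0
    then show ?case by (intro bexI[of _ 0]) simp_all
  next
    case (Suc k)
    let ?i = "j + 2 * int k"
    define u where "u = (bracket e ^^ k) w"
    have u: "wcomp ?i u = u" "bracket e u = 0" "u \<in> \<gg>"
      using weight_e_power[OF Suc.prems(2), of k] Suc.prems power_g by (simp_all add: u_def)
    obtain c where c: "c \<noteq> 0" "(bracket e ^^ k) ((bracket f ^^ k) u) = c \<bullet>\<^sub>C u"
      using e_power_f_power[OF u(1,2), of k] j by auto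
    define v where "v = (1 / c) \<bullet>\<^sub>C (bracket f ^^ k) u"
    have v: "v \<in> \<gg>" "wcomp j v = v" "(bracket e ^^ k) v = u"
      using weight_f_power[OF u(1), of k] u(3) c
      by (simp_all add: v_def g_scale power_g e_power_linear cscale_cscale cmat.scale_one)
    have "\<exists>y\<in>\<gg>. bracket y e = w - v"
      using Suc.prems v by (intro Suc.IH) (simp_all add: g_diff e_power_linear u_def)
    then obtain y where y: "y \<in> \<gg>" "bracket y e = w - v" by blast
    let ?d = "of_int (int (Suc k) * (?i - int k)) :: complex"
    \<comment> \<open>The second factor is \<open>j + k\<close>, positive because
      \<open>j \<ge> 1\<close>.\<close>
    have d: "?d \<noteq> 0" using j by (simp only: of_int_eq_0_iff mult_eq_0_iff) linarith
    define z where "z = (- (1 / (c * ?d))) \<bullet>\<^sub>C (bracket f ^^ Suc k) u"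
    have "bracket z e = (1 / (c * ?d)) \<bullet>\<^sub>C bracket e ((bracket f ^^ Suc k) u)"
      unfolding z_def bracket_cscale_left bracket_swap[of "(bracket f ^^ Suc k) u" e]
      by (simp only: cmat.scale_minus_left cmat.scale_minus_right minus_minus)
    also have "\<dots> = v"
      unfolding bracket_e_f_power[OF u(1,2)] v_def cscale_cscale using d by (simp only: times_divide_eq_left) simp
    finally have "bracket (y + z) e = w" using y by (simp add: bracket_add_left)
    moreover have "y + z \<in> \<gg>" using y(1) u(3) unfolding z_def by (intro g_add g_scale power_g)
    ultimately show ?case by blast
  qed
  have "wcomp (j + 2 * int (nat (N + 1))) ((bracket e ^^ nat (N + 1)) w) = 0"
    using j N_nonneg by (intro wcomp_out) auto
  then have "(bracket e ^^ nat (N + 1)) w = 0"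
    using weight_e_power[OF w(2), of "nat (N + 1)"] by metis
  then show ?thesis using gen w by blast
qed

lemma mexp_G: "y \<in> \<gg> \<Longrightarrow> y \<in> wle (-1) \<Longrightarrow> mexp K y \<in> G"
  using mexp_in_group[OF G _ mpow_K K_pos] .

lemma g_Ad_gam: "t \<noteq> 0 \<Longrightarrow> x \<in> \<gg> \<Longrightarrow> Ad (gam t) x \<in> \<gg>"
  by (simp add: g_Ad gam_G)

text \<open>Applied to each argument of the form separately, this reduces identities to homogeneous
  elements.\<close>

lemma additive_eq_0:
  assumes x: "x \<in> \<gg>" and add: "\<And>x y. x \<in> \<gg> \<Longrightarrow> y \<in> \<gg> \<Longrightarrow> F (x + y) = F x + (F y :: complex)"
    and zero: "\<And>i. F (wcomp i x) = 0"
  shows "F x = 0"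
proof -
  have F0: "F 0 = 0" using add[of 0 0] by simp
  have "F (\<Sum>i\<in>I. wcomp i x) = 0" for I
    by (induction I rule: infinite_finite_induct) (simp_all add: F0 add zero g_sum g_wcomp x)
  from this[of "{-(2*N)..2*N}"] show ?thesis by (simp add: sum_comp)
qed

end

section \<open>The invariant form and the subalgebra \<open>\<mm>\<close>\<close>

locale kazhdan_setting = graded_sl2 P N G e f
  for P :: "int \<Rightarrow> ('n::finite,'n) cmat" and N G e f +
  fixes \<beta> :: "('n,'n) cmat \<Rightarrow> ('n,'n) cmat \<Rightarrow> complex" and \<ll> M :: "('n,'n) cmat set"
  assumes form: "nondeg_invariant_form G \<beta>"
    and lagr: "lagrangian (lie_algebra G) \<beta> e hh \<ll>"
    and M: "unipotent_group M" "M \<subseteq> G" "lie_algebra M = premet_subalgebra (lie_algebra G) hh \<ll>"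
begin

definition \<mm> :: "('n,'n) cmat set" where "\<mm> = premet_subalgebra \<gg> hh \<ll>"

lemma form_add: "x \<in> \<gg> \<Longrightarrow> y \<in> \<gg> \<Longrightarrow> z \<in> \<gg> \<Longrightarrow> \<beta> (x + y) z = \<beta> x z + \<beta> y z"
  and form_scale: "x \<in> \<gg> \<Longrightarrow> y \<in> \<gg> \<Longrightarrow> \<beta> (c \<bullet>\<^sub>C x) y = c * \<beta> x y"
  and form_sym: "x \<in> \<gg> \<Longrightarrow> y \<in> \<gg> \<Longrightarrow> \<beta> x y = \<beta> y x"
  and form_Ad: "A \<in> G \<Longrightarrow> x \<in> \<gg> \<Longrightarrow> y \<in> \<gg> \<Longrightarrow> \<beta> (Ad A x) (Ad A y) = \<beta> x y"
  and form_nondeg: "x \<in> \<gg> \<Longrightarrow> (\<And>y. y \<in> \<gg> \<Longrightarrow> \<beta> x y = 0) \<Longrightarrow> x = 0"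
  using form by (simp_all add: nondeg_invariant_form_def Let_def)

lemma form_add_right: "x \<in> \<gg> \<Longrightarrow> y \<in> \<gg> \<Longrightarrow> z \<in> \<gg> \<Longrightarrow> \<beta> z (x + y) = \<beta> z x + \<beta> z y"
  by (metis form_add form_sym g_add)

lemma form_scale_right: "x \<in> \<gg> \<Longrightarrow> y \<in> \<gg> \<Longrightarrow> \<beta> y (c \<bullet>\<^sub>C x) = c * \<beta> y x"
  by (metis form_scale form_sym g_scale)

lemma form_minus: "x \<in> \<gg> \<Longrightarrow> y \<in> \<gg> \<Longrightarrow> \<beta> (- x) y = - \<beta> x y"
  using form_scale[of x y "-1"] by (simp add: cmat.scale_minus_left cmat.scale_one)

lemma form_minus_right: "x \<in> \<gg> \<Longrightarrow> y \<in> \<gg> \<Longrightarrow> \<beta> y (- x) = - \<beta> y x"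
  by (metis form_minus form_sym g_minus)

lemma form_diff: "x \<in> \<gg> \<Longrightarrow> y \<in> \<gg> \<Longrightarrow> z \<in> \<gg> \<Longrightarrow> \<beta> (x - y) z = \<beta> x z - \<beta> y z"
  using form_add[of x "- y" z] form_minus[of y z] by (simp add: g_minus)

lemma form_diff_right: "x \<in> \<gg> \<Longrightarrow> y \<in> \<gg> \<Longrightarrow> z \<in> \<gg> \<Longrightarrow> \<beta> z (x - y) = \<beta> z x - \<beta> z y"
  by (metis form_diff form_sym g_diff)

lemma form_zero: "y \<in> \<gg> \<Longrightarrow> \<beta> 0 y = 0" "y \<in> \<gg> \<Longrightarrow> \<beta> y 0 = 0"
  using form_scale[of 0 y 0] form_scale_right[of 0 y 0] by simp_all

text \<open>Invariance under \<open>gam 2\<close> multiplies the value by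
  \<open>2 powi (i + j)\<close>; the number \<open>2\<close> serves because it is not a root of
  unity.\<close>

lemma form_orthogonal:
  assumes x: "x \<in> \<gg>" "wcomp i x = x" and y: "y \<in> \<gg>" "wcomp j y = y" and ij: "i + j \<noteq> 0"
  shows "\<beta> x y = 0"
proof -
  have ne1: "(2::complex) ^ n \<noteq> 1" if "n > 0" for n
  proof
    assume "(2::complex) ^ n = 1"
    then have "norm ((2::complex) ^ n) = 1" by simp
    then have "(2::real) ^ n = 1" by (simp add: norm_power)
    then show False using one_less_power[of "2::real" n] that by simp
  qed
  have ne: "(2::complex) powi (i + j) \<noteq> 1"
  proof (cases "i + j" rule: int_cases2)
    case (nonneg n)
    then show ?thesis using ne1[of n] ij by auto
  next
    case (nonpos n)
    then show ?thesis using ne1[of n] ij by (auto simp: power_int_minus)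
  qed
  have "\<beta> x y = \<beta> (Ad (gam 2) x) (Ad (gam 2) y)"
    using form_Ad[OF gam_G x(1) y(1)] by simp
  also have "\<dots> = 2 powi (i + j) * \<beta> x y"
    using x y by (simp add: Ad_gam_homogeneous[of 2 i x] Ad_gam_homogeneous[of 2 j y] form_scale form_scale_right g_scale power_int_add)
  finally show ?thesis using ne by simp
qed

lemma form_homogeneous:
  assumes x: "x \<in> \<gg>" and y: "y \<in> \<gg>" "wcomp j y = y"
  shows "\<beta> x y = \<beta> (wcomp (- j) x) y"
proof -
  have "\<beta> (x - wcomp (- j) x) y = 0"
  proof (rule additive_eq_0[of "x - wcomp (- j) x" "\<lambda>x. \<beta> x y"])
    show "\<beta> (wcomp i (x - wcomp (- j) x)) y = 0" for i
      using form_orthogonal[of "wcomp i x" i y j] x y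
      by (auto simp: wcomp_comp form_zero g_wcomp)
  qed (use x y in \<open>simp_all add: g_diff g_wcomp form_add\<close>)
  then show ?thesis using x y by (simp add: form_diff g_wcomp)
qed

lemma form_wle:
  assumes x: "x \<in> \<gg>" "x \<in> wle i" and y: "y \<in> \<gg>" "y \<in> wle j" and ij: "i + j < 0"
  shows "\<beta> x y = 0"
proof (rule additive_eq_0[OF y(1), of "\<beta> x"])
  fix k
  have "\<beta> x (wcomp k y) = \<beta> (wcomp (- k) x) (wcomp k y)"
    using x y by (intro form_homogeneous) (simp_all add: g_wcomp wcomp_comp)
  moreover have "wcomp (- k) x = 0 \<or> wcomp k y = 0"
    using x(2) y(2) ij by (cases "k > j") (simp_all add: wle_iff_comp)
  ultimately show "\<beta> x (wcomp k y) = 0" using x y by (auto simp: form_zero g_wcomp)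
qed (use x in \<open>simp add: form_add_right\<close>)

text \<open>
  For homogeneous arguments only the first order term of \<open>\<beta> (Ad (exp z) x) (Ad (exp z) y)\<close> has
  total weight zero.
\<close>

lemma form_bracket_homogeneous:
  assumes z: "z \<in> \<gg>" "wcomp i z = z" "i < 0" and x: "x \<in> \<gg>" "wcomp j x = x" and y: "y \<in> \<gg>" "wcomp k y = y"
  shows "\<beta> (bracket z x) y + \<beta> x (bracket z y) = 0"
proof -
  have b: "wcomp (i + j) (bracket z x) = bracket z x" "wcomp (i + k) (bracket z y) = bracket z y"
    using wcomp_bracket_homogeneous(2)[OF z(2)] x(2) y(2) by simp_all
  show ?thesis
  proof (cases "i + j + k = 0")
    case False
    then have "\<beta> (bracket z x) y = 0" "\<beta> x (bracket z y) = 0"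
      using b x y z by (intro form_orthogonal[of _ "i + j" _ k] form_orthogonal[of _ j _ "i + k"]; simp add: g_bracket)+
    then show ?thesis by simp
  next
    case True
    \<comment> \<open>The first bound has the shape required by \<open>Ad_mexp_wle\<close>, with
      \<open>k = - i\<close>.\<close>
    have zw: "z \<in> wle (- (- i))" "z \<in> wle (-1)"
      using homogeneous_in_wle[OF z(2)] wle_mono[of z i "-1"] z(3) by auto
    have xw: "x \<in> wle j" and yw: "y \<in> wle k" using homogeneous_in_wle x y by auto
    have bw: "bracket z x \<in> wle (i + j)" "bracket z y \<in> wle (i + k)" using homogeneous_in_wle b by auto
    let ?A = "mexp K z"
    define r where "r = Ad ?A x - x - bracket z x"
    define s where "s = Ad ?A y - y - bracket z y"
    have A: "?A \<in> G" using mexp_G z(1) zw(2) .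
    have rw: "r \<in> wle (j + 2 * i)" and sw: "s \<in> wle (k + 2 * i)"
      unfolding r_def s_def using Ad_mexp_wle[OF zw(1)] z(3) xw yw by fastforce+
    have mem: "r \<in> \<gg>" "s \<in> \<gg>" "bracket z x \<in> \<gg>" "bracket z y \<in> \<gg>"
      unfolding r_def s_def using A x y z by (simp_all add: g_diff g_Ad g_bracket)
    have "\<beta> x y = \<beta> (x + (bracket z x + r)) (y + (bracket z y + s))"
      using form_Ad[OF A x(1) y(1)] by (simp add: r_def s_def)
    also have "\<dots> = \<beta> x y + \<beta> x (bracket z y) + \<beta> (bracket z x) y
      + (\<beta> x s + \<beta> (bracket z x) (bracket z y) + \<beta> (bracket z x) s + \<beta> r y + \<beta> r (bracket z y) + \<beta> r s)"
      using mem x y by (simp add: form_add form_add_right g_add)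
    \<comment> \<open>The six terms in parentheses have total weight at most
      \<open>2 * i + j + k = i < 0\<close>, so \<open>form_wle\<close> kills each of them.\<close>
    also have "\<beta> x s = 0" using True z(3) by (intro form_wle[OF x(1) xw mem(2) sw]) linarith
    also have "\<beta> (bracket z x) (bracket z y) = 0" using True z(3) by (intro form_wle[OF mem(3) bw(1) mem(4) bw(2)]) linarith
    also have "\<beta> (bracket z x) s = 0" using True z(3) by (intro form_wle[OF mem(3) bw(1) mem(2) sw]) linarith
    also have "\<beta> r y = 0" using True z(3) by (intro form_wle[OF mem(1) rw y(1) yw]) linarith
    also have "\<beta> r (bracket z y) = 0" using True z(3) by (intro form_wle[OF mem(1) rw mem(4) bw(2)]) linarith
    also have "\<beta> r s = 0" using True z(3) by (intro form_wle[OF mem(1) rw mem(2) sw]) linarith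
    finally show ?thesis by (simp add: add.commute)
  qed
qed

text \<open>Derived from invariance under \<open>Ad\<close>, hence for \<open>z\<close> of negative
  weights, whose exponentials lie in \<open>G\<close>. Additivity in \<open>z\<close>,
  \<open>x\<close> and \<open>y\<close> leaves the homogeneous case.\<close>

lemma form_bracket:
  assumes z: "z \<in> \<gg>" "z \<in> wle (-1)" and x: "x \<in> \<gg>" and y: "y \<in> \<gg>"
  shows "\<beta> (bracket z x) y = - \<beta> x (bracket z y)"
proof -
  have "\<beta> (bracket z x) y + \<beta> x (bracket z y) = 0"
  proof (rule additive_eq_0[OF z(1), of "\<lambda>z. \<beta> (bracket z x) y + \<beta> x (bracket z y)"])
    fix i
    show "\<beta> (bracket (wcomp i z) x) y + \<beta> x (bracket (wcomp i z) y) = 0"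
    proof (cases "i < 0")
      case False
      then show ?thesis using z x y by (simp add: wle_iff_comp form_zero)
    next
      case True
      show ?thesis
      proof (rule additive_eq_0[OF x, of "\<lambda>x. \<beta> (bracket (wcomp i z) x) y + \<beta> x (bracket (wcomp i z) y)"])
        fix j
        show "\<beta> (bracket (wcomp i z) (wcomp j x)) y + \<beta> (wcomp j x) (bracket (wcomp i z) y) = 0"
        proof (rule additive_eq_0[OF y, of "\<lambda>y. \<beta> (bracket (wcomp i z) (wcomp j x)) y + \<beta> (wcomp j x) (bracket (wcomp i z) y)"])
          show "\<beta> (bracket (wcomp i z) (wcomp j x)) (wcomp k y) + \<beta> (wcomp j x) (bracket (wcomp i z) (wcomp k y)) = 0" for k
            using True x y z by (intro form_bracket_homogeneous[of _ i _ j _ k]) (simp_all add: g_wcomp wcomp_comp)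
        qed (use x z in \<open>simp add: form_add_right bracket_add_right g_bracket g_wcomp\<close>)
      qed (use y z in \<open>simp add: form_add bracket_add_right g_bracket g_wcomp\<close>)
    qed
  qed (use x y in \<open>simp add: form_add form_add_right bracket_add_left g_bracket\<close>)
  then show ?thesis by (simp add: add_eq_0_iff)
qed

section \<open>The subalgebra \<open>\<mm>\<close> as the Lie algebra of \<open>M\<close>\<close>

lemma subspace_l: "cmat.subspace \<ll>"
  and l_iff: "x \<in> \<ll> \<longleftrightarrow> x \<in> \<gg> \<and> wcomp (-1) x = x \<and> (\<forall>y\<in>\<ll>. \<beta> e (bracket x y) = 0)"
proof -
  show "cmat.subspace \<ll>" using lagr by (simp add: lagrangian_def)
  have "\<ll> = {x \<in> weight_space \<gg> hh (-1). \<forall>y\<in>\<ll>. \<beta> e (bracket x y) = 0}"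
    using lagr by (simp add: lagrangian_def)
  then show "x \<in> \<ll> \<longleftrightarrow> x \<in> \<gg> \<and> wcomp (-1) x = x \<and> (\<forall>y\<in>\<ll>. \<beta> e (bracket x y) = 0)"
    using weight_space_iff[of x "-1"] by blast
qed

lemma l_g: "x \<in> \<ll> \<Longrightarrow> x \<in> \<gg>"
  and l_weight: "x \<in> \<ll> \<Longrightarrow> wcomp (-1) x = x"
  and l_isotropic: "x \<in> \<ll> \<Longrightarrow> y \<in> \<ll> \<Longrightarrow> \<beta> e (bracket x y) = 0"
  using l_iff by blast+

lemma l_wle: "x \<in> \<ll> \<Longrightarrow> x \<in> wle (-1)"
  by (rule homogeneous_in_wle) (rule l_weight)

text \<open>All weight components of an element of the right-hand side lie in the span. The span
  thus becomes a condition on weights, the form in which membership is checked later.\<close>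

lemma m_eq: "\<mm> = {y \<in> \<gg>. y \<in> wle (-1) \<and> wcomp (-1) y \<in> \<ll>}"
proof
  have "cmat.subspace {y \<in> \<gg>. y \<in> wle (-1) \<and> wcomp (-1) y \<in> \<ll>}"
    unfolding cmat.subspace_def
    using subspace_g subspace_l subspace_wle[of "-1"] by (auto simp: cmat.subspace_def)
  moreover have "\<ll> \<subseteq> {y \<in> \<gg>. y \<in> wle (-1) \<and> wcomp (-1) y \<in> \<ll>}"
    by (auto simp: l_g l_wle l_weight)
  moreover have "y \<in> {y \<in> \<gg>. y \<in> wle (-1) \<and> wcomp (-1) y \<in> \<ll>}" if "i \<le> -2" "y \<in> weight_space \<gg> hh i" for i y
  proof -
    have y: "y \<in> \<gg>" "wcomp i y = y" using that(2) by (simp_all add: weight_space_iff)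
    have "y \<in> wle (-2)" using that(1) homogeneous_in_wle[OF y(2)] wle_mono by blast
    then have "wcomp (-1) y = 0" "y \<in> wle (-1)" using wle_mono[of y "-2" "-1"] by (auto simp: wle_iff_comp)
    then show ?thesis using y cmat.subspace_0[OF subspace_l] by simp
  qed
  ultimately show "\<mm> \<subseteq> {y \<in> \<gg>. y \<in> wle (-1) \<and> wcomp (-1) y \<in> \<ll>}"
    unfolding \<mm>_def premet_subalgebra_def by (intro cmat.span_minimal) auto
next
  show "{y \<in> \<gg>. y \<in> wle (-1) \<and> wcomp (-1) y \<in> \<ll>} \<subseteq> \<mm>"
  proof
    fix y assume y: "y \<in> {y \<in> \<gg>. y \<in> wle (-1) \<and> wcomp (-1) y \<in> \<ll>}"
    have "wcomp i y \<in> \<mm>" for i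
    proof -
      consider "i > -1" | "i = -1" | "i \<le> -2" by linarith
      then show ?thesis
      proof cases
        case 1
        then show ?thesis using y by (simp add: wle_iff_comp \<mm>_def premet_subalgebra_def cmat.span_zero)
      next
        case 2
        then show ?thesis using y unfolding \<mm>_def premet_subalgebra_def by (intro cmat.span_base) simp
      next
        case 3
        have "wcomp i y \<in> weight_space \<gg> hh i" using y by (simp add: weight_space_iff g_wcomp wcomp_comp)
        then show ?thesis using 3 unfolding \<mm>_def premet_subalgebra_def by (intro cmat.span_base) auto
      qed
    qed
    then have "(\<Sum>i\<in>{-(2*N)..2*N}. wcomp i y) \<in> \<mm>"
      unfolding \<mm>_def premet_subalgebra_def by (intro cmat.span_sum)
    then show "y \<in> \<mm>" by (simp add: sum_comp)
  qed
qed

lemma subspace_m: "cmat.subspace \<mm>"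
  by (simp add: \<mm>_def premet_subalgebra_def cmat.subspace_span)

lemma m_g: "y \<in> \<mm> \<Longrightarrow> y \<in> \<gg>" and m_wle: "y \<in> \<mm> \<Longrightarrow> y \<in> wle (-1)"
  and m_l: "y \<in> \<mm> \<Longrightarrow> wcomp (-1) y \<in> \<ll>"
  by (simp_all add: m_eq)

lemma M_group: "algebraic_group M"
  using M(1) by (simp add: unipotent_group_def)

lemma mexp_M: "y \<in> \<mm> \<Longrightarrow> mexp K y \<in> M"
  using mexp_in_group[OF M_group _ mpow_K K_pos, of y] M(3) m_wle by (simp add: \<mm>_def)

text \<open>The logarithm from \<open>unipotent_log\<close> lies in the Lie algebra
  \<open>\<mm>\<close> of \<open>M\<close>, whose negative weights make its \<open>K\<close>-th
  power vanish.\<close>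

lemma M_mexp:
  assumes "A \<in> M"
  obtains y where "y \<in> \<mm>" "A = mexp K y"
proof -
  obtain L where L: "L \<in> lie_algebra M" "\<And>K. mpow L K = 0 \<Longrightarrow> K > 0 \<Longrightarrow> A = mexp K L"
    using unipotent_log[OF M_group assms] M(1) assms by (auto simp: unipotent_group_def)
  then have "L \<in> \<mm>" using M(3) by (simp add: \<mm>_def)
  moreover from this have "A = mexp K L" using L(2) mpow_K m_wle K_pos by blast
  ultimately show thesis using that by blast
qed

lemma M_G: "A \<in> M \<Longrightarrow> A \<in> G"
  using M(2) by blast

text \<open>\<open>e\<close> pairs only with weight \<open>-2\<close>, and that part of
  \<open>[y, z]\<close> comes from the weight \<open>-1\<close> components, which lie in the
  isotropic subspace \<open>\<ll>\<close>. So the form with \<open>e\<close> is a character of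
  \<open>\<mm>\<close>.\<close>

lemma character:
  assumes y: "y \<in> \<mm>" and z: "z \<in> \<mm>"
  shows "\<beta> e (bracket y z) = 0"
proof -
  let ?y = "wcomp (-1) y" and ?z = "wcomp (-1) z"
  have mem: "?y \<in> \<gg>" "?z \<in> \<gg>" "y \<in> \<gg>" "z \<in> \<gg>" using y z m_g by (auto simp: g_wcomp)
  have tail: "x - wcomp (-1) x \<in> wle (-2)" if "x \<in> wle (-1)" for x
    using wle_lower[OF wle_closed(3)[OF that wcomp_in_wle]] by (simp add: wcomp_comp)
  have yw: "y - ?y \<in> wle (-2)" "z - ?z \<in> wle (-2)" "?y \<in> wle (-1)" "?z \<in> wle (-1)" "z \<in> wle (-1)"
    using tail[OF m_wle[OF y]] tail[OF m_wle[OF z]] m_wle[OF z] wcomp_in_wle by auto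
  have d: "y - ?y \<in> \<gg>" "z - ?z \<in> \<gg>" using mem g_diff by auto
  have "bracket y z = bracket ?y ?z + (bracket (y - ?y) z + bracket ?y (z - ?z))"
    by (simp add: bracket_diff_left bracket_diff_right)
  moreover have "bracket (y - ?y) z + bracket ?y (z - ?z) \<in> wle (-3)"
    using yw wle_bracket by (auto intro!: wle_closed)
  then have "\<beta> e (bracket (y - ?y) z + bracket ?y (z - ?z)) = 0"
    using mem d by (intro form_wle[OF e_g e_wle]) (auto intro!: g_add g_bracket)
  moreover have "\<beta> e (bracket ?y ?z) = 0"
    using m_l[OF y] m_l[OF z] by (rule l_isotropic)
  ultimately show ?thesis
    using mem d by (simp add: form_add_right e_g g_add g_bracket)
qed

section \<open>The fibre of the moment map\<close>

definition mperp :: "('n,'n) cmat set" where "mperp = {v \<in> \<gg>. \<forall>y\<in>\<mm>. \<beta> v y = 0}"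

lemma mperp_g: "v \<in> mperp \<Longrightarrow> v \<in> \<gg>"
  by (simp add: mperp_def)

lemma subspace_mperp: "cmat.subspace mperp"
  unfolding cmat.subspace_def by (auto simp: mperp_def form_zero form_add form_scale m_g g_add g_scale)

lemma fibre_iff: "x \<in> moment_fibre \<gg> \<beta> \<mm> e \<longleftrightarrow> x - e \<in> mperp"
proof -
  have "x \<in> \<gg> \<longleftrightarrow> x - e \<in> \<gg>" using g_add[of "x - e" e] g_diff[of x e] e_g by auto
  then show ?thesis
    by (auto simp: moment_fibre_def mperp_def form_diff e_g m_g)
qed

lemma wle_0_mperp: "v \<in> \<gg> \<Longrightarrow> v \<in> wle 0 \<Longrightarrow> v \<in> mperp"
  using form_wle[of v 0 _ "-1"] m_g m_wle by (simp add: mperp_def)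

text \<open>\<open>\<mm>\<close> contains all weights at most \<open>-2\<close>, and these pair
  nondegenerately with the weights at least \<open>2\<close>.\<close>

lemma mperp_wle_1:
  assumes v: "v \<in> mperp"
  shows "v \<in> wle 1"
  unfolding wle_iff_comp
proof (intro allI impI)
  fix j :: int assume j: "j > 1"
  have vg: "v \<in> \<gg>" using v by (rule mperp_g)
  show "wcomp j v = 0"
  proof (rule form_nondeg)
    fix z assume z: "z \<in> \<gg>"
    have zj: "wcomp (- j) z \<in> \<mm>"
    proof -
      have "wcomp (- j) z \<in> wle (-2)" using wcomp_in_wle[of "- j" z] j wle_mono by simp
      then have "wcomp (- j) z \<in> wle (-1)" "wcomp (-1) (wcomp (- j) z) = 0"
        using wle_mono[of _ "-2" "-1"] j by (auto simp: wcomp_comp)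
      then show ?thesis using z cmat.subspace_0[OF subspace_l] by (simp add: m_eq g_wcomp)
    qed
    have "\<beta> (wcomp j v) z = \<beta> z (wcomp j v)" using vg z by (simp add: form_sym g_wcomp)
    also have "\<dots> = \<beta> (wcomp (- j) z) (wcomp j v)"
      using vg z by (intro form_homogeneous) (simp_all add: g_wcomp wcomp_comp)
    also have "\<dots> = \<beta> (wcomp j v) (wcomp (- j) z)" using vg z by (simp add: form_sym g_wcomp)
    also have "\<dots> = \<beta> v (wcomp (- j) z)"
      using form_homogeneous[of v "wcomp (- j) z" "- j"] vg z by (simp add: g_wcomp wcomp_comp)
    also have "\<dots> = 0" using v zj by (simp add: mperp_def)
    finally show "\<beta> (wcomp j v) z = 0" .
  qed (simp add: vg g_wcomp)
qed

lemma bracket_m_e: "y \<in> \<mm> \<Longrightarrow> bracket y e \<in> mperp"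
  using form_bracket[of y e] character m_g m_wle by (simp add: mperp_def g_bracket e_g)

lemma bracket_m_mperp: "y \<in> \<mm> \<Longrightarrow> v \<in> mperp \<Longrightarrow> bracket y v \<in> mperp"
  by (intro wle_0_mperp) (auto intro: g_bracket m_g mperp_g wle_bracket[OF m_wle mperp_wle_1])

lemma fibre_g: "x \<in> moment_fibre \<gg> \<beta> \<mm> e \<Longrightarrow> x \<in> \<gg>"
  by (simp add: moment_fibre_def)

lemma fibre_wle: "x \<in> moment_fibre \<gg> \<beta> \<mm> e \<Longrightarrow> x \<in> wle 2"
  using fibre_iff mperp_wle_1[of "x - e"] wle_mono[of "x - e" 1 2] wle_closed(2)[of "x - e" 2 e] e_wle by simp

lemma bracket_m_fibre: "y \<in> \<mm> \<Longrightarrow> x \<in> moment_fibre \<gg> \<beta> \<mm> e \<Longrightarrow> bracket y x \<in> mperp"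
  using bracket_m_e[of y] bracket_m_mperp[of y "x - e"] fibre_iff cmat.subspace_add[OF subspace_mperp]
  by (metis bracket_add_right diff_add_cancel)

text \<open>Since \<open>x\<close> has weights at most \<open>2\<close>, the remainder after the
  linear term \<open>[y, x]\<close> has weights at most \<open>0\<close>, where membership in
  \<open>mperp\<close> is automatic. The linear term itself is in \<open>mperp\<close> because the
  form with \<open>e\<close> is a character of \<open>\<mm>\<close>.\<close>

lemma M_fibre:
  assumes A: "A \<in> M" and x: "x \<in> moment_fibre \<gg> \<beta> \<mm> e"
  shows "Ad A x \<in> moment_fibre \<gg> \<beta> \<mm> e"
proof -
  obtain y where y: "y \<in> \<mm>" "A = mexp K y" using M_mexp[OF A] .
  have "Ad A x - x - bracket y x \<in> wle 0"
    using Ad_mexp_wle[of y 1 x 2] m_wle[OF y(1)] fibre_wle[OF x] by (simp add: y(2))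
  then have "Ad A x - x - bracket y x \<in> mperp"
    using fibre_g[OF x] m_g[OF y(1)] M_G[OF A] by (intro wle_0_mperp) (auto intro!: g_diff g_Ad g_bracket)
  then have "(Ad A x - x - bracket y x) + (bracket y x + (x - e)) \<in> mperp"
    using bracket_m_fibre[OF y(1) x] x unfolding fibre_iff
    by (intro cmat.subspace_add[OF subspace_mperp])
  then show ?thesis by (simp add: fibre_iff)
qed

text \<open>Orthogonality to all weights at most \<open>0\<close> leaves only negative weights. In
  weight \<open>-1\<close> the test vectors \<open>[z, e]\<close> with \<open>z \<in> \<ll>\<close>
  put the component into the symplectic complement of \<open>\<ll>\<close>, which is
  \<open>\<ll>\<close> itself.\<close>

lemma mperp_perp:
  assumes w: "w \<in> \<gg>" and perp: "\<And>v. v \<in> mperp \<Longrightarrow> \<beta> w v = 0"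
  shows "w \<in> \<mm>"
proof -
  have wle: "w \<in> wle (-1)"
    unfolding wle_iff_comp
  proof (intro allI impI)
    fix j :: int assume j: "j > -1"
    show "wcomp j w = 0"
    proof (rule form_nondeg)
      fix z assume z: "z \<in> \<gg>"
      have "\<beta> (wcomp j w) z = \<beta> z (wcomp j w)" using w z by (simp add: form_sym g_wcomp)
      also have "\<dots> = \<beta> (wcomp (- j) z) (wcomp j w)"
        using w z by (intro form_homogeneous) (simp_all add: g_wcomp wcomp_comp)
      also have "\<dots> = \<beta> (wcomp j w) (wcomp (- j) z)" using w z by (simp add: form_sym g_wcomp)
      also have "\<dots> = \<beta> w (wcomp (- j) z)"
        using form_homogeneous[of w "wcomp (- j) z" "- j"] w z by (simp add: g_wcomp wcomp_comp)
      also have "\<dots> = 0"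
        using wcomp_in_wle[of "- j" z] j wle_mono[of "wcomp (- j) z" "- j" 0] z
        by (intro perp wle_0_mperp) (auto simp: g_wcomp)
      finally show "\<beta> (wcomp j w) z = 0" .
    qed (simp add: w g_wcomp)
  qed
  let ?w = "wcomp (-1) w"
  have wg: "?w \<in> \<gg>" "?w \<in> wle (-1)" using w by (simp_all add: g_wcomp wcomp_in_wle)
  have "\<beta> e (bracket ?w z) = 0" if z: "z \<in> \<ll>" for z
  proof -
    have zm: "z \<in> \<mm>" "z \<in> \<gg>" "wcomp (-1) z = z"
      using z by (simp_all add: m_eq l_g l_wle l_weight)
    have b: "bracket z e \<in> \<gg>" "wcomp 1 (bracket z e) = bracket z e"
      using zm wcomp_bracket_e[of 1 z] by (simp_all add: g_bracket e_g)
    have "\<beta> ?w (bracket z e) = \<beta> w (bracket z e)"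
      using form_homogeneous[OF w b] by simp
    also have "\<dots> = 0" using perp bracket_m_e zm by blast
    finally have "\<beta> (bracket z ?w) e = 0"
      using form_bracket[of z ?w e] zm wg m_wle e_g by simp
    then have "\<beta> e (bracket z ?w) = 0"
      using form_sym[OF e_g g_bracket[OF zm(2) wg(1)]] by simp
    then show ?thesis
      using bracket_swap[of ?w z] form_minus_right[OF g_bracket[OF zm(2) wg(1)] e_g] by simp
  qed
  then have "?w \<in> \<ll>" using l_iff[of ?w] wg by (simp add: wcomp_comp)
  then show ?thesis using w wle by (simp add: m_eq)
qed

lemma Ad_gam_m: "t \<noteq> 0 \<Longrightarrow> y \<in> \<mm> \<Longrightarrow> Ad (gam t) y \<in> \<mm>"
  by (simp add: m_eq g_Ad_gam Ad_gam_wle wcomp_Ad_gam cmat.subspace_scale[OF subspace_l])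

end

context kazhdan_setting
begin

abbreviation fib :: "('n,'n) cmat set" where "fib \<equiv> moment_fibre \<gg> \<beta> \<mm> e"

section \<open>Invariance of the Poisson bracket\<close>

text \<open>Nondegeneracy gives the existence and uniqueness behind the \<open>THE\<close> in the
  definition.\<close>

lemma gradient:
  assumes "cpoly F"
  shows "gradient \<gg> \<beta> F x \<in> \<gg>" "y \<in> \<gg> \<Longrightarrow> \<beta> (gradient \<gg> \<beta> F x) y = dir_deriv F x y"
proof -
  have "\<exists>u\<in>\<gg>. \<forall>y\<in>\<gg>. \<beta> u y = dir_deriv F x y"
    by (rule nondegenerate_represent[OF subspace_g])
      (auto simp: form_add form_scale dir_deriv_linear[OF assms] intro: form_sym form_nondeg)
  then obtain u where u: "u \<in> \<gg>" "\<And>y. y \<in> \<gg> \<Longrightarrow> \<beta> u y = dir_deriv F x y" by blast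
  have "gradient \<gg> \<beta> F x = u"
    unfolding gradient_def
  proof (rule the_equality)
    fix v assume v: "v \<in> \<gg> \<and> (\<forall>y\<in>\<gg>. \<beta> v y = dir_deriv F x y)"
    then have "v - u = 0"
      using u by (intro form_nondeg) (auto simp: g_diff form_diff)
    then show "v = u" by simp
  qed (use u in auto)
  then show "gradient \<gg> \<beta> F x \<in> \<gg>" "y \<in> \<gg> \<Longrightarrow> \<beta> (gradient \<gg> \<beta> F x) y = dir_deriv F x y"
    using u by simp_all
qed

text \<open>Invariance holds on the fibre only, so it controls the differential only in the
  directions \<open>mperp\<close> tangent to the fibre. The gradients are therefore related by
  \<open>Ad\<close> up to the orthogonal of \<open>mperp\<close>.\<close>

lemma gradient_equivariant_mod_m:
  assumes F: "cpoly F" "\<And>A x. A \<in> M \<Longrightarrow> x \<in> fib \<Longrightarrow> F (Ad A x) = F x"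
    and A: "A \<in> M" and x: "x \<in> fib"
  shows "Ad (matrix_inv A) (gradient \<gg> \<beta> F (Ad A x)) - gradient \<gg> \<beta> F x \<in> \<mm>"
proof (rule mperp_perp)
  let ?u = "gradient \<gg> \<beta> F x" and ?u' = "gradient \<gg> \<beta> F (Ad A x)"
  have AG: "A \<in> G" "matrix_inv A \<in> G" using M_G[OF A] algebraic_group_inv(1)[OF G] by auto
  have u: "?u \<in> \<gg>" "?u' \<in> \<gg>" using gradient(1)[OF F(1)] by auto
  then show "Ad (matrix_inv A) ?u' - ?u \<in> \<gg>" using AG by (simp add: g_diff g_Ad)
  fix v assume v: "v \<in> mperp"
  have vg: "v \<in> \<gg>" using v by (rule mperp_g)
  have "\<beta> (Ad (matrix_inv A) ?u') v = \<beta> ?u' (Ad A v)"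
    using form_Ad[OF AG(1) g_Ad[OF AG(2) u(2)] vg] by (simp add: Ad_inv[OF G AG(1)])
  also have "\<dots> = dir_deriv F (Ad A x) (Ad A v)"
    using gradient(2)[OF F(1)] g_Ad[OF AG(1) vg] by blast
  also have "\<dots> = dir_deriv F x v"
  proof -
    have "F (Ad A x + t \<bullet>\<^sub>C Ad A v) = F (x + t \<bullet>\<^sub>C v)" for t
    proof -
      have "x + t \<bullet>\<^sub>C v \<in> fib"
        using x v cmat.subspace_add[OF subspace_mperp, of "x - e" "t \<bullet>\<^sub>C v"] cmat.subspace_scale[OF subspace_mperp]
        by (simp add: fibre_iff algebra_simps)
      then show ?thesis using F(2)[OF A, of "x + t \<bullet>\<^sub>C v"] by simp
    qed
    then show ?thesis by (simp add: dir_deriv_def)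
  qed
  also have "\<dots> = \<beta> ?u v" using gradient(2)[OF F(1) vg] by simp
  finally show "\<beta> (Ad (matrix_inv A) ?u' - ?u) v = 0"
    using u AG vg by (simp add: form_diff g_Ad)
qed

text \<open>\<open>[y, x]\<close> is the velocity at \<open>0\<close> of the orbit curve
  \<open>Ad (exp (t y)) x\<close>, along which \<open>F\<close> is constant.\<close>

lemma invariant_deriv_zero:
  assumes F: "cpoly F" "\<And>A x. A \<in> M \<Longrightarrow> x \<in> fib \<Longrightarrow> F (Ad A x) = F x"
    and y: "y \<in> \<mm>" and x: "x \<in> fib"
  shows "dir_deriv F x (bracket y x) = 0"
proof -
  have nil: "mpow y K = 0" "mpow (- y) K = 0" using mpow_K[OF m_wle[OF y]] mpow_minus_eq_0 by auto
  define a where "a = (\<lambda>t. mexp K (t \<bullet>\<^sub>C y) ** x ** mexp K (t \<bullet>\<^sub>C (- y)))"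
  have const: "F (a t) = F x" for t
  proof -
    have ty: "t \<bullet>\<^sub>C y \<in> \<mm>" using y cmat.subspace_scale[OF subspace_m] by blast
    have "a t = Ad (mexp K (t \<bullet>\<^sub>C y)) x"
      using Ad_mexp[OF mpow_K[OF m_wle[OF ty]] K_pos, of x] by (simp add: a_def cmat.scale_minus_right)
    then show ?thesis using F(2)[OF mexp_M[OF ty] x] by simp
  qed
  have "has_mderiv a
      ((y ** mexp K (0 \<bullet>\<^sub>C y) ** x + mexp K (0 \<bullet>\<^sub>C y) ** 0) ** mexp K (0 \<bullet>\<^sub>C (- y))
        + mexp K (0 \<bullet>\<^sub>C y) ** x ** ((- y) ** mexp K (0 \<bullet>\<^sub>C (- y)))) 0"
    unfolding a_def by (intro has_mderiv_mult has_mderiv_const has_mderiv_mexp nil)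
  then have "has_mderiv a (bracket y x) 0"
    by (simp add: K_pos bracket_def matrix_mult_minus)
  from cpoly_chain[OF F(1) this] have "((\<lambda>t. F (a t)) has_field_derivative dir_deriv F x (bracket y x)) (at 0)"
    by (simp add: a_def K_pos)
  moreover have "((\<lambda>t. F (a t)) has_field_derivative 0) (at 0)" by (simp add: const)
  ultimately show ?thesis by (rule DERIV_unique)
qed

text \<open>Transported back by \<open>A\<close>, the gradients at \<open>Ad A x\<close> are
  \<open>u + y\<close> and \<open>v + z\<close> with \<open>y\<close> and \<open>z\<close> in
  \<open>\<mm>\<close>. The terms with a single error vanish by \<open>invariant_deriv_zero\<close>
  once the bracket is moved across the form; the term with \<open>[y, z]\<close> vanishes because
  \<open>[y, x]\<close> lies in \<open>mperp\<close>.\<close>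

lemma kks_bracket_invariant:
  assumes F: "cpoly F" "\<And>A x. A \<in> M \<Longrightarrow> x \<in> fib \<Longrightarrow> F (Ad A x) = F x"
    and H: "cpoly H" "\<And>A x. A \<in> M \<Longrightarrow> x \<in> fib \<Longrightarrow> H (Ad A x) = H x"
    and A: "A \<in> M" and x: "x \<in> fib"
  shows "kks_bracket \<gg> \<beta> F H (Ad A x) = kks_bracket \<gg> \<beta> F H x"
proof -
  let ?u = "gradient \<gg> \<beta> F x" and ?v = "gradient \<gg> \<beta> H x"
  let ?u' = "gradient \<gg> \<beta> F (Ad A x)" and ?v' = "gradient \<gg> \<beta> H (Ad A x)"
  define y where "y = Ad (matrix_inv A) ?u' - ?u"
  define z where "z = Ad (matrix_inv A) ?v' - ?v"
  have y: "y \<in> \<mm>" and z: "z \<in> \<mm>"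
    unfolding y_def z_def using gradient_equivariant_mod_m F H A x by blast+
  have AG: "A \<in> G" "matrix_inv A \<in> G" using M_G[OF A] algebraic_group_inv(1)[OF G] by auto
  have u: "?u \<in> \<gg>" "?u' \<in> \<gg>" "?v \<in> \<gg>" "?v' \<in> \<gg>" using gradient(1) F(1) H(1) by auto
  have xg: "x \<in> \<gg>" using x by (rule fibre_g)
  have zero: "\<beta> x (bracket w (gradient \<gg> \<beta> F' x)) = 0"
    if w: "w \<in> \<mm>" and F': "cpoly F'" "\<And>A x. A \<in> M \<Longrightarrow> x \<in> fib \<Longrightarrow> F' (Ad A x) = F' x" for w F'
  proof -
    have wx: "bracket w x \<in> \<gg>" using g_bracket[OF m_g[OF w] xg] .
    have "\<beta> (gradient \<gg> \<beta> F' x) (bracket w x) = 0"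
      using gradient(2)[OF F'(1) wx] invariant_deriv_zero[OF F' w x] by simp
    then show ?thesis
      using form_bracket[OF m_g[OF w] m_wle[OF w] xg gradient(1)[OF F'(1)]] form_sym[OF wx gradient(1)[OF F'(1)]] by simp
  qed
  have yz: "\<beta> x (bracket y z) = 0"
    using form_bracket[OF m_g[OF y] m_wle[OF y] xg m_g[OF z]] bracket_m_fibre[OF y x] z by (simp add: mperp_def)
  have "kks_bracket \<gg> \<beta> F H (Ad A x) = \<beta> (Ad A x) (bracket (Ad A (?u + y)) (Ad A (?v + z)))"
    by (simp add: kks_bracket_def y_def z_def Ad_inv[OF G AG(1)] del: Ad_linear)
  also have "\<dots> = \<beta> (Ad A x) (Ad A (bracket (?u + y) (?v + z)))"
    by (simp only: Ad_bracket[OF G AG(1)])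
  also have "\<dots> = \<beta> x (bracket (?u + y) (?v + z))"
    using form_Ad[OF AG(1) xg] u m_g[OF y] m_g[OF z] by (simp add: g_bracket g_add)
  also have "bracket (?u + y) (?v + z) = bracket ?u ?v + (bracket y ?v + (- bracket z ?u + bracket y z))"
    using bracket_swap[of ?u z] by (simp add: bracket_add_left bracket_add_right)
  also have "\<beta> x \<dots> = \<beta> x (bracket ?u ?v)"
    using xg u m_g[OF y] m_g[OF z] zero[OF y H] zero[OF z F] yz
    by (simp add: form_add_right form_diff_right g_bracket g_add g_diff)
  finally show ?thesis by (simp add: kks_bracket_def)
qed

text \<open>\<open>Ad (gam t)\<close> preserves \<open>\<mm>\<close> and commutes with the
  exponential, so the torus normalizes \<open>M\<close> and permutes its orbits.\<close>

lemma gam_conj_M: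
  assumes t: "t \<noteq> 0" and A: "A \<in> M"
  shows "Ad (gam t) A \<in> M" "Ad (gam t) (Ad A x) = Ad (Ad (gam t) A) (Ad (gam t) x)"
proof -
  obtain y where y: "y \<in> \<mm>" "A = mexp K y" using M_mexp[OF A] .
  show "Ad (gam t) A \<in> M"
    using mexp_M[OF Ad_gam_m[OF t y(1)]] Ad_mexp_commute[OF G gam_G[OF t]] by (simp add: y(2))
  have g: "gam t \<in> G" "matrix_inv (gam t) \<in> G" "A \<in> G"
    using gam_G[OF t] algebraic_group_inv(1)[OF G] M_G[OF A] by auto
  have "Ad (Ad (gam t) A) (Ad (gam t) x) = Ad (gam t ** (A ** matrix_inv (gam t))) (Ad (gam t) x)"
    by (simp add: Ad_def[of _ A] matrix_mul_assoc)
  also have "\<dots> = Ad (gam t) (Ad A x)"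
    using g by (simp add: Ad_mult[OF G] Ad_inv[OF G] algebraic_group_mult[OF G])
  finally show "Ad (gam t) (Ad A x) = Ad (Ad (gam t) A) (Ad (gam t) x)" by simp
qed

lemma kazhdan_e: "t \<noteq> 0 \<Longrightarrow> (t ^ 2) \<bullet>\<^sub>C Ad (gam (inverse t)) e = e"
proof -
  assume t: "t \<noteq> 0"
  then have "t ^ 2 * (inverse t) ^ 2 = 1" by (simp flip: power_mult_distrib)
  then show ?thesis using t by (simp add: Ad_gam_homogeneous[of "inverse t" 2] cscale_cscale cmat.scale_one)
qed

end

section \<open>Slices\<close>

locale slice = kazhdan_setting P N G e f \<beta> \<ll> M
  for P :: "int \<Rightarrow> ('n::finite,'n) cmat" and N G e f \<beta> \<ll> M +
  fixes C :: "('n,'n) cmat set"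
  assumes subspace_C: "cmat.subspace C" and C_g: "C \<subseteq> lie_algebra G"
    and C_stable: "\<And>x. x \<in> C \<Longrightarrow> bracket hh x \<in> C"
    and decomposition: "lie_algebra G = {bracket x e + c |x c. x \<in> lie_algebra G \<and> c \<in> C}"
    and direct: "(\<lambda>x. bracket x e) ` lie_algebra G \<inter> C = {0}"
begin

definition S :: "('n,'n) cmat set" where "S = {e + c |c. c \<in> C}"

lemma S_iff: "x \<in> S \<longleftrightarrow> x - e \<in> C"
proof -
  have "x = e + (x - e)" by simp
  then show ?thesis unfolding S_def by force
qed

lemma C_wcomp: "c \<in> C \<Longrightarrow> wcomp i c \<in> C"
  by (rule wcomp_in_stable[OF subspace_C]) (simp_all add: C_stable)

lemma C_image: "x \<in> \<gg> \<Longrightarrow> bracket x e \<in> C \<Longrightarrow> bracket x e = 0"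
  using direct by blast

text \<open>By \<open>ad_e_surjective\<close> every positive weight lies in
  \<open>[\<gg>, e]\<close>, which meets \<open>C\<close> only in \<open>0\<close>; and
  \<open>C\<close> contains the components of its elements. This puts all slices into the same
  fibre.\<close>

lemma C_wle:
  assumes c: "c \<in> C"
  shows "c \<in> wle 0"
  unfolding wle_iff_comp
proof (intro allI impI)
  fix j :: int assume "j > 0"
  then obtain y where "y \<in> \<gg>" "bracket y e = wcomp j c"
    using ad_e_surjective[of "wcomp j c" j] C_wcomp[OF c] C_g by (auto simp: wcomp_comp)
  then show "wcomp j c = 0" using C_image C_wcomp[OF c] by metis
qed

lemma C_mperp: "c \<in> C \<Longrightarrow> c \<in> mperp"
  using C_g C_wle by (intro wle_0_mperp) auto

lemma S_fib: "x \<in> S \<Longrightarrow> x \<in> fib"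
  by (simp add: S_iff fibre_iff C_mperp)

text \<open>Decompose \<open>v = [x, e] + c\<close> in \<open>\<gg>\<close> and discard the weights
  of \<open>x\<close> that cannot contribute to \<open>v\<close>; the difference stays in
  \<open>C\<close>, which is graded. The weight \<open>-1\<close> part of the truncation is in the
  symplectic complement of \<open>\<ll>\<close> because \<open>v\<close> is orthogonal to
  \<open>\<ll>\<close>, so the truncation lies in \<open>\<mm>\<close>.\<close>

lemma mperp_decomposition:
  assumes v: "v \<in> mperp" "v \<in> wle i"
  shows "\<exists>y\<in>\<mm>. y \<in> wle (i - 2) \<and> v - bracket y e \<in> C"
proof -
  obtain x c where x: "x \<in> \<gg>" and c: "c \<in> C" and vxc: "v = bracket x e + c"
    using mperp_g[OF v(1)] decomposition by blast
  \<comment> \<open>\<open>v\<close> has no weights above \<open>min 1 i\<close>, and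
    \<open>ad e\<close> raises weights by \<open>2\<close>.\<close>
  define k where "k = min (-1) (i - 2)"
  define y where "y = (\<Sum>j\<in>{-(2*N)..2*N} \<inter> {..k}. wcomp j x)"
  have yg: "y \<in> \<gg>" unfolding y_def using x by (intro g_sum g_wcomp)
  have y_comp: "wcomp j y = (if j \<le> k then wcomp j x else 0)" for j
  proof -
    have "wcomp j y = (\<Sum>l\<in>{-(2*N)..2*N} \<inter> {..k}. if l = j then wcomp j x else 0)"
      unfolding y_def wcomp_sum by (intro sum.cong) (auto simp: wcomp_comp)
    then show ?thesis using wcomp_out[of j x] by (auto simp: sum.delta)
  qed
  have yk: "y \<in> wle k" by (simp add: wle_iff_comp y_comp)
  then have yw: "y \<in> wle (-1)" "y \<in> wle (i - 2)" using wle_mono[of y k] by (auto simp: k_def)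
  have "wcomp j (v - bracket y e) \<in> C" for j
  proof (cases "j - 2 \<le> k")
    case True
    then have "wcomp j (v - bracket y e) = wcomp j c"
      by (simp add: vxc wcomp_bracket_e y_comp)
    then show ?thesis using C_wcomp[OF c] by simp
  next
    case False
    then have "wcomp j v = 0"
      using v mperp_wle_1[OF v(1)] by (auto simp: wle_iff_comp k_def)
    then show ?thesis
      using False by (simp add: wcomp_bracket_e y_comp cmat.subspace_0[OF subspace_C])
  qed
  then have "(\<Sum>j\<in>{-(2*N)..2*N}. wcomp j (v - bracket y e)) \<in> C"
    by (intro cmat.subspace_sum[OF subspace_C])
  then have vy: "v - bracket y e \<in> C" unfolding sum_comp .
  let ?w = "wcomp (-1) y"
  have wg: "?w \<in> \<gg>" "?w \<in> wle (-1)" using yg by (simp_all add: g_wcomp wcomp_in_wle)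
  \<comment> \<open>\<open>C\<close> has no weight \<open>1\<close>, so the weight \<open>1\<close>
    part of \<open>v\<close> is exactly \<open>[?w, e]\<close>.\<close>
  have "wcomp 1 (v - bracket y e) = 0" using C_wle[OF vy] by (simp add: wle_iff_comp del: wcomp_linear)
  then have we: "bracket ?w e = wcomp 1 v" using wcomp_bracket_e[of 1 y] by simp
  have "\<beta> e (bracket ?w z) = 0" if z: "z \<in> \<ll>" for z
  proof -
    have "z \<in> \<mm>" using z by (simp add: m_eq l_g l_wle l_weight)
    then have "\<beta> (wcomp 1 v) z = 0"
      using form_homogeneous[OF mperp_g[OF v(1)] l_g[OF z] l_weight[OF z]] v(1) by (simp add: mperp_def)
    then show ?thesis using form_bracket[OF wg e_g l_g[OF z]] by (simp add: we)
  qed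
  then have "?w \<in> \<ll>" using l_iff[of ?w] wg by (simp add: wcomp_comp)
  then have "y \<in> \<mm>" using yg yw by (simp add: m_eq)
  then show ?thesis using yw vy by blast
qed

definition T :: "('n,'n) cmat \<Rightarrow> ('n,'n) cmat"
  where "T v = (THE y. y \<in> \<mm> \<and> v - bracket y e \<in> C)"

text \<open>Two candidates differ by an element of \<open>\<mm>\<close> whose bracket with
  \<open>e\<close> lies in \<open>C\<close> and in \<open>[\<gg>, e]\<close>, hence is
  \<open>0\<close>; and \<open>ad e\<close> is injective on negative weights.\<close>

lemma T_eq:
  assumes y: "y \<in> \<mm>" "v - bracket y e \<in> C"
  shows "T v = y"
  unfolding T_def
proof (rule the_equality)
  fix z assume z: "z \<in> \<mm> \<and> v - bracket z e \<in> C"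
  have "bracket (y - z) e = (v - bracket z e) - (v - bracket y e)" by (simp add: bracket_diff_left)
  then have "bracket (y - z) e \<in> C" using y z cmat.subspace_diff[OF subspace_C] by metis
  then have "bracket (y - z) e = 0" using y z C_image[of "y - z"] by (simp add: g_diff m_g)
  then have "y - z = 0" using y z by (intro ad_e_injective[of "y - z"]) (auto intro: wle_closed m_wle)
  then show "z = y" by simp
qed (use y in simp)

lemma T_mperp:
  assumes v: "v \<in> mperp"
  shows "T v \<in> \<mm>" "v - bracket (T v) e \<in> C"
proof -
  obtain y where y: "y \<in> \<mm>" "v - bracket y e \<in> C"
    using mperp_decomposition[OF v mperp_wle_1[OF v]] by blast
  from T_eq[OF this] y show "T v \<in> \<mm>" "v - bracket (T v) e \<in> C" by simp_all
qed

lemma T_wle: "v \<in> mperp \<Longrightarrow> v \<in> wle i \<Longrightarrow> T v \<in> wle (i - 2)"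
  using mperp_decomposition[of v i] T_eq by blast

text \<open>Uniqueness makes \<open>T\<close> linear on \<open>mperp\<close>, and a linear extension
  to all matrices is polynomial.\<close>

lemma T_poly:
  obtains T' where "poly_map T'" "\<And>v. v \<in> mperp \<Longrightarrow> T' v = T v"
proof (rule poly_map_extend[OF subspace_mperp])
  show "T (v + w) = T v + T w" if "v \<in> mperp" "w \<in> mperp" for v w
  proof (rule T_eq)
    show "T v + T w \<in> \<mm>" using T_mperp that cmat.subspace_add[OF subspace_m] by blast
    have "v + w - bracket (T v + T w) e = (v - bracket (T v) e) + (w - bracket (T w) e)"
      by (simp add: bracket_add_left)
    then show "v + w - bracket (T v + T w) e \<in> C"
      using T_mperp(2)[OF that(1)] T_mperp(2)[OF that(2)] cmat.subspace_add[OF subspace_C] by metis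
  qed
  show "T (k \<bullet>\<^sub>C v) = k \<bullet>\<^sub>C T v" if "v \<in> mperp" for k v
  proof (rule T_eq)
    show "k \<bullet>\<^sub>C T v \<in> \<mm>" using T_mperp that cmat.subspace_scale[OF subspace_m] by blast
    have "k \<bullet>\<^sub>C v - bracket (k \<bullet>\<^sub>C T v) e = k \<bullet>\<^sub>C (v - bracket (T v) e)"
      by (simp add: cmat.scale_right_diff_distrib)
    then show "k \<bullet>\<^sub>C v - bracket (k \<bullet>\<^sub>C T v) e \<in> C"
      using T_mperp(2)[OF that] cmat.subspace_scale[OF subspace_C] by metis
  qed
qed (use that in blast)

text \<open>
  One step lowers by one the largest weight at which a point of the fibre fails to lie on the slice;
  finitely many steps project the fibre onto the slice along the orbits of \<open>M\<close>.
\<close>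

lemma lower_weight:
  assumes x: "x \<in> fib" and c: "c \<in> C" "x - e - c \<in> wle i" and i: "i \<le> 1"
  shows "\<exists>c'\<in>C. Ad (mexp K (- T (x - e))) x - e - c' \<in> wle (i - 1)"
proof -
  let ?y = "T (x - e)"
  have xe: "x - e \<in> mperp" using x by (simp add: fibre_iff)
  have v: "x - e - c \<in> mperp" using xe C_mperp[OF c(1)] cmat.subspace_diff[OF subspace_mperp] by blast
  define c' where "c' = x - e - bracket ?y e"
  have c': "c' \<in> C" unfolding c'_def using T_mperp(2)[OF xe] .
  have "(x - e - c) - bracket ?y e \<in> C"
    using cmat.subspace_diff[OF subspace_C c' c(1)] by (simp add: c'_def algebra_simps)
  \<comment> \<open>\<open>T\<close> ignores elements of \<open>C\<close>, so the weight bound on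
    \<open>x - e - c\<close> passes to \<open>?y\<close>.\<close>
  then have "T (x - e - c) = ?y" using T_eq T_mperp(1)[OF xe] by blast
  then have y: "?y \<in> wle (i - 2)" using T_wle[OF v c(2)] by simp
  \<comment> \<open>With \<open>k = 2 - i\<close> the remainder has weights at most
    \<open>2 - 2 * k = 2 * i - 2\<close>, which is at most \<open>i - 1\<close> because
    \<open>i \<le> 1\<close>.\<close>
  have "Ad (mexp K (- ?y)) x - x - bracket (- ?y) x \<in> wle (2 - 2 * (2 - i))"
    using y i fibre_wle[OF x] by (intro Ad_mexp_wle) auto
  then have "Ad (mexp K (- ?y)) x - x + bracket ?y x \<in> wle (i - 1)"
    using i wle_mono[of _ "2 - 2 * (2 - i)" "i - 1"] by simp
  moreover have "bracket ?y (x - e) \<in> wle (i - 1)"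
    using wle_bracket[OF y mperp_wle_1[OF xe]] by simp
  ultimately have "(Ad (mexp K (- ?y)) x - x + bracket ?y x) - bracket ?y (x - e) \<in> wle (i - 1)"
    by (rule wle_closed)
  then have "Ad (mexp K (- ?y)) x - e - c' \<in> wle (i - 1)"
    by (simp add: c'_def bracket_diff_right algebra_simps)
  then show ?thesis using c' by blast
qed

text \<open>The number of steps is the same for all points, so iterating the single polynomial map
  \<open>R\<close> gives a polynomial map; each step conjugates by an element of \<open>M\<close>
  that depends on the point.\<close>

lemma retraction:
  obtains \<alpha> where "poly_map \<alpha>" "\<And>x. x \<in> fib \<Longrightarrow> \<alpha> x \<in> S" "\<And>x. x \<in> fib \<Longrightarrow> \<exists>A\<in>M. \<alpha> x = Ad A x"
proof -
  obtain T' where T': "poly_map T'" "\<And>v. v \<in> mperp \<Longrightarrow> T' v = T v" by (rule T_poly) blast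
  define R where "R = (\<lambda>x. mexp K (- T' (x - e)) ** x ** mexp K (T' (x - e)))"
  have t: "poly_map (\<lambda>x. T' (x - e))"
    by (rule poly_map_comp[OF T'(1)]) (intro poly_map_diff poly_map_id poly_map_const)
  have R_poly: "poly_map R"
    unfolding R_def by (intro poly_map_mult poly_map_mexp poly_map_minus t poly_map_id)
  have R: "R x = Ad (mexp K (- T (x - e))) x" "mexp K (- T (x - e)) \<in> M" if "x \<in> fib" for x
  proof -
    have xe: "x - e \<in> mperp" using that by (simp add: fibre_iff)
    have m: "- T (x - e) \<in> \<mm>" using T_mperp(1)[OF xe] cmat.subspace_neg[OF subspace_m] by blast
    then show "mexp K (- T (x - e)) \<in> M" by (rule mexp_M)
    show "R x = Ad (mexp K (- T (x - e))) x"
      using Ad_mexp[OF mpow_K[OF m_wle[OF m]] K_pos, of x] by (simp add: R_def T'(2)[OF xe])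
  qed
  have iter: "(R ^^ k) x \<in> fib \<and> (\<exists>A\<in>M. (R ^^ k) x = Ad A x) \<and> (\<exists>c\<in>C. (R ^^ k) x - e - c \<in> wle (1 - int k))"
    if x: "x \<in> fib" for x k
  proof (induction k)
    case 0
    have "x - e \<in> wle 1" using x fibre_iff mperp_wle_1 by blast
    moreover have "mat 1 \<in> M" using M_group by (simp add: algebraic_group_def)
    ultimately have "\<exists>A\<in>M. x = Ad A x" "\<exists>c\<in>C. x - e - c \<in> wle 1"
      using cmat.subspace_0[OF subspace_C] by (metis Ad_mat_1, metis diff_zero)
    then show ?case using x by simp
  next
    case (Suc k)
    let ?x = "(R ^^ k) x"
    obtain A c where IH: "?x \<in> fib" "A \<in> M" "?x = Ad A x" "c \<in> C" "?x - e - c \<in> wle (1 - int k)"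
      using Suc by blast
    let ?B = "mexp K (- T (?x - e))"
    have RB: "R ?x = Ad ?B ?x" "?B \<in> M" using R[OF IH(1)] by auto
    then have "R ?x = Ad (?B ** A) x" "?B ** A \<in> M" "R ?x \<in> fib"
      using Ad_mult[OF M_group RB(2) IH(2)] algebraic_group_mult[OF M_group RB(2) IH(2)] IH M_fibre by simp_all
    moreover have "\<exists>c'\<in>C. R ?x - e - c' \<in> wle (1 - int k - 1)"
      using lower_weight[OF IH(1,4,5)] RB(1) by simp
    moreover have "1 - int k - 1 = 1 - int (Suc k)" by simp
    ultimately show ?case by (metis funpow.simps(2) o_apply)
  qed
  have "poly_map (R ^^ k)" for k
  proof (induction k)
    case 0
    then show ?case using poly_map_id by (simp add: id_def)
  next
    case (Suc k)
    then show ?case using poly_map_comp[OF R_poly] by (simp add: o_def)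
  qed
  \<comment> \<open>Starting in weight \<open>1\<close>, this many steps reach
    \<open>wle (- 2 * N - 1)\<close>, which is zero.\<close>
  moreover have "(R ^^ nat (2 * N + 2)) x \<in> S" if x: "x \<in> fib" for x
  proof -
    obtain c where "c \<in> C" "(R ^^ nat (2 * N + 2)) x - e - c \<in> wle (1 - int (nat (2 * N + 2)))"
      using iter[OF x] by blast
    moreover have "wle (1 - int (nat (2 * N + 2))) = {0}" using N_nonneg by (intro wle_trivial) simp
    ultimately show ?thesis by (simp add: S_iff)
  qed
  ultimately show thesis using iter that[of "R ^^ nat (2 * N + 2)"] by blast
qed

text \<open>Let \<open>A = exp y\<close> with \<open>y\<close> in \<open>wle (- k)\<close> and
  leading component \<open>y'\<close>. In weight \<open>2 - k\<close> the difference
  \<open>Ad A x - x\<close> is \<open>[y', e]\<close>, since the other contributions are lower. It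
  lies in \<open>C\<close> and in \<open>[\<gg>, e]\<close>, hence is \<open>0\<close>; injectivity
  of \<open>ad e\<close> pushes \<open>y\<close> one weight down, until nothing is left.\<close>

lemma slice_meets_orbit_once:
  assumes x: "x \<in> S" and A: "A \<in> M" and Ax: "Ad A x \<in> S"
  shows "Ad A x = x"
proof -
  obtain y where y: "y \<in> \<mm>" "A = mexp K y" using M_mexp[OF A] .
  define d where "d = Ad A x - x"
  have d: "d \<in> C"
    using cmat.subspace_diff[OF subspace_C Ax[unfolded S_iff] x[unfolded S_iff]] by (simp add: d_def)
  have xw: "x \<in> wle 2" using fibre_wle S_fib x by blast
  have "y \<in> wle (- int (Suc k))" for k
  proof (induction k)
    case 0
    then show ?case using m_wle[OF y(1)] by simp
  next
    case (Suc k)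
    let ?k = "int (Suc k)"
    have "d - bracket y x \<in> wle (2 - 2 * ?k)"
      unfolding d_def y(2) using Suc xw by (intro Ad_mexp_wle) auto
    then have "wcomp (2 - ?k) (d - bracket y x) = 0" by (simp add: wle_iff_comp del: wcomp_linear)
    moreover have "bracket y (x - e) \<in> wle (- ?k)"
      using wle_bracket[OF Suc C_wle[OF x[unfolded S_iff]]] by simp
    then have "wcomp (2 - ?k) (bracket y (x - e)) = 0" by (simp add: wle_iff_comp del: wcomp_linear)
    moreover have "d - bracket y x + bracket y (x - e) = d - bracket y e" by (simp add: bracket_diff_right)
    ultimately have "wcomp (2 - ?k) (d - bracket y e) = 0" by (metis add.right_neutral wcomp_linear(1))
    then have eq: "bracket (wcomp (- ?k) y) e = wcomp (2 - ?k) d"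
      using wcomp_bracket_e[of "2 - ?k" y] by simp
    then have "bracket (wcomp (- ?k) y) e = 0"
      using C_image[OF g_wcomp[OF m_g[OF y(1)]]] C_wcomp[OF d] by metis
    moreover have "wcomp (- ?k) y \<in> wle (-1)" using wle_mono[OF wcomp_in_wle[of "- ?k" y], of "-1"] by simp
    ultimately have "wcomp (- ?k) y = 0" using ad_e_injective by blast
    then show ?case using wle_lower[OF Suc] by simp
  qed
  from this[of "nat (2 * N + 1)"] have "y = 0"
    using wle_trivial[of "- int (Suc (nat (2 * N + 1)))"] N_nonneg by auto
  then show ?thesis by (simp add: y(2) K_pos)
qed

lemma orbit_slice_unique:
  assumes "Ad A x \<in> S" "Ad B x \<in> S" and A: "A \<in> M" and B: "B \<in> M"
  shows "Ad A x = Ad B x"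
proof -
  have Bi: "matrix_inv B \<in> M" using algebraic_group_inv(1)[OF M_group B] .
  have "Ad (A ** matrix_inv B) (Ad B x) = Ad A x"
    by (simp add: Ad_mult[OF M_group A Bi] Ad_inv[OF M_group B])
  then show ?thesis
    using slice_meets_orbit_once[OF assms(2) algebraic_group_mult[OF M_group A Bi]] assms(1) by simp
qed

text \<open>\<open>e\<close> is fixed by the action, and \<open>C\<close> is the sum of its weight
  components, on each of which the action is a scalar.\<close>

lemma kazhdan_S:
  assumes t: "t \<noteq> 0" and x: "x \<in> S"
  shows "(t ^ 2) \<bullet>\<^sub>C Ad (gam (inverse t)) x \<in> S"
proof -
  define c where "c = x - e"
  have c: "c \<in> C" using x by (simp add: S_iff c_def)
  have "wcomp i (Ad (gam (inverse t)) c) \<in> C" for i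
    using t C_wcomp[OF c] by (simp add: wcomp_Ad_gam cmat.subspace_scale[OF subspace_C])
  then have "(\<Sum>i\<in>{-(2*N)..2*N}. wcomp i (Ad (gam (inverse t)) c)) \<in> C"
    by (intro cmat.subspace_sum[OF subspace_C])
  then have "(t ^ 2) \<bullet>\<^sub>C Ad (gam (inverse t)) c \<in> C"
    unfolding sum_comp by (rule cmat.subspace_scale[OF subspace_C])
  moreover have "(t ^ 2) \<bullet>\<^sub>C Ad (gam (inverse t)) c = (t ^ 2) \<bullet>\<^sub>C Ad (gam (inverse t)) x - e"
    by (simp add: c_def cmat.scale_right_diff_distrib kazhdan_e[OF t])
  ultimately show ?thesis by (simp add: S_iff)
qed

end

section \<open>The isomorphism\<close>

context kazhdan_setting
begin

text \<open>
  Two slices are identified by following the orbits of \<open>M\<close>. A function on one slice and its pullback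
  to the other then have literally the same invariant representatives.
\<close>

lemma slices_isomorphic:
  assumes "slice P N G e f \<beta> \<ll> M C1" "slice P N G e f \<beta> \<ll> M C2"
  defines "S1 \<equiv> {e + c |c. c \<in> C1}" and "S2 \<equiv> {e + c |c. c \<in> C2}"
  shows "\<exists>\<phi>. poisson_iso S1 (slice_bracket \<gg> \<beta> fib M S1) S2 (slice_bracket \<gg> \<beta> fib M S2) \<phi> \<and>
    (\<forall>t x. t \<noteq> 0 \<and> x \<in> S1 \<longrightarrow>
      \<phi> ((t ^ 2) \<bullet>\<^sub>C Ad (gam (inverse t)) x) = (t ^ 2) \<bullet>\<^sub>C Ad (gam (inverse t)) (\<phi> x))"
proof -
  interpret A: slice P N G e f \<beta> \<ll> M C1 by (rule assms(1))
  interpret B: slice P N G e f \<beta> \<ll> M C2 by (rule assms(2))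
  have S1: "S1 = A.S" and S2: "S2 = B.S" by (simp_all add: S1_def S2_def A.S_def B.S_def)
  obtain \<psi> where psi: "poly_map \<psi>" "\<And>x. x \<in> fib \<Longrightarrow> \<psi> x \<in> S1" "\<And>x. x \<in> fib \<Longrightarrow> \<exists>A\<in>M. \<psi> x = Ad A x"
    unfolding S1 by (rule A.retraction) blast
  obtain \<phi> where phi: "poly_map \<phi>" "\<And>x. x \<in> fib \<Longrightarrow> \<phi> x \<in> S2" "\<And>x. x \<in> fib \<Longrightarrow> \<exists>A\<in>M. \<phi> x = Ad A x"
    unfolding S2 by (rule B.retraction) blast
  have fib: "x \<in> fib" if "x \<in> S1 \<or> x \<in> S2" for x
    using that A.S_fib B.S_fib unfolding S1 S2 by blast
  have one: "mat 1 \<in> M" using M_group by (simp add: algebraic_group_def)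
  \<comment> \<open>Exhibiting one element of \<open>M\<close> that moves \<open>x\<close> into the
    slice determines the image; the inverse property, invariance and equivariance are all read off
    from this.\<close>
  have phi_unique: "\<phi> x = Ad A x" if "x \<in> fib" "A \<in> M" "Ad A x \<in> S2" for A x
    using phi(2,3)[OF that(1)] that(2,3) B.orbit_slice_unique[of _ x A] unfolding S2 by metis
  have psi_unique: "\<psi> x = Ad A x" if "x \<in> fib" "A \<in> M" "Ad A x \<in> S1" for A x
    using psi(2,3)[OF that(1)] that(2,3) A.orbit_slice_unique[of _ x A] unfolding S1 by metis
  have phi_inv: "\<phi> (Ad A x) = \<phi> x" if A: "A \<in> M" and x: "x \<in> fib" for A x
  proof -
    obtain B where B: "B \<in> M" "\<phi> (Ad A x) = Ad B (Ad A x)" using phi(3)[OF M_fibre[OF A x]] by blast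
    have "\<phi> x = Ad (B ** A) x"
      using phi(2)[OF M_fibre[OF A x]] B A x
      by (intro phi_unique) (simp_all add: Ad_mult[OF M_group] algebraic_group_mult[OF M_group])
    then show ?thesis using B A by (simp add: Ad_mult[OF M_group])
  qed
  have phi_S2: "\<phi> y = y" if "y \<in> S2" for y
    using phi_unique[of y "mat 1"] that fib one by simp
  have psi_phi: "\<psi> (\<phi> x) = x" if x: "x \<in> S1" for x
  proof -
    obtain B where B: "B \<in> M" "\<phi> x = Ad B x" using phi(3) fib x by blast
    have "\<psi> (\<phi> x) = Ad (matrix_inv B) (\<phi> x)"
      using B x phi(2)[of x] fib algebraic_group_inv(1)[OF M_group B(1)]
      by (intro psi_unique) (auto simp: Ad_inv[OF M_group B(1)])
    then show ?thesis using B by (simp add: Ad_inv[OF M_group B(1)])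
  qed
  have phi_psi: "\<phi> (\<psi> y) = y" if y: "y \<in> S2" for y
  proof -
    obtain B where B: "B \<in> M" "\<psi> y = Ad B y" using psi(3) fib y by blast
    have "\<phi> (\<psi> y) = Ad (matrix_inv B) (\<psi> y)"
      using B y psi(2)[of y] fib algebraic_group_inv(1)[OF M_group B(1)]
      by (intro phi_unique) (auto simp: Ad_inv[OF M_group B(1)])
    then show ?thesis using B by (simp add: Ad_inv[OF M_group B(1)])
  qed
  have regular: "regular_map V \<eta>" if "poly_map \<eta>" for V and \<eta> :: "('n,'n) cmat \<Rightarrow> ('n,'n) cmat"
    using that by (auto simp: regular_map_def regular_fun_def poly_map_def)
  have iso: "variety_iso S1 S2 \<phi>"
    unfolding variety_iso_def
    using regular[OF phi(1)] regular[OF psi(1)] phi(2) psi(2) psi_phi phi_psi fib by (auto intro!: exI[of _ \<psi>])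
  have same: "invariant_representative fib M S1 (F \<circ> \<phi>) = invariant_representative fib M S2 F" for F
  proof (rule ext, rule iffI)
    fix F' assume *: "invariant_representative fib M S1 (F \<circ> \<phi>) F'"
    have "F' y = F y" if y: "y \<in> S2" for y
    proof -
      have py: "\<psi> y \<in> S1" using psi(2) fib y by blast
      obtain A where A: "A \<in> M" "\<psi> y = Ad A y" using psi(3) fib y by blast
      have "F' y = F' (\<psi> y)" using * A fib y by (simp add: invariant_representative_def)
      also have "\<dots> = F y" using * py phi_psi[OF y] by (simp add: invariant_representative_def)
      finally show ?thesis .
    qed
    then show "invariant_representative fib M S2 F F'" using * by (simp add: invariant_representative_def)
  next
    fix F' assume *: "invariant_representative fib M S2 F F'"
    have "F' x = F (\<phi> x)" if x: "x \<in> S1" for x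
    proof -
      obtain A where A: "A \<in> M" "\<phi> x = Ad A x" using phi(3) fib x by blast
      have "F' x = F' (\<phi> x)" using * A fib x by (simp add: invariant_representative_def)
      also have "\<dots> = F (\<phi> x)" using * phi(2) fib x by (simp add: invariant_representative_def)
      finally show ?thesis .
    qed
    then show "invariant_representative fib M S1 (F \<circ> \<phi>) F'" using * by (simp add: invariant_representative_def)
  qed
  \<comment> \<open>The witness is the pullback of \<open>F\<close> along the projection: constant
    on orbits by \<open>phi_inv\<close>, unchanged on \<open>S2\<close> by
    \<open>phi_S2\<close>.\<close>
  have ex: "invariant_representative fib M S2 F (SOME F'. invariant_representative fib M S2 F F')"
    if F: "regular_fun S2 F" for F
  proof -
    obtain p where p: "cpoly p" "\<forall>y\<in>S2. F y = p y" using F by (auto simp: regular_fun_def)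
    have "invariant_representative fib M S2 F (\<lambda>x. p (\<phi> x))"
      using p cpoly_comp[OF p(1) phi(1)] phi_inv phi_S2 by (simp add: invariant_representative_def)
    then show ?thesis by (rule someI[of "invariant_representative fib M S2 F"])
  qed
  have "slice_bracket \<gg> \<beta> fib M S1 (F \<circ> \<phi>) (H \<circ> \<phi>) x = slice_bracket \<gg> \<beta> fib M S2 F H (\<phi> x)"
    if F: "regular_fun S2 F" and H: "regular_fun S2 H" and x: "x \<in> S1" for F H x
  proof -
    obtain A where A: "A \<in> M" "\<phi> x = Ad A x" using phi(3) fib x by blast
    have "kks_bracket \<gg> \<beta> F' H' (\<phi> x) = kks_bracket \<gg> \<beta> F' H' x"
      if "invariant_representative fib M S2 F F'" "invariant_representative fib M S2 H H'" for F' H'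
      unfolding A(2) using that A(1) fib x
      by (intro kks_bracket_invariant) (auto simp: invariant_representative_def)
    \<comment> \<open>By \<open>same\<close> the two \<open>SOME\<close> choices coincide, so only
      values of one function at two points of the same orbit are compared.\<close>
    from this[OF ex[OF F] ex[OF H]] show ?thesis
      unfolding slice_bracket_def same by (rule sym)
  qed
  then have poisson: "poisson_iso S1 (slice_bracket \<gg> \<beta> fib M S1) S2 (slice_bracket \<gg> \<beta> fib M S2) \<phi>"
    using iso by (simp add: poisson_iso_def)
  have "\<phi> ((t ^ 2) \<bullet>\<^sub>C Ad (gam (inverse t)) x) = (t ^ 2) \<bullet>\<^sub>C Ad (gam (inverse t)) (\<phi> x)"
    if t: "t \<noteq> 0" and x: "x \<in> S1" for t x
  proof -
    let ?x = "(t ^ 2) \<bullet>\<^sub>C Ad (gam (inverse t)) x"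
    obtain A where A: "A \<in> M" "\<phi> x = Ad A x" using phi(3) fib x by blast
    have t': "inverse t \<noteq> 0" using t by simp
    \<comment> \<open>The element of \<open>M\<close> that moves the transformed point to its
      transformed image.\<close>
    let ?A = "Ad (gam (inverse t)) A"
    have eq: "(t ^ 2) \<bullet>\<^sub>C Ad (gam (inverse t)) (\<phi> x) = Ad ?A ?x"
      using gam_conj_M(2)[OF t' A(1), of x] by (simp add: A(2))
    have "\<phi> ?x = Ad ?A ?x"
    proof (rule phi_unique)
      show "?x \<in> fib" using A.kazhdan_S[OF t] x fib unfolding S1 by blast
      show "?A \<in> M" using gam_conj_M(1)[OF t' A(1)] .
      show "Ad ?A ?x \<in> S2"
        unfolding eq[symmetric] S2 using B.kazhdan_S[OF t] phi(2) x fib unfolding S2 by blast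
    qed
    then show ?thesis by (rule trans[OF _ eq[symmetric]])
  qed
  then show ?thesis using poisson by blast
qed

end

theorem theorem5p5:
  fixes G M \<gg> \<ll> \<mm> fibre \<M>\<^sub>1 \<M>\<^sub>2 :: "('n::finite, 'n) cmat set"
    and e h f :: "('n, 'n) cmat"
    and \<beta> :: "('n, 'n) cmat \<Rightarrow> ('n, 'n) cmat \<Rightarrow> complex"
    and \<Phi> :: "(2, 2) cmat \<Rightarrow> ('n, 'n) cmat"
  assumes reductive: "reductive_group G"
    and lie: "\<gg> = lie_algebra G"
    and e_nilpotent: "e \<in> \<gg>" "nilpotent_mat e" "e \<noteq> 0"
    and triple: "sl2_triple \<gg> e h f"
    and sl2: "sl2_hom G e h f \<Phi>"
    and form: "nondeg_invariant_form G \<beta>"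
    and lagr: "lagrangian \<gg> \<beta> e h \<ll>"
    and m_def: "\<mm> = premet_subalgebra \<gg> h \<ll>"
    and M_unipotent: "unipotent_group M" "M \<subseteq> G" "lie_algebra M = \<mm>"
    and fibre: "fibre = moment_fibre \<gg> \<beta> \<mm> e"
    and slices: "mv_slice \<gg> e h \<M>\<^sub>1" "mv_slice \<gg> e h \<M>\<^sub>2"
  shows "\<exists>\<phi>. poisson_iso \<M>\<^sub>1 (slice_bracket \<gg> \<beta> fibre M \<M>\<^sub>1)
                          \<M>\<^sub>2 (slice_bracket \<gg> \<beta> fibre M \<M>\<^sub>2) \<phi> \<and>
             (\<forall>t x. t \<noteq> 0 \<and> x \<in> \<M>\<^sub>1 \<longrightarrow> \<phi> (kazhdan \<Phi> t x) = kazhdan \<Phi> t (\<phi> x))"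
proof -
  have G: "algebraic_group G" using reductive by (simp add: reductive_group_def)
  \<comment> \<open>From here on \<open>hh\<close> stands for \<open>h\<close> and
    \<open>gam\<close> for the cocharacter.\<close>
  obtain P N where PN: "weight_grading P N" "h = weight_grading.hh P N"
    "\<And>t. t \<noteq> 0 \<Longrightarrow> cocharacter \<Phi> t = weight_grading.gam P N t"
    using sl2_hom_grading[OF G sl2] by blast
  interpret weight_grading P N by (rule PN(1))
  have "gam t \<in> G" if t: "t \<noteq> 0" for t
  proof -
    have "cocharacter \<Phi> t = \<Phi> (torus2 t)" by (simp add: cocharacter_def torus2_def)
    then show ?thesis
      using PN(3)[OF t] torus2_SL2[OF t] sl2 unfolding sl2_hom_def by auto
  qed
  then interpret kazhdan_setting P N G e f \<beta> \<ll> M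
    using G triple form lagr M_unipotent
    by unfold_locales (simp_all add: lie PN(2) m_def)
  have m: "\<mm> = kazhdan_setting.\<mm> P N G \<ll>"
    using m_def lie PN(2) \<mm>_def by simp
  have slice: "\<exists>C. slice P N G e f \<beta> \<ll> M C \<and> \<M> = {e + c |c. c \<in> C}" if mv: "mv_slice \<gg> e h \<M>" for \<M>
  proof -
    obtain C where C: "cmat.subspace C" "C \<subseteq> \<gg>" "\<forall>x\<in>C. bracket h x \<in> C"
      "\<gg> = {bracket x e + c |x c. x \<in> \<gg> \<and> c \<in> C}" "(\<lambda>x. bracket x e) ` \<gg> \<inter> C = {0}"
      "\<M> = {e + c |c. c \<in> C}"
      using mv unfolding mv_slice_def by (elim exE conjE) (rule that)
    note C' = C[unfolded lie PN(2)]
    have "slice P N G e f \<beta> \<ll> M C"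
      by unfold_locales (fact C'(1), fact C'(2), rule bspec[OF C'(3)], assumption, fact C'(4), fact C'(5))
    then show ?thesis using C(6) by blast
  qed
  obtain C1 C2 where C: "slice P N G e f \<beta> \<ll> M C1" "\<M>\<^sub>1 = {e + c |c. c \<in> C1}"
    "slice P N G e f \<beta> \<ll> M C2" "\<M>\<^sub>2 = {e + c |c. c \<in> C2}"
    using slice[OF slices(1)] slice[OF slices(2)] by blast
  have kz: "kazhdan \<Phi> t x = (t ^ 2) \<bullet>\<^sub>C Ad (gam (inverse t)) x" if "t \<noteq> 0" for t x
    using PN(3)[of "inverse t"] that by (simp add: kazhdan_def)
  show ?thesis
    using slices_isomorphic[OF C(1,3)] kz unfolding C(2,4) fibre m lie by simp
qed

end
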